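(* Let $z_0\in\mathbb C^*$. With the identification of $\mathrm{Aut}^{\otimes}(\omega)$ with $\mathbf Z^{alg}=\mathrm{Hom}_{grp}(\mathbb C^*,\mathbb C^* )\times\mathbb C$, and viewing $\mathrm{Aut}^{\otimes}(\omega^{(0)}_{z_0})$ as a subgroup of $\mathrm{Aut}^{\otimes}(\omega)$ by restriction along $\mathcal R\to\mathcal P^{(0)}$, one has $$\mathrm{Aut}^{\otimes}(\omega^{(0)}_{z_0})=\{(\gamma,\lambda)\in\mathbf Z^{alg}\;:\;\gamma(q)=1\}.$$
   Context: Fix $q\in\mathbb C$ with $|q|>1$; $(\sigma_qF)(z)=F(qz)$. $\mathbb C(\{z\})$ is the field of germs at $0$ of meromorphic functions. $\mathcal P^{(0)}$ is the category whose objects are pairs $(\mathbb C^n,A)$ with $n\in\mathbb N$, $A\in GL_n(\mathbb C)$, and whose morphisms $(\mathbb C^n,A)\to(\mathbb C^p,B)$ are the matrices $F\in M_{p,n}(\mathbb C(\{z\}))$ such that $(\sigma_qF)A=BF$. Tensor products are Kronecker products; the unit is $(\mathbb C,1)$. Every morphism of $\mathcal P^{(0)}$ has entries in $\mathbb C[z,z^{-1}]$. For $z_0\in\mathbb C^*$, $\omega^{(0)}_{z_0}$ is the fibre functor $(\mathbb C^n,A)\mapsto\mathbb C^n$, $F\mapsto F(z_0)$ on $\mathcal P^{(0)}$. $\mathcal R$ is the tannakian category of finite-dimensional complex representations of $\mathbb Z$: objects $(\mathbb C^n,A)$, $A\in GL_n(\mathbb C)$, morphisms the constant matrices $F$ with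 $FA=BF$; $\omega$ is its forgetful functor. Via the embedding $\mathcal R\to\mathcal P^{(0)}$ each $\omega^{(0)}_{z_0}$ restricts to $\omega$, so $\mathrm{Aut}^{\otimes}(\omega^{(0)}_{z_0})$ is a subgroup of $\mathrm{Aut}^{\otimes}(\omega)$. $\mathrm{Aut}^{\otimes}(\omega)$ is identified with $\mathbf Z^{alg}=\mathrm{Hom}_{grp}(\mathbb C^*,\mathbb C^* )\times\mathbb C$: $(\gamma,\lambda)$ acts on $\omega(\mathbb C^n,A)=\mathbb C^n$ by $\gamma(A_s)A_u^{\lambda}$, where $A=A_sA_u$ is the multiplicative Dunford (Jordan) decomposition, $\gamma(A_s)=Q\,\mathrm{diag}(\gamma(c_1),\dots,\gamma(c_n))\,Q^{-1}$ if $A_s=Q\,\mathrm{diag}(c_1,\dots,c_n)\,Q^{-1}$, and $A_u^{\lambda}=\sum_{k\ge0}\binom{\lambda}{k}(A_u-I_n)^k$. *)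

theory Defs
  imports
    "HOL-Complex_Analysis.Complex_Analysis"
    "HOL-Algebra.Group"
    "Jordan_Normal_Form.Matrix"
begin

section \<open>The field of germs at 0 of meromorphic functions\<close>

text \<open>Values at 0 itself are irrelevant for a germ of meromorphic functions: two functions
  have the same germ iff they agree on a punctured neighbourhood of 0.\<close>

definition germ_rel :: "(complex \<Rightarrow> complex) \<Rightarrow> (complex \<Rightarrow> complex) \<Rightarrow> bool" where
  "germ_rel f g \<longleftrightarrow>
     f meromorphic_on {0} \<and> g meromorphic_on {0} \<and> (\<forall>\<^sub>F z in at 0. f z = g z)"

lemma germ_rel_part_equivp: "part_equivp germ_rel"
proof (rule part_equivpI)
  show "\<exists>f. germ_rel f f"
    by (rule exI[of _ "\<lambda>_. 0"]) (auto simp: germ_rel_def)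
  show "symp germ_rel"
    by (auto simp: symp_def germ_rel_def eq_commute)
  show "transp germ_rel"
    by (auto simp: transp_def germ_rel_def elim: eventually_elim2)
qed

quotient_type mero_germ = "complex \<Rightarrow> complex" / partial: germ_rel
  by (rule germ_rel_part_equivp)

text \<open>The germ at 0 of a function; only meaningful if the function is meromorphic at 0.\<close>

definition germ :: "(complex \<Rightarrow> complex) \<Rightarrow> mero_germ" where
  "germ f = abs_mero_germ f"

lemma germ_eq_iff:
  assumes "f meromorphic_on {0}" "g meromorphic_on {0}"
  shows "germ f = germ g \<longleftrightarrow> (\<forall>\<^sub>F z in at 0. f z = g z)"
  unfolding germ_def using assms Quotient3_rel[OF Quotient3_mero_germ, of f g]
  by (auto simp: germ_rel_def)

lemma germ_cases:
  obtains f where "f meromorphic_on {0}" "g = germ f"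
proof -
  have "germ_rel (rep_mero_germ g) (rep_mero_germ g)"
    by (rule Quotient3_rep_reflp[OF Quotient3_mero_germ])
  moreover have "g = germ (rep_mero_germ g)"
    unfolding germ_def by (simp add: Quotient3_abs_rep[OF Quotient3_mero_germ])
  ultimately show ?thesis
    using that by (auto simp: germ_rel_def)
qed

instantiation mero_germ :: field
begin

lift_definition zero_mero_germ :: mero_germ is "\<lambda>_. 0"
  by (auto simp: germ_rel_def)

lift_definition one_mero_germ :: mero_germ is "\<lambda>_. 1"
  by (auto simp: germ_rel_def)

lift_definition plus_mero_germ :: "mero_germ \<Rightarrow> mero_germ \<Rightarrow> mero_germ"
  is "\<lambda>f g z. f z + g z"
  by (auto simp: germ_rel_def intro!: meromorphic_intros elim: eventually_elim2)

lift_definition minus_mero_germ :: "mero_germ \<Rightarrow> mero_germ \<Rightarrow> mero_germ"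
  is "\<lambda>f g z. f z - g z"
  by (auto simp: germ_rel_def intro!: meromorphic_intros elim: eventually_elim2)

lift_definition uminus_mero_germ :: "mero_germ \<Rightarrow> mero_germ"
  is "\<lambda>f z. - f z"
  by (auto simp: germ_rel_def intro!: meromorphic_intros elim: eventually_mono)

lift_definition times_mero_germ :: "mero_germ \<Rightarrow> mero_germ \<Rightarrow> mero_germ"
  is "\<lambda>f g z. f z * g z"
  by (auto simp: germ_rel_def intro!: meromorphic_intros elim: eventually_elim2)

lift_definition inverse_mero_germ :: "mero_germ \<Rightarrow> mero_germ"
  is "\<lambda>f z. inverse (f z)"
  by (auto simp: germ_rel_def intro!: meromorphic_intros elim: eventually_mono)

lift_definition divide_mero_germ :: "mero_germ \<Rightarrow> mero_germ \<Rightarrow> mero_germ"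
  is "\<lambda>f g z. f z / g z"
  by (auto simp: germ_rel_def intro!: meromorphic_intros elim: eventually_elim2)

instance
proof
  fix a b c :: mero_germ
  show "a * b * c = a * (b * c)"
    by transfer (auto simp: germ_rel_def mult_ac intro!: meromorphic_intros)
  show "a * b = b * a"
    by transfer (auto simp: germ_rel_def mult_ac intro!: meromorphic_intros)
  show "1 * a = a"
    by transfer (auto simp: germ_rel_def intro!: meromorphic_intros)
  show "a + b + c = a + (b + c)"
    by transfer (auto simp: germ_rel_def add_ac intro!: meromorphic_intros)
  show "a + b = b + a"
    by transfer (auto simp: germ_rel_def add_ac intro!: meromorphic_intros)
  show "0 + a = a"
    by transfer (auto simp: germ_rel_def intro!: meromorphic_intros)
  show "- a + a = 0"
    by transfer (auto simp: germ_rel_def intro!: meromorphic_intros)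
  show "a - b = a + - b"
    by transfer (auto simp: germ_rel_def intro!: meromorphic_intros)
  show "(a + b) * c = a * c + b * c"
    by transfer (auto simp: germ_rel_def algebra_simps intro!: meromorphic_intros)
  show "(0::mero_germ) \<noteq> 1"
    by transfer (auto simp: germ_rel_def)
  show "a div b = a * inverse b"
    by transfer (auto simp: germ_rel_def field_simps intro!: meromorphic_intros)
  show "inverse (0::mero_germ) = 0"
    by transfer (auto simp: germ_rel_def)
  show "inverse a * a = 1" if "a \<noteq> 0"
    using that
  proof transfer
    fix f assume f: "germ_rel f f" and nz: "\<not> germ_rel f (\<lambda>_. 0)"
    from f have mero: "f meromorphic_on {0}"
      by (simp add: germ_rel_def)
    have "\<exists>\<^sub>F z in at 0. f z \<noteq> 0"
      using nz mero by (auto simp: germ_rel_def frequently_def)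
    hence "\<forall>\<^sub>F z in at 0. f z \<noteq> 0"
      using mero non_zero_neighbour[of f 0] by (auto simp: meromorphic_at_iff)
    hence "\<forall>\<^sub>F z in at 0. inverse (f z) * f z = 1"
      by eventually_elim simp
    thus "germ_rel (\<lambda>z. inverse (f z) * f z) (\<lambda>_. 1)"
      using mero by (auto simp: germ_rel_def intro!: meromorphic_intros)
  qed
qed

end

definition germ_const :: "complex \<Rightarrow> mero_germ" where
  "germ_const c = germ (\<lambda>_. c)"

text \<open>The operator $F(z) \mapsto F(qz)$; only meaningful for $q \neq 0$.\<close>

definition sigma :: "complex \<Rightarrow> mero_germ \<Rightarrow> mero_germ" where
  "sigma q g = germ (\<lambda>z. rep_mero_germ g (q * z))"

lemma meromorphic_scale:
  assumes "q \<noteq> 0" "f meromorphic_on {0}"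
  shows "(\<lambda>z. f (q * z)) meromorphic_on {0}"
  by (rule meromorphic_on_compose[OF assms(2)]) (auto intro!: analytic_intros)

lemma sigma_germ:
  assumes "q \<noteq> 0" "f meromorphic_on {0}"
  shows "sigma q (germ f) = germ (\<lambda>z. f (q * z))"
proof -
  define r where "r = rep_mero_germ (germ f)"
  have "germ_rel r r"
    unfolding r_def by (rule Quotient3_rep_reflp[OF Quotient3_mero_germ])
  hence r: "r meromorphic_on {0}"
    by (simp add: germ_rel_def)
  have "germ r = germ f"
    unfolding r_def by (simp add: germ_def Quotient3_abs_rep[OF Quotient3_mero_germ])
  hence ev: "\<forall>\<^sub>F z in at 0. r z = f z"
    using germ_eq_iff[OF r assms(2)] by simp
  have "filterlim (\<lambda>z. q * z) (at 0) (at 0)"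
    using assms(1) by (auto simp: filterlim_at eventually_at_filter intro!: tendsto_eq_intros)
  from eventually_compose_filterlim[OF ev this]
  show ?thesis
    unfolding sigma_def r_def [symmetric]
    using germ_eq_iff[OF meromorphic_scale[OF assms(1) r] meromorphic_scale[OF assms]] by simp
qed

text \<open>The value at $z_0 \neq 0$ of a germ that is (the germ of) a Laurent polynomial; every
  Laurent polynomial has the form $p(z) / z^k$ with $p$ a polynomial.\<close>

definition germ_eval :: "complex \<Rightarrow> mero_germ \<Rightarrow> complex" where
  "germ_eval z0 g =
     (THE w. \<exists>(p :: complex poly) k. g = germ (\<lambda>z. poly p z / z ^ k) \<and> w = poly p z0 / z0 ^ k)"

lemma meromorphic_poly: "(\<lambda>z. poly p z :: complex) meromorphic_on A"
  by (induction p) (auto intro!: meromorphic_intros)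

lemma germ_eval_laurent_poly:
  fixes p :: "complex poly"
  assumes "z0 \<noteq> 0"
  shows "germ_eval z0 (germ (\<lambda>z. poly p z / z ^ k)) = poly p z0 / z0 ^ k"
  unfolding germ_eval_def
proof (rule the_equality)
  show "\<exists>p' k'. germ (\<lambda>z. poly p z / z ^ k) = germ (\<lambda>z. poly p' z / z ^ k') \<and>
          poly p z0 / z0 ^ k = poly p' z0 / z0 ^ k'"
    by blast
next
  fix w
  assume "\<exists>p' k'. germ (\<lambda>z. poly p z / z ^ k) = germ (\<lambda>z. poly p' z / z ^ k') \<and>
            w = poly p' z0 / z0 ^ k'"
  then obtain p' k' where
    eq: "germ (\<lambda>z. poly p z / z ^ k) = germ (\<lambda>z. poly p' z / z ^ k')"
    and w: "w = poly p' z0 / z0 ^ k'"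
    by blast
  have "\<forall>\<^sub>F z in at 0. poly p z / z ^ k = poly p' z / z ^ k'"
    using eq by (subst (asm) germ_eq_iff) (auto intro!: meromorphic_intros meromorphic_poly)
  moreover have "\<forall>\<^sub>F z in at (0::complex). z \<noteq> 0"
    by (simp add: eventually_at_filter)
  ultimately have "\<forall>\<^sub>F z in at 0. poly (p * monom 1 k' - p' * monom 1 k) z = 0"
    by eventually_elim (simp add: poly_monom field_simps)
  hence "\<exists>\<^sub>F z in at 0. poly (p * monom 1 k' - p' * monom 1 k) z = 0"
    by (intro eventually_frequently) auto
  hence "\<exists>\<^sub>F z in at 0. z \<in> {z. poly (p * monom 1 k' - p' * monom 1 k) z = 0}"
    by (simp only: mem_Collect_eq)
  hence "infinite {z. poly (p * monom 1 k' - p' * monom 1 k) z = 0}"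
    using islimpt_finite[of _ "0::complex"] unfolding islimpt_conv_frequently_at by blast
  hence "p * monom 1 k' - p' * monom 1 k = 0"
    using poly_roots_finite by blast
  hence "poly (p * monom 1 k') z0 = poly (p' * monom 1 k) z0"
    by simp
  thus "w = poly p z0 / z0 ^ k"
    unfolding w using assms by (subst frac_eq_eq) (simp_all add: poly_monom)
qed

lemma germ_eval_const: "z0 \<noteq> 0 \<Longrightarrow> germ_eval z0 (germ_const c) = c"
  using germ_eval_laurent_poly[of z0 "[:c:]" 0] by (simp add: germ_const_def)

section \<open>Tensor automorphisms of matrix-valued fibre functors\<close>

definition kronecker :: "complex mat \<Rightarrow> complex mat \<Rightarrow> complex mat" where
  "kronecker A B = Matrix.mat (dim_row A * dim_row B) (dim_col A * dim_col B)
     (\<lambda>(i, j). A $$ (i div dim_row B, j div dim_col B) * B $$ (i mod dim_row B, j mod dim_col B))"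

text \<open>A tensor category together with a fibre functor to finite-dimensional vector spaces
  that sends an object \<open>X\<close> to the coordinate space of dimension \<open>fdim X\<close>, a morphism \<open>F\<close> to the
  matrix \<open>fmor F\<close>, and tensor products to Kronecker products. Only the data that
  enters the definition of the group of tensor automorphisms is recorded.\<close>

record ('o, 'm) fibred_category =
  Obj :: "'o set"
  Hom :: "'o \<Rightarrow> 'o \<Rightarrow> 'm set"
  tens :: "'o \<Rightarrow> 'o \<Rightarrow> 'o"
  unit_obj :: 'o
  fdim :: "'o \<Rightarrow> nat"
  fmor :: "'m \<Rightarrow> complex mat"

definition tensor_auts :: "('o, 'm) fibred_category \<Rightarrow> ('o \<Rightarrow> complex mat) set" where
  "tensor_auts C = {\<eta> \<in> extensional (Obj C).
     (\<forall>X \<in> Obj C. \<eta> X \<in> carrier_mat (fdim C X) (fdim C X) \<and> invertible_mat (\<eta> X)) \<and>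
     (\<forall>X \<in> Obj C. \<forall>Y \<in> Obj C. \<forall>F \<in> Hom C X Y. fmor C F * \<eta> X = \<eta> Y * fmor C F) \<and>
     (\<forall>X \<in> Obj C. \<forall>Y \<in> Obj C. \<eta> (tens C X Y) = kronecker (\<eta> X) (\<eta> Y)) \<and>
     \<eta> (unit_obj C) = 1\<^sub>m (fdim C (unit_obj C))}"

definition Aut_tensor :: "('o, 'm) fibred_category \<Rightarrow> ('o \<Rightarrow> complex mat) monoid" where
  "Aut_tensor C = \<lparr>carrier = tensor_auts C,
     monoid.mult = (\<lambda>\<eta> \<theta>. \<lambda>X\<in>Obj C. \<eta> X * \<theta> X),
     one = (\<lambda>X\<in>Obj C. 1\<^sub>m (fdim C X))\<rparr>"

section \<open>The categories R and P0\<close>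

definition GL_objects :: "(nat \<times> complex mat) set" where
  "GL_objects = {(n, A). A \<in> carrier_mat n n \<and> invertible_mat A}"

definition obj_tensor :: "nat \<times> complex mat \<Rightarrow> nat \<times> complex mat \<Rightarrow> nat \<times> complex mat" where
  "obj_tensor X Y = (fst X * fst Y, kronecker (snd X) (snd Y))"

definition R_cat :: "(nat \<times> complex mat, complex mat) fibred_category" where
  "R_cat = \<lparr>Obj = GL_objects,
     Hom = (\<lambda>(n, A) (p, B). {F \<in> carrier_mat p n. F * A = B * F}),
     tens = obj_tensor,
     unit_obj = (1, 1\<^sub>m 1),
     fdim = fst,
     fmor = (\<lambda>F. F)\<rparr>"

definition P0_cat ::
    "complex \<Rightarrow> complex \<Rightarrow> (nat \<times> complex mat, mero_germ mat) fibred_category" where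
  "P0_cat q z0 = \<lparr>Obj = GL_objects,
     Hom = (\<lambda>(n, A) (p, B). {F \<in> carrier_mat p n.
       map_mat (sigma q) F * map_mat germ_const A = map_mat germ_const B * F}),
     tens = obj_tensor,
     unit_obj = (1, 1\<^sub>m 1),
     fdim = fst,
     fmor = map_mat (germ_eval z0)\<rparr>"

text \<open>The embedding of \<^const>\<open>R_cat\<close> into \<^const>\<open>P0_cat\<close> is the identity on objects and
  \<open>map_mat germ_const\<close> on morphisms, and is compatible with the fibre functors.\<close>

lemma germ_const_0: "germ_const 0 = 0"
  unfolding germ_const_def germ_def zero_mero_germ_def ..

lemma germ_const_add: "germ_const (a + b) = germ_const a + germ_const b"
  unfolding germ_const_def germ_def
  by (subst plus_mero_germ.abs_eq) (auto simp: germ_rel_def)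

lemma germ_const_mult: "germ_const (a * b) = germ_const a * germ_const b"
  unfolding germ_const_def germ_def
  by (subst times_mero_germ.abs_eq) (auto simp: germ_rel_def)

lemma germ_const_sum: "germ_const (sum f I) = (\<Sum>i\<in>I. germ_const (f i))"
  by (induction I rule: infinite_finite_induct) (simp_all add: germ_const_0 germ_const_add)

lemma map_mat_germ_const_mult:
  assumes "dim_col A = dim_row B"
  shows "map_mat germ_const (A * B) = map_mat germ_const A * map_mat germ_const B"
  using assms by (intro eq_matI) (auto simp: scalar_prod_def germ_const_sum germ_const_mult)

lemma R_embeds_in_P0:
  assumes "q \<noteq> 0" "X \<in> Obj R_cat" "Y \<in> Obj R_cat" "F \<in> Hom R_cat X Y"
  shows "map_mat germ_const F \<in> Hom (P0_cat q z0) X Y"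
proof -
  obtain n A p B where X: "X = (n, A)" and Y: "Y = (p, B)"
    by (metis surj_pair)
  have A: "A \<in> carrier_mat n n" and B: "B \<in> carrier_mat p p"
    using assms(2,3) by (auto simp: R_cat_def GL_objects_def X Y)
  have F: "F \<in> carrier_mat p n" "F * A = B * F"
    using assms(4) by (auto simp: R_cat_def X Y)
  have "sigma q (germ_const c) = germ_const c" for c
    unfolding germ_const_def using assms(1) by (subst sigma_germ) auto
  hence "map_mat (sigma q) (map_mat germ_const F) = map_mat germ_const F"
    by (intro eq_matI) auto
  moreover have "map_mat germ_const F * map_mat germ_const A =
      map_mat germ_const B * map_mat germ_const F"
    using A B F by (subst (1 2) map_mat_germ_const_mult [symmetric]) auto
  ultimately show ?thesis
    using F by (simp add: P0_cat_def X Y)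
qed

lemma P0_fibre_on_R:
  assumes "z0 \<noteq> 0"
  shows "fmor (P0_cat q z0) (map_mat germ_const F) = fmor R_cat F"
  using assms by (intro eq_matI) (auto simp: P0_cat_def R_cat_def germ_eval_const)

definition restrict_to_R ::
    "(nat \<times> complex mat \<Rightarrow> complex mat) \<Rightarrow> (nat \<times> complex mat \<Rightarrow> complex mat)" where
  "restrict_to_R \<eta> = (\<lambda>X\<in>Obj R_cat. \<eta> X)"

section \<open>The proalgebraic hull of the integers and its action\<close>

definition Cstar :: "complex monoid" where
  "Cstar = \<lparr>carrier = - {0}, monoid.mult = (*), one = 1\<rparr>"

text \<open>Group endomorphisms of the multiplicative group are made extensional, so that
  equality of functions is equality of homomorphisms.\<close>

definition Zalg :: "((complex \<Rightarrow> complex) \<times> complex) monoid" where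
  "Zalg = \<lparr>carrier = {(\<gamma>, l). \<gamma> \<in> hom Cstar Cstar \<inter> extensional (carrier Cstar)},
     monoid.mult = (\<lambda>(\<gamma>, l) (\<gamma>', l'). (\<lambda>c\<in>carrier Cstar. \<gamma> c * \<gamma>' c, l + l')),
     one = (\<lambda>c\<in>carrier Cstar. 1, 0)\<rparr>"

definition unipotent_mat :: "complex mat \<Rightarrow> bool" where
  "unipotent_mat U \<longleftrightarrow> square_mat U \<and>
     (\<exists>k. (U - 1\<^sub>m (dim_row U)) ^\<^sub>m k = 0\<^sub>m (dim_row U) (dim_row U))"

definition diagonalizable_mat :: "complex mat \<Rightarrow> bool" where
  "diagonalizable_mat S \<longleftrightarrow> (\<exists>c. similar_mat S (mat_diag (dim_row S) c))"

definition is_dunford :: "complex mat \<Rightarrow> complex mat \<Rightarrow> complex mat \<Rightarrow> bool" where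
  "is_dunford A S U \<longleftrightarrow>
     S \<in> carrier_mat (dim_row A) (dim_row A) \<and> U \<in> carrier_mat (dim_row A) (dim_row A) \<and>
     diagonalizable_mat S \<and> unipotent_mat U \<and> A = S * U \<and> S * U = U * S"

definition ss_part :: "complex mat \<Rightarrow> complex mat" where
  "ss_part A = (THE S. \<exists>U. is_dunford A S U)"

definition unip_part :: "complex mat \<Rightarrow> complex mat" where
  "unip_part A = (THE U. \<exists>S. is_dunford A S U)"

text \<open>In \<open>similar_mat_wit S D Q P\<close> the matrix \<open>P\<close> is the inverse of \<open>Q\<close> and \<open>S = Q * D * P\<close>.\<close>

definition char_app :: "(complex \<Rightarrow> complex) \<Rightarrow> complex mat \<Rightarrow> complex mat" where
  "char_app \<gamma> S = (THE M. \<exists>Q P c. similar_mat_wit S (mat_diag (dim_row S) c) Q P \<and>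
     M = Q * mat_diag (dim_row S) (\<lambda>i. \<gamma> (c i)) * P)"

text \<open>The entries of the binomial series; each series has only finitely many nonzero terms
  if \<open>U\<close> is unipotent.\<close>

definition unip_pow :: "complex mat \<Rightarrow> complex \<Rightarrow> complex mat" where
  "unip_pow U l = Matrix.mat (dim_row U) (dim_row U)
     (\<lambda>(i, j). \<Sum>k. (l gchoose k) * ((U - 1\<^sub>m (dim_row U)) ^\<^sub>m k) $$ (i, j))"

definition Zalg_act ::
    "(complex \<Rightarrow> complex) \<times> complex \<Rightarrow> (nat \<times> complex mat \<Rightarrow> complex mat)" where
  "Zalg_act = (\<lambda>(\<gamma>, l). \<lambda>X\<in>Obj R_cat. char_app \<gamma> (ss_part (snd X)) * unip_pow (unip_part (snd X)) l)"

end

theory Submission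
  imports Defs "Jordan_Normal_Form.Jordan_Normal_Form_Existence"
begin

text \<open>
  For $A = S U$ with $S$ diagonalizable, $U$ unipotent and $S U = U S$, everything rests on one
  fact: a matrix $F$ with $F A = B F$ also intertwines the two parts of $A$ with the two parts
  of $B$ (lemmas \<open>dunford_intertwine_ss\<close> and \<open>dunford_intertwine_unip\<close>). It contains the uniqueness
  of the decomposition, and it makes $A \mapsto \gamma(S) U^\lambda$ natural, because $\gamma(S)$ and
  $U^\lambda$ are natural in $S$ and $U$. Compatibility with Kronecker products is clear for $\gamma(S)$; for
  $U^\lambda$, as for the law $U^{\lambda + \mu} = U^\lambda U^\mu$, both sides are polynomial in the
  exponent and agree at all natural numbers. Together with the existence of the decomposition, read
  off from the Jordan normal form, this shows that \<open>Zalg_act\<close> takes values in tensor automorphisms and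
  is a homomorphism.

  It is bijective because a tensor automorphism of the representations of the integers is determined
  by its values on the objects $(1, c)$ and on the Jordan block $J_2(1)$ (lemma \<open>tensor_auts_eqI\<close>).
  These values are an arbitrary character $\gamma$ and a matrix with rows $(1, \lambda)$ and $(0, 1)$. The object
  $J_n(1)$ is the space of polynomials of degree less than $n$ with the shift $x \mapsto x + 1$, and
  multiplication of functions is a surjective morphism $J_2(1) \otimes J_n(1) \to J_{n+1}(1)$, which
  yields all $J_n(1)$ inductively. Tensoring with $(1, c)$ gives all Jordan blocks, and direct sums
  and isomorphisms give all objects.

  For the category of $q$-difference modules, the Laurent coefficients $F_k$ of a morphism $F$ from
  $A$ to $B$ satisfy $F_k \, (q^k A) = B F_k$: each $F_k$ is a morphism of representations from
  $q^k A$ to $B$. Because $|q| > 1$, only finitely many of them are nonzero, so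
  $F(z_0) = \sum_k z_0^k F_k$ is a finite sum. The action of $(\gamma, \lambda)$ on $q^k A$ is
  $\gamma(q)^k$ times the one on $A$; hence $\gamma(q) = 1$ implies compatibility with every $F(z_0)$.
  Conversely $F = z$ is a morphism from $(1, 1)$ to $(1, q)$, and compatibility with it forces
  $\gamma(q) = 1$.
\<close>

section \<open>Intertwiners and uniqueness of the Dunford decomposition\<close>

lemma pow_mat_Suc_left:
  fixes A :: "'a :: semiring_1 mat"
  assumes "A \<in> carrier_mat n n"
  shows "A ^\<^sub>m Suc k = A * A ^\<^sub>m k"
proof (induction k)
  case (Suc k)
  have "A ^\<^sub>m Suc (Suc k) = A * A ^\<^sub>m k * A" using Suc by simp
  also have "\<dots> = A * A ^\<^sub>m Suc k"
    using assms by (simp add: assoc_mult_mat[of _ n n _ n _ n])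
  finally show ?case .
qed (use assms in auto)

lemma pow_mat_intertwine:
  fixes A :: "'a :: semiring_1 mat"
  assumes "A \<in> carrier_mat n n" "B \<in> carrier_mat p p" "F \<in> carrier_mat p n" "F * A = B * F"
  shows "F * A ^\<^sub>m k = B ^\<^sub>m k * F"
proof (induction k)
  case (Suc k)
  have "F * A ^\<^sub>m Suc k = (F * A ^\<^sub>m k) * A"
    using assms by (simp add: assoc_mult_mat[of F p n _ n _ n])
  also have "\<dots> = B ^\<^sub>m k * (F * A)"
    using assms Suc by (simp add: assoc_mult_mat[of _ p p _ n _ n])
  also have "\<dots> = B ^\<^sub>m Suc k * F"
    using assms by (simp add: assoc_mult_mat[of _ p p _ p _ n])
  finally show ?case .
qed (use assms in auto)

lemma pow_mat_zero_mono:
  fixes A :: "'a :: semiring_1 mat"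
  assumes "A \<in> carrier_mat n n" "A ^\<^sub>m k = 0\<^sub>m n n" "k \<le> m"
  shows "A ^\<^sub>m m = 0\<^sub>m n n"
  using assms(3)
proof (induction m rule: dec_induct)
  case (step m)
  then show ?case using assms by (simp add: left_mult_zero_mat[of _ n n])
qed (use assms in auto)

text \<open>The heart of the uniqueness of the Dunford decomposition, after both semisimple parts have been
  diagonalized; \<open>N\<close> and \<open>N'\<close> are the nilpotent parts of the unipotent factors. With the matrices
  $G N$ and $N' G$, which satisfy the same equation, in place of $G$, one of the nilpotency
  exponents drops by one. By induction their $(i, j)$ entries vanish, and the equation for $G$
  reduces to $(c_j - d_i) \, G_{ij} = 0$.\<close>

lemma diag_unipotent_intertwine:
  fixes G :: "complex mat"
  assumes G: "G \<in> carrier_mat p n"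
    and N: "N \<in> carrier_mat n n" and N': "N' \<in> carrier_mat p p"
    and comm: "mat_diag n c * N = N * mat_diag n c" "mat_diag p d * N' = N' * mat_diag p d"
    and nil: "N' ^\<^sub>m a * G = 0\<^sub>m p n" "G * N ^\<^sub>m b = 0\<^sub>m p n"
    and eq: "G * mat_diag n c + (G * N) * mat_diag n c = mat_diag p d * G + mat_diag p d * (N' * G)"
    and ij: "i < p" "j < n" "c j \<noteq> d i"
  shows "G $$ (i, j) = 0"
  using G nil eq
proof (induction "a + b" arbitrary: a b G)
  case 0
  then have "G = 0\<^sub>m p n" using N' by simp
  then show ?case using ij by simp
next
  case (Suc m)
  note G = Suc.prems(1)
  let ?C = "mat_diag n c" and ?D = "mat_diag p d"
  show ?case
  proof (cases "a = 0 \<or> b = 0")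
    case True
    then have "G = 0\<^sub>m p n" using Suc.prems N N' by auto
    then show ?thesis using ij by simp
  next
    case False
    then obtain a' b' where a: "a = Suc a'" and b: "b = Suc b'"
      by (metis not0_implies_Suc)
    have NG: "N' * G \<in> carrier_mat p n" and GN: "G * N \<in> carrier_mat p n"
      using G N N' by auto
    note as1 = assoc_mult_mat[of _ p n _ n _ n] and as2 = assoc_mult_mat[of _ p p _ n _ n]
      and as3 = assoc_mult_mat[of _ p p _ p _ n]
    have C: "?C \<in> carrier_mat n n" and D: "?D \<in> carrier_mat p p" by auto
    have "(N' * G) $$ (i, j) = 0"
    proof (rule Suc.hyps(1)[of a' b])
      show "N' ^\<^sub>m a' * (N' * G) = 0\<^sub>m p n"
        using Suc.prems(2) N' G unfolding a by (simp add: as3)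
      show "N' * G * N ^\<^sub>m b = 0\<^sub>m p n"
        using Suc.prems(3) N' N G by (simp add: as2)
      have "N' * (G * ?C + (G * N) * ?C) = N' * (?D * G + ?D * (N' * G))"
        using Suc.prems(4) by simp
      then have "N' * (G * ?C) + N' * ((G * N) * ?C) = N' * (?D * G) + N' * (?D * (N' * G))"
        using G N N' C D NG GN by (simp add: mult_add_distrib_mat[of _ p p _ n] del: assoc_mult_mat)
      moreover have "N' * (G * ?C) = N' * G * ?C" using G N' C by (simp add: as2)
      moreover have "N' * ((G * N) * ?C) = N' * G * N * ?C"
        using G N' N C NG GN by (simp add: as2[symmetric] del: assoc_mult_mat)
      moreover have "N' * (?D * X) = ?D * (N' * X)" if "X \<in> carrier_mat p n" for X
        using that N' D comm(2) by (metis as3)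
      ultimately show "N' * G * ?C + N' * G * N * ?C = ?D * (N' * G) + ?D * (N' * (N' * G))"
        using G NG by simp
    qed (use a Suc NG in auto)
    moreover have "(G * N) $$ (i, j) = 0"
    proof (rule Suc.hyps(1)[of a b'])
      show "N' ^\<^sub>m a * (G * N) = 0\<^sub>m p n"
        using Suc.prems(2) N' N G by (simp add: as2[symmetric] del: assoc_mult_mat)
      show "G * N * N ^\<^sub>m b' = 0\<^sub>m p n"
        using Suc.prems(3) N G unfolding b by (simp only: pow_mat_Suc_left[OF N]) (simp add: as1)
      have "(G * ?C + (G * N) * ?C) * N = (?D * G + ?D * (N' * G)) * N"
        using Suc.prems(4) by simp
      then have "G * ?C * N + G * N * ?C * N = ?D * G * N + ?D * (N' * G) * N"
        using G N N' C D NG GN by (simp add: add_mult_distrib_mat[of _ p n _ _ n] del: assoc_mult_mat)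
      moreover have "X * ?C * N = X * N * ?C" if "X \<in> carrier_mat p n" for X
        using that N C comm(1) by (metis as1)
      moreover have "?D * G * N = ?D * (G * N)" using G N D by (simp add: as2)
      moreover have "?D * (N' * G) * N = ?D * (N' * (G * N))"
        using G N D N' NG by (simp add: as2)
      ultimately show "G * N * ?C + G * N * N * ?C = ?D * (G * N) + ?D * (N' * (G * N))"
        using G GN by simp
    qed (use b Suc GN in auto)
    moreover have "(G * ?C + (G * N) * ?C) $$ (i,j) = (?D * G + ?D * (N' * G)) $$ (i,j)"
      using Suc.prems(4) by simp
    then have "G $$ (i,j) * c j + (G * N) $$ (i,j) * c j = d i * G $$ (i,j) + d i * (N' * G) $$ (i,j)"
      using G N N' NG GN ij by (simp add: mat_diag_mult_left[of _ p n] mat_diag_mult_right[of _ p n] del: index_mult_mat(1))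
    ultimately have "G $$ (i,j) * (c j - d i) = 0" by (simp add: algebra_simps)
    then show ?thesis using ij by simp
  qed
qed

lemma mat_eq_sandwich:
  fixes M :: "complex mat"
  assumes "Q' \<in> carrier_mat p p" "P' \<in> carrier_mat p p" "Q' * P' = 1\<^sub>m p"
    and "Q \<in> carrier_mat n n" "P \<in> carrier_mat n n" "Q * P = 1\<^sub>m n"
    and "M \<in> carrier_mat p n"
  shows "Q' * (P' * M * Q) * P = M"
proof -
  have "Q' * (P' * M * Q) * P = (Q' * P') * M * (Q * P)"
    using assms(1,2,4,5,7)
    by (simp add: assoc_mult_mat[of _ p p _ p _ n] assoc_mult_mat[of _ p p _ n _ n] assoc_mult_mat[of _ p n _ n _ n])
  then show ?thesis using assms by simp
qed

lemma unipotentE: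
  assumes "unipotent_mat U" "U \<in> carrier_mat n n"
  obtains k where "(U - 1\<^sub>m n) ^\<^sub>m k = 0\<^sub>m n n"
  using assms unfolding unipotent_mat_def by auto

text \<open>If entries of $G$ can be nonzero only where the eigenvalues agree, then $G$ intertwines an
  arbitrary function of these eigenvalues. This is the source of the naturality of \<^const>\<open>char_app\<close>.\<close>

lemma char_intertwine_diag:
  fixes G :: "complex mat"
  assumes "G \<in> carrier_mat p n" "\<And>i j. i < p \<Longrightarrow> j < n \<Longrightarrow> c j \<noteq> d i \<Longrightarrow> G $$ (i, j) = 0"
  shows "G * mat_diag n (\<lambda>i. \<gamma> (c i)) = mat_diag p (\<lambda>i. \<gamma> (d i)) * G"
proof -
  have "G $$ (i,j) * \<gamma> (c j) = \<gamma> (d i) * G $$ (i,j)" if "i < p" "j < n" for i j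
    using assms(2)[OF that] by (cases "c j = d i") auto
  then show ?thesis
    using assms(1) by (simp only: mat_diag_mult_left[of _ p n] mat_diag_mult_right[of _ p n]) (rule cong_mat, auto)
qed

lemma diag_intertwine_entry:
  fixes G :: "complex mat"
  assumes "G \<in> carrier_mat p n" "G * mat_diag n c = mat_diag p d * G" "i < p" "j < n" "c j \<noteq> d i"
  shows "G $$ (i, j) = 0"
proof -
  have "(G * mat_diag n c) $$ (i,j) = (mat_diag p d * G) $$ (i,j)" using assms by simp
  then have "G $$ (i,j) * c j = d i * G $$ (i,j)" 
    using assms(1,3,4) by (simp add: mat_diag_mult_left[of _ p n] mat_diag_mult_right[of _ p n] del: index_mult_mat(1))
  then have "G $$ (i,j) * (c j - d i) = 0" by (simp add: algebra_simps)
  then show ?thesis using assms by simp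
qed

lemma conj_intertwine:
  fixes F :: "complex mat"
  assumes w: "similar_mat_wit S D Q P" "S \<in> carrier_mat n n"
    and w': "similar_mat_wit S' D' Q' P'" "S' \<in> carrier_mat p p"
    and F: "F \<in> carrier_mat p n"
  shows "F * S = S' * F \<longleftrightarrow> (P' * F * Q) * D = D' * (P' * F * Q)"
proof -
  note * = similar_mat_witD2[OF w(2,1)] and ** = similar_mat_witD2[OF w'(2,1)]
  note as = assoc_mult_mat[of _ p p _ p _ n] assoc_mult_mat[of _ p p _ n _ n] assoc_mult_mat[of _ p n _ n _ n]
    assoc_mult_mat[of _ n n _ n _ n] assoc_mult_mat[of _ p p _ p _ p]
  have PF: "P' * F * Q \<in> carrier_mat p n" using F *(5-) **(5-) by auto
  have FS: "P' * (F * S) * Q = (P' * F * Q) * D"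
  proof -
    have "P' * (F * S) * Q = P' * F * Q * D * (P * Q)"
      unfolding *(3) using F *(5-) **(5-) by (simp add: as)
    then show ?thesis using *(2,5-) PF by (simp add: as)
  qed
  have SF: "P' * (S' * F) * Q = D' * (P' * F * Q)"
  proof -
    have "P' * (S' * F) * Q = (P' * Q') * D' * (P' * F * Q)"
      unfolding **(3) using F *(5-) **(5-) by (simp add: as)
    then show ?thesis using **(2,5-) PF by (simp add: as)
  qed
  have cFS: "F * S \<in> carrier_mat p n" and cSF: "S' * F \<in> carrier_mat p n" using F w w' by auto
  have "F * S = S' * F \<longleftrightarrow> P' * (F * S) * Q = P' * (S' * F) * Q"
    using mat_eq_sandwich[OF **(6,7,1) *(6,7,1) cFS] mat_eq_sandwich[OF **(6,7,1) *(6,7,1) cSF] by metis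
  then show ?thesis by (simp only: FS SF)
qed

lemma char_intertwine:
  fixes F :: "complex mat"
  assumes w: "similar_mat_wit S (mat_diag n c) Q P" "S \<in> carrier_mat n n"
    and w': "similar_mat_wit S' (mat_diag p d) Q' P'" "S' \<in> carrier_mat p p"
    and F: "F \<in> carrier_mat p n" "F * S = S' * F"
  shows "F * (Q * mat_diag n (\<lambda>i. \<gamma> (c i)) * P) = (Q' * mat_diag p (\<lambda>i. \<gamma> (d i)) * P') * F"
proof -
  note * = similar_mat_witD2[OF w(2,1)] and ** = similar_mat_witD2[OF w'(2,1)]
  have PF: "P' * F * Q \<in> carrier_mat p n" using F *(5-) **(5-) by auto
  have "P' * F * Q * mat_diag n c = mat_diag p d * (P' * F * Q)"
    using conj_intertwine[OF w w' F(1)] F(2) by simp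
  then have "P' * F * Q * mat_diag n (\<lambda>i. \<gamma> (c i)) = mat_diag p (\<lambda>i. \<gamma> (d i)) * (P' * F * Q)"
    by (intro char_intertwine_diag[OF PF] diag_intertwine_entry[OF PF])
  moreover have w1: "similar_mat_wit (Q * mat_diag n (\<lambda>i. \<gamma> (c i)) * P) (mat_diag n (\<lambda>i. \<gamma> (c i))) Q P"
    by (rule similar_mat_witI[of _ _ n]) (use *(1,2,5-) in auto)
  moreover have w2: "similar_mat_wit (Q' * mat_diag p (\<lambda>i. \<gamma> (d i)) * P') (mat_diag p (\<lambda>i. \<gamma> (d i))) Q' P'"
    by (rule similar_mat_witI[of _ _ p]) (use **(1,2,5-) in auto)
  ultimately show ?thesis
    using conj_intertwine[OF w1 _ w2 _ F(1)] *(6,7) **(6,7) mult_carrier_mat mat_diag_dim by metis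
qed

lemma diagonalizable_wit:
  assumes "diagonalizable_mat S" "S \<in> carrier_mat n n"
  obtains c Q P where "similar_mat_wit S (mat_diag n c) Q P"
  using assms unfolding diagonalizable_mat_def similar_mat_def by auto

lemma dunfordD:
  assumes "is_dunford A S U" "A \<in> carrier_mat n n"
  shows "S \<in> carrier_mat n n" "U \<in> carrier_mat n n" "diagonalizable_mat S" "unipotent_mat U"
    "A = S * U" "S * U = U * S"
  using assms unfolding is_dunford_def by auto

text \<open>Conjugation by eigenbases of $S$ and $S'$ turns $F$ into a matrix $G$ that intertwines
  $C + N C$ with $D + D N'$, where $C$, $D$ are diagonal and $N$, $N'$ nilpotent and commuting with
  $C$, $D$ respectively.\<close>

lemma dunford_intertwine_ss:
  fixes A B F :: "complex mat"
  assumes A: "A \<in> carrier_mat n n" "is_dunford A S U"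
    and B: "B \<in> carrier_mat p p" "is_dunford B S' U'"
    and F: "F \<in> carrier_mat p n" "F * A = B * F"
  shows "F * S = S' * F"
proof -
  have S: "S \<in> carrier_mat n n" and U: "U \<in> carrier_mat n n" and S': "S' \<in> carrier_mat p p" and U': "U' \<in> carrier_mat p p"
    using dunfordD[OF A(2,1)] dunfordD[OF B(2,1)] by blast+
  obtain c Q P where w: "similar_mat_wit S (mat_diag n c) Q P"
    using dunfordD(1,3)[OF A(2,1)] diagonalizable_wit by metis
  obtain d Q' P' where w': "similar_mat_wit S' (mat_diag p d) Q' P'"
    using dunfordD(1,3)[OF B(2,1)] diagonalizable_wit by metis
  obtain k where k: "(U - 1\<^sub>m n) ^\<^sub>m k = 0\<^sub>m n n"
    using dunfordD(2,4)[OF A(2,1)] unipotentE by metis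
  obtain k' where k': "(U' - 1\<^sub>m p) ^\<^sub>m k' = 0\<^sub>m p p"
    using dunfordD(2,4)[OF B(2,1)] unipotentE by metis
  note * = similar_mat_witD2[OF S w] and ** = similar_mat_witD2[OF S' w']
  note as = assoc_mult_mat[of _ p p _ p _ n] assoc_mult_mat[of _ p p _ n _ n] assoc_mult_mat[of _ p n _ n _ n]
    assoc_mult_mat[of _ n n _ n _ n] assoc_mult_mat[of _ p p _ p _ p]
  define G where "G = P' * F * Q"
  have G: "G \<in> carrier_mat p n" unfolding G_def using F *(5-) **(5-) by auto
  define N where "N = P * (U - 1\<^sub>m n) * Q"
  define N' where "N' = P' * (U' - 1\<^sub>m p) * Q'"
  have cN: "N \<in> carrier_mat n n" and cN': "N' \<in> carrier_mat p p" unfolding N_def N'_def using *(5-) **(5-) U U' by auto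
  let ?C = "mat_diag n c" and ?D = "mat_diag p d"
  have wN: "similar_mat_wit (U - 1\<^sub>m n) N Q P"
    by (rule similar_mat_wit_sym, rule similar_mat_witI[of _ _ n]) (use *(1,2,5-) U N_def in auto)
  have wN': "similar_mat_wit (U' - 1\<^sub>m p) N' Q' P'"
    by (rule similar_mat_wit_sym, rule similar_mat_witI[of _ _ p]) (use **(1,2,5-) U' N'_def in auto)
  have nilN: "N ^\<^sub>m k = 0\<^sub>m n n"
    using similar_mat_wit_pow_id[OF similar_mat_wit_sym[OF wN], of k] *(5-) k by simp
  have nilN': "N' ^\<^sub>m k' = 0\<^sub>m p p"
    using similar_mat_wit_pow_id[OF similar_mat_wit_sym[OF wN'], of k'] **(5-) k' by simp
  have U1: "U - 1\<^sub>m n \<in> carrier_mat n n" and U1': "U' - 1\<^sub>m p \<in> carrier_mat p p"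
    by (auto intro: minus_carrier_mat)
  have SN: "S * (U - 1\<^sub>m n) = (U - 1\<^sub>m n) * S"
    using S U dunfordD(6)[OF A(2,1)]
    by (simp add: mult_minus_distrib_mat[of _ n n] minus_mult_distrib_mat[of _ n n])
  have SN': "S' * (U' - 1\<^sub>m p) = (U' - 1\<^sub>m p) * S'"
    using S' U' dunfordD(6)[OF B(2,1)]
    by (simp add: mult_minus_distrib_mat[of _ p p] minus_mult_distrib_mat[of _ p p])
  have comm: "?C * N = N * ?C"
  proof -
    have "(P * (U - 1\<^sub>m n) * Q) * ?C = ?C * (P * (U - 1\<^sub>m n) * Q)"
      using conj_intertwine[OF w S w S, of "U - 1\<^sub>m n"] SN by (simp add: minus_carrier_mat del: assoc_mult_mat)
    then show ?thesis by (simp add: N_def)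
  qed
  have comm': "?D * N' = N' * ?D"
  proof -
    have "(P' * (U' - 1\<^sub>m p) * Q') * ?D = ?D * (P' * (U' - 1\<^sub>m p) * Q')"
      using conj_intertwine[OF w' S' w' S', of "U' - 1\<^sub>m p"] SN' by (simp add: minus_carrier_mat del: assoc_mult_mat)
    then show ?thesis by (simp add: N'_def)
  qed
  have wA: "similar_mat_wit A (?C + N * ?C) Q P"
  proof (rule similar_mat_wit_sym, rule similar_mat_witI[of _ _ n])
    have "A = S + (U - 1\<^sub>m n) * S"
      unfolding dunfordD(5)[OF A(2,1)] dunfordD(6)[OF A(2,1)] using S U
      by (simp add: minus_mult_distrib_mat[of _ n n] del: index_mult_mat(1)) (rule eq_matI, auto simp del: index_mult_mat(1))
    moreover have "P * S * Q = ?C" using similar_mat_witD2(3)[OF _ similar_mat_wit_sym[OF w], of n n] by simp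
    moreover have "P * ((U - 1\<^sub>m n) * S) * Q = N * ?C"
    proof -
      have "N * ?C = N * (P * S * Q)" using \<open>P * S * Q = ?C\<close> by simp
      also have "\<dots> = P * (U - 1\<^sub>m n) * (Q * P) * S * Q"
        unfolding N_def using *(5-) U1 S by (simp add: assoc_mult_mat[of _ n n _ n _ n])
      also have "\<dots> = P * ((U - 1\<^sub>m n) * S) * Q"
        using *(1,2,5-) U1 S by (simp add: assoc_mult_mat[of _ n n _ n _ n])
      finally show ?thesis by simp
    qed
    ultimately show "?C + N * ?C = P * A * Q"
      using mult_add_distrib_mat[OF *(7) S mult_carrier_mat[OF U1 S]]
        add_mult_distrib_mat[OF mult_carrier_mat[OF *(7) S] mult_carrier_mat[OF *(7) mult_carrier_mat[OF U1 S]] *(6)]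
      by metis
  qed (use *(1,2,5-) A cN add_carrier_mat mult_carrier_mat[OF cN mat_diag_dim] in auto)
  have wB: "similar_mat_wit B (?D + ?D * N') Q' P'"
  proof (rule similar_mat_wit_sym, rule similar_mat_witI[of _ _ p])
    have "B = S' + S' * (U' - 1\<^sub>m p)"
      unfolding dunfordD(5)[OF B(2,1)] using S' U'
      by (simp add: mult_minus_distrib_mat[of _ p p] del: index_mult_mat(1)) (rule eq_matI, auto simp del: index_mult_mat(1))
    moreover have "P' * S' * Q' = ?D" using similar_mat_witD2(3)[OF _ similar_mat_wit_sym[OF w'], of p p] by simp
    moreover have "P' * (S' * (U' - 1\<^sub>m p)) * Q' = ?D * N'"
    proof -
      have "?D * N' = (P' * S' * Q') * N'" using \<open>P' * S' * Q' = ?D\<close> by simp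
      also have "\<dots> = P' * S' * (Q' * P') * (U' - 1\<^sub>m p) * Q'"
        unfolding N'_def using **(5-) U1' S' by (simp add: assoc_mult_mat[of _ p p _ p _ p])
      also have "\<dots> = P' * (S' * (U' - 1\<^sub>m p)) * Q'"
        using **(1,2,5-) U1' S' by (simp add: assoc_mult_mat[of _ p p _ p _ p])
      finally show ?thesis by simp
    qed
    ultimately show "?D + ?D * N' = P' * B * Q'"
      using mult_add_distrib_mat[OF **(7) S' mult_carrier_mat[OF S' U1']]
        add_mult_distrib_mat[OF mult_carrier_mat[OF **(7) S'] mult_carrier_mat[OF **(7) mult_carrier_mat[OF S' U1']] **(6)]
      by metis
  qed (use **(1,2,5-) B cN' add_carrier_mat mult_carrier_mat[OF mat_diag_dim cN'] in auto)
  have "G * (?C + N * ?C) = (?D + ?D * N') * G"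
    using conj_intertwine[OF wA A(1) wB B(1) F(1)] F(2) by (simp add: G_def)
  then have eq: "G * ?C + (G * N) * ?C = ?D * G + ?D * (N' * G)"
    using G cN cN' mult_add_distrib_mat[OF G mat_diag_dim mult_carrier_mat[OF cN mat_diag_dim], of c c]
      add_mult_distrib_mat[OF mat_diag_dim mult_carrier_mat[OF mat_diag_dim cN'] G, of d d]
    by (simp add: as)
  have "G * ?C = ?D * G"
    using char_intertwine_diag[OF G, of c d "\<lambda>x. x"]
      diag_unipotent_intertwine[OF G cN cN' comm comm' _ _ eq, of k' k] G nilN nilN' by simp
  then show ?thesis
    using conj_intertwine[OF w S w' S' F(1)] by (simp add: G_def)
qed

lemma invertible_matE:
  assumes "invertible_mat (A :: complex mat)" "A \<in> carrier_mat n n"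
  obtains A' where "A' \<in> carrier_mat n n" "A * A' = 1\<^sub>m n" "A' * A = 1\<^sub>m n"
proof -
  obtain A' where A': "A * A' = 1\<^sub>m n" "A' * A = 1\<^sub>m (dim_row A')"
    using assms unfolding invertible_mat_def inverts_mat_def by auto
  have "dim_row A' = dim_col (A' * A)" using A'(2) by simp
  moreover have "dim_col A' = dim_col (A * A')" by simp
  ultimately have "A' \<in> carrier_mat n n" using A'(1) assms(2) by auto
  then show ?thesis using that A' by auto
qed

lemma invertible_matI:
  assumes "A \<in> carrier_mat n n" "A' \<in> carrier_mat n n" "A * A' = 1\<^sub>m n" "A' * A = 1\<^sub>m n"
  shows "invertible_mat (A :: complex mat)"
  using assms unfolding invertible_mat_def inverts_mat_def by auto

lemma invertible_mat_left_cancel: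
  assumes "invertible_mat (S :: complex mat)" "S \<in> carrier_mat n n" "X \<in> carrier_mat n m" "Y \<in> carrier_mat n m"
    "S * X = S * Y"
  shows "X = Y"
proof -
  obtain T where T: "T \<in> carrier_mat n n" "T * S = 1\<^sub>m n" using assms invertible_matE by metis
  have "T * S * X = T * S * Y" using assms T(1) by (simp add: assoc_mult_mat[of _ n n _ n _ m])
  then show ?thesis using assms T by simp
qed

lemma dunford_ss_invertible:
  fixes A :: "complex mat"
  assumes A: "A \<in> carrier_mat n n" "invertible_mat A" "is_dunford A S U"
  shows "invertible_mat S"
proof -
  have S: "S \<in> carrier_mat n n" and U: "U \<in> carrier_mat n n" and SU: "A = S * U"
    using dunfordD[OF A(3,1)] by blast+
  obtain A' where A': "A' \<in> carrier_mat n n" "A * A' = 1\<^sub>m n" using A invertible_matE by metis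
  have *: "S * (U * A') = 1\<^sub>m n" using A'(1,2)[unfolded SU] S U by (simp add: assoc_mult_mat[of _ n n _ n _ n])
  have "(U * A') * S = 1\<^sub>m n"
    by (rule mat_mult_left_right_inverse[OF S _ *]) (use U A' in auto)
  then show ?thesis by (intro invertible_matI[OF S _ *]) (use U A' in auto)
qed

lemma dunford_intertwine_unip:
  fixes A B F :: "complex mat"
  assumes A: "A \<in> carrier_mat n n" "is_dunford A S U"
    and B: "B \<in> carrier_mat p p" "invertible_mat B" "is_dunford B S' U'"
    and F: "F \<in> carrier_mat p n" "F * A = B * F"
  shows "F * U = U' * F"
proof (rule invertible_mat_left_cancel)
  show "invertible_mat S'" by (rule dunford_ss_invertible[OF B])
  have c: "S \<in> carrier_mat n n" "U \<in> carrier_mat n n" "S' \<in> carrier_mat p p" "U' \<in> carrier_mat p p"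
    using dunfordD[OF A(2,1)] dunfordD[OF B(3,1)] by blast+
  then show "S' \<in> carrier_mat p p" "F * U \<in> carrier_mat p n" "U' * F \<in> carrier_mat p n"
    using F by auto
  have "S' * (F * U) = (S' * F) * U" using c F by simp
  also have "\<dots> = (F * S) * U"
    using dunford_intertwine_ss[OF A B(1,3) F] by simp
  also have "\<dots> = F * (S * U)" using c F by simp
  also have "\<dots> = B * F" using F(2) dunfordD(5)[OF A(2,1)] by simp
  also have "\<dots> = S' * (U' * F)" using dunfordD(5)[OF B(3,1)] c F by (simp only: assoc_mult_mat[of S' p p U' p F n])
  finally show "S' * (F * U) = S' * (U' * F)" .
qed

section \<open>Functions of diagonalizable matrices and powers of unipotent matrices\<close>

lemma unipotent_matI:
  assumes "U \<in> carrier_mat n n" "(U - 1\<^sub>m n) ^\<^sub>m k = 0\<^sub>m n n"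
  shows "unipotent_mat U"
  using assms unfolding unipotent_mat_def by auto

lemma is_dunfordI:
  assumes "A \<in> carrier_mat n n" "S \<in> carrier_mat n n" "U \<in> carrier_mat n n"
    "diagonalizable_mat S" "unipotent_mat U" "A = S * U" "S * U = U * S"
  shows "is_dunford A S U"
  using assms unfolding is_dunford_def by simp

lemma diagonalizable_matI:
  assumes "similar_mat_wit S (mat_diag n c) Q P" "S \<in> carrier_mat n n"
  shows "diagonalizable_mat S"
  using assms unfolding diagonalizable_mat_def similar_mat_def by auto

text \<open>Uniqueness is the case $F = 1$ of the statements on intertwiners.\<close>

lemma ss_part_eq:
  assumes "A \<in> carrier_mat n n" "is_dunford A S U"
  shows "ss_part A = S"
  unfolding ss_part_def
proof (rule the_equality)
  fix S' assume "\<exists>U'. is_dunford A S' U'"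
  then obtain U' where d: "is_dunford A S' U'" by blast
  have "1\<^sub>m n * S' = S * 1\<^sub>m n"
    using dunford_intertwine_ss[OF assms(1) d assms, of "1\<^sub>m n"] assms(1) by simp
  then show "S' = S" using dunfordD(1)[OF d assms(1)] dunfordD(1)[OF assms(2,1)] by simp
qed (use assms in blast)

lemma unip_part_eq:
  assumes "A \<in> carrier_mat n n" "invertible_mat A" "is_dunford A S U"
  shows "unip_part A = U"
  unfolding unip_part_def
proof (rule the_equality)
  fix U' assume "\<exists>S'. is_dunford A S' U'"
  then obtain S' where d: "is_dunford A S' U'" by blast
  have "1\<^sub>m n * U' = U * 1\<^sub>m n"
    using dunford_intertwine_unip[OF assms(1) d assms, of "1\<^sub>m n"] assms(1) by simp
  then show "U' = U" using dunfordD(2)[OF d assms(1)] dunfordD(2)[OF assms(3,1)] by simp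
qed (use assms in blast)

lemma char_app_eq:
  assumes "similar_mat_wit S (mat_diag n c) Q P" "S \<in> carrier_mat n n"
  shows "char_app \<gamma> S = Q * mat_diag n (\<lambda>i. \<gamma> (c i)) * P"
proof -
  have n: "dim_row S = n" using assms by auto
  show ?thesis
    unfolding char_app_def n
  proof (rule the_equality)
    fix M assume "\<exists>Q' P' d. similar_mat_wit S (mat_diag n d) Q' P' \<and> M = Q' * mat_diag n (\<lambda>i. \<gamma> (d i)) * P'"
    then obtain Q' P' d where w: "similar_mat_wit S (mat_diag n d) Q' P'"
      and M: "M = Q' * mat_diag n (\<lambda>i. \<gamma> (d i)) * P'" by blast
    have "1\<^sub>m n * M = (Q * mat_diag n (\<lambda>i. \<gamma> (c i)) * P) * 1\<^sub>m n"
      using char_intertwine[OF w assms(2) assms, of "1\<^sub>m n" \<gamma>] assms(2) M by simp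
    moreover have "M \<in> carrier_mat n n" "Q * mat_diag n (\<lambda>i. \<gamma> (c i)) * P \<in> carrier_mat n n"
      using similar_mat_witD2(6,7)[OF assms(2) w] similar_mat_witD2(6,7)[OF assms(2,1)] 
        M mult_carrier_mat mat_diag_dim by metis+
    ultimately show "M = Q * mat_diag n (\<lambda>i. \<gamma> (c i)) * P"
      using left_mult_one_mat right_mult_one_mat by metis
  qed (use assms in blast)
qed

lemma char_app_wit:
  assumes "similar_mat_wit S (mat_diag n c) Q P" "S \<in> carrier_mat n n"
  shows "similar_mat_wit (char_app \<gamma> S) (mat_diag n (\<lambda>i. \<gamma> (c i))) Q P"
  using similar_mat_witD2(1,2,6,7)[OF assms(2,1)]
  by (intro similar_mat_witI[of _ _ n])
     (simp_all add: char_app_eq[OF assms] mult_carrier_mat[OF mult_carrier_mat[OF _ mat_diag_dim]] del: assoc_mult_mat)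

lemma char_app_carrier:
  assumes "diagonalizable_mat S" "S \<in> carrier_mat n n"
  shows "char_app \<gamma> S \<in> carrier_mat n n"
proof -
  obtain c Q P where w: "similar_mat_wit S (mat_diag n c) Q P" using diagonalizable_wit[OF assms] .
  from char_app_wit[OF w assms(2), of \<gamma>] show ?thesis
    unfolding similar_mat_wit_def Let_def
    using similar_mat_witD2(6)[OF assms(2) w] by (metis carrier_matD(1) insert_subset)
qed

lemma char_app_intertwine:
  assumes "diagonalizable_mat S" "S \<in> carrier_mat n n" "diagonalizable_mat S'" "S' \<in> carrier_mat p p"
    "F \<in> carrier_mat p n" "F * S = S' * F"
  shows "F * char_app \<gamma> S = char_app \<gamma> S' * F"
proof -
  obtain c Q P where w: "similar_mat_wit S (mat_diag n c) Q P" using diagonalizable_wit assms by metis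
  obtain d Q' P' where w': "similar_mat_wit S' (mat_diag p d) Q' P'" using diagonalizable_wit assms by metis
  show ?thesis
    using char_intertwine[OF w assms(2) w' assms(4-6)] char_app_eq[OF w assms(2)] char_app_eq[OF w' assms(4)] by simp
qed

lemma unip_pow_carrier: "U \<in> carrier_mat n n \<Longrightarrow> unip_pow U l \<in> carrier_mat n n"
  unfolding unip_pow_def by auto

text \<open>Any bound \<open>m\<close> on the nilpotency order may be used, so that several unipotent matrices can be
  expanded over the same range of summation.\<close>

lemma unip_pow_index:
  assumes "U \<in> carrier_mat n n" "(U - 1\<^sub>m n) ^\<^sub>m m = 0\<^sub>m n n" "i < n" "j < n"
  shows "unip_pow U l $$ (i, j) = (\<Sum>k<m. (l gchoose k) * ((U - 1\<^sub>m n) ^\<^sub>m k) $$ (i, j))"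
proof -
  have "unip_pow U l $$ (i, j) = (\<Sum>k. (l gchoose k) * ((U - 1\<^sub>m n) ^\<^sub>m k) $$ (i, j))"
    using assms unfolding unip_pow_def by auto
  also have "\<dots> = (\<Sum>k<m. (l gchoose k) * ((U - 1\<^sub>m n) ^\<^sub>m k) $$ (i, j))"
  proof (rule suminf_finite)
    fix k assume "k \<notin> {..<m}"
    then have "(U - 1\<^sub>m n) ^\<^sub>m k = 0\<^sub>m n n"
      using pow_mat_zero_mono[OF _ assms(2), of k] by (simp add: minus_carrier_mat)
    then show "(l gchoose k) * ((U - 1\<^sub>m n) ^\<^sub>m k) $$ (i, j) = 0" using assms by simp
  qed simp
  finally show ?thesis .
qed

lemma index_mult_sum:
  assumes "A \<in> carrier_mat p n" "B \<in> carrier_mat n m" "i < p" "j < m"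
  shows "(A * B) $$ (i, j) = (\<Sum>a<n. A $$ (i, a) * B $$ (a, j))"
  using assms by (auto simp: scalar_prod_def lessThan_atLeast0)

lemma unip_pow_intertwine:
  assumes U: "U \<in> carrier_mat n n" "unipotent_mat U" and U': "U' \<in> carrier_mat p p" "unipotent_mat U'"
    and F: "F \<in> carrier_mat p n" "F * U = U' * F"
  shows "F * unip_pow U l = unip_pow U' l * F"
proof -
  obtain k where k: "(U - 1\<^sub>m n) ^\<^sub>m k = 0\<^sub>m n n" using unipotentE U by metis
  obtain k' where k': "(U' - 1\<^sub>m p) ^\<^sub>m k' = 0\<^sub>m p p" using unipotentE U' by metis
  define m where "m = max k k'"
  have U1: "U - 1\<^sub>m n \<in> carrier_mat n n" "U' - 1\<^sub>m p \<in> carrier_mat p p" by (auto intro: minus_carrier_mat)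
  have m: "(U - 1\<^sub>m n) ^\<^sub>m m = 0\<^sub>m n n" "(U' - 1\<^sub>m p) ^\<^sub>m m = 0\<^sub>m p p"
    using pow_mat_zero_mono[OF U1(1) k, of m] pow_mat_zero_mono[OF U1(2) k', of m] by (auto simp: m_def)
  have FN: "F * (U - 1\<^sub>m n) = (U' - 1\<^sub>m p) * F"
    using U U' F by (simp add: mult_minus_distrib_mat[of _ p n] minus_mult_distrib_mat[of _ p p])
  have pw: "F * (U - 1\<^sub>m n) ^\<^sub>m r = (U' - 1\<^sub>m p) ^\<^sub>m r * F" for r
    by (rule pow_mat_intertwine[OF U1 F(1) FN])
  have c: "(U - 1\<^sub>m n) ^\<^sub>m r \<in> carrier_mat n n" "(U' - 1\<^sub>m p) ^\<^sub>m r \<in> carrier_mat p p" for r using U1 by auto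
  show ?thesis
  proof (rule eq_matI)
    fix i j assume "i < dim_row (unip_pow U' l * F)" "j < dim_col (unip_pow U' l * F)"
    then have ij: "i < p" "j < n" using F unip_pow_carrier[OF U'(1), of l] by auto
    have "(F * unip_pow U l) $$ (i, j) = (\<Sum>a<n. F $$ (i, a) * (\<Sum>r<m. (l gchoose r) * ((U - 1\<^sub>m n) ^\<^sub>m r) $$ (a, j)))"
      using ij by (subst index_mult_sum[OF F(1) unip_pow_carrier[OF U(1)]]) (auto intro!: sum.cong simp: unip_pow_index[OF U(1) m(1)])
    also have "\<dots> = (\<Sum>r<m. (l gchoose r) * (F * (U - 1\<^sub>m n) ^\<^sub>m r) $$ (i, j))"
      unfolding index_mult_sum[OF F(1) c(1) ij] sum_distrib_left
      by (subst sum.swap) (simp add: algebra_simps)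
    also have "\<dots> = (\<Sum>r<m. (l gchoose r) * ((U' - 1\<^sub>m p) ^\<^sub>m r * F) $$ (i, j))" unfolding pw ..
    also have "\<dots> = (\<Sum>a<p. (\<Sum>r<m. (l gchoose r) * ((U' - 1\<^sub>m p) ^\<^sub>m r) $$ (i, a)) * F $$ (a, j))"
      unfolding index_mult_sum[OF c(2) F(1) ij] sum_distrib_left sum_distrib_right
      by (subst sum.swap) (simp add: algebra_simps)
    also have "\<dots> = (unip_pow U' l * F) $$ (i, j)"
      using ij by (subst index_mult_sum[OF unip_pow_carrier[OF U'(1)] F(1)]) (auto intro!: sum.cong simp: unip_pow_index[OF U'(1) m(2)])
    finally show "(F * unip_pow U l) $$ (i, j) = (unip_pow U' l * F) $$ (i, j)" .
  qed (use F unip_pow_carrier[OF U(1), of l] unip_pow_carrier[OF U'(1), of l] in auto)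
qed

lemma unip_pow_0: "U \<in> carrier_mat n n \<Longrightarrow> unipotent_mat U \<Longrightarrow> unip_pow U 0 = 1\<^sub>m n"
proof -
  assume U: "U \<in> carrier_mat n n" "unipotent_mat U"
  obtain k where k: "(U - 1\<^sub>m n) ^\<^sub>m k = 0\<^sub>m n n" using unipotentE U by metis
  have k': "(U - 1\<^sub>m n) ^\<^sub>m Suc k = 0\<^sub>m n n"
    using pow_mat_zero_mono[OF _ k, of "Suc k"] by (simp add: minus_carrier_mat)
  have "unip_pow U 0 $$ (i,j) = 1\<^sub>m n $$ (i, j)" if "i < n" "j < n" for i j
    unfolding unip_pow_index[OF U(1) k' that] using U(1) that
    by (subst sum.lessThan_Suc_shift) (simp add: gbinomial_0_left del: pow_mat.simps(2) index_mult_mat(1))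
  then show ?thesis using unip_pow_carrier[OF U(1), of 0] by (intro eq_matI) auto
qed

lemma unip_pow_one: "unip_pow (1\<^sub>m n) l = 1\<^sub>m n"
proof (rule eq_matI)
  fix i j assume "i < dim_row (1\<^sub>m n :: complex mat)" "j < dim_col (1\<^sub>m n :: complex mat)"
  then have ij: "i < n" "j < n" by auto
  have "(1\<^sub>m n - 1\<^sub>m n :: complex mat) ^\<^sub>m 1 = 0\<^sub>m n n" by (intro eq_matI) auto
  from unip_pow_index[OF one_carrier_mat this ij] show "unip_pow (1\<^sub>m n) l $$ (i, j) = 1\<^sub>m n $$ (i, j)"
    using ij by simp
qed (use unip_pow_carrier[OF one_carrier_mat, of n l] in auto)

text \<open>Pascal's rule for generalized binomial coefficients, with $U = 1 + (U - 1)$.\<close>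

lemma unip_pow_plus_1:
  assumes U: "U \<in> carrier_mat n n" "unipotent_mat U"
  shows "unip_pow U (l + 1) = unip_pow U l * U"
proof -
  obtain k where k: "(U - 1\<^sub>m n) ^\<^sub>m k = 0\<^sub>m n n" using unipotentE U by metis
  let ?N = "U - 1\<^sub>m n"
  have N: "?N \<in> carrier_mat n n" by (auto intro: minus_carrier_mat)
  have Nr: "?N ^\<^sub>m r \<in> carrier_mat n n" for r using N by auto
  have k': "?N ^\<^sub>m Suc k = 0\<^sub>m n n" using pow_mat_zero_mono[OF N k, of "Suc k"] by simp
  have UN: "X * U = X + X * ?N" if "X \<in> carrier_mat n n" for X
  proof -
    have "X * ?N = X * U - X" using that U mult_minus_distrib_mat[OF that U(1) one_carrier_mat] by simp
    then show ?thesis using that U by (intro eq_matI) (auto simp del: index_mult_mat(1))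
  qed
  have "unip_pow U (l + 1) $$ (i, j) = (unip_pow U l * U) $$ (i, j)" if ij: "i < n" "j < n" for i j
  proof -
    have "(unip_pow U l * U) $$ (i, j) = (\<Sum>a<n. (\<Sum>r<Suc k. (l gchoose r) * (?N ^\<^sub>m r) $$ (i, a)) * U $$ (a, j))"
      using ij by (subst index_mult_sum[OF unip_pow_carrier[OF U(1)] U(1)]) (auto intro!: sum.cong simp: unip_pow_index[OF U(1) k'])
    also have "\<dots> = (\<Sum>r<Suc k. (l gchoose r) * (?N ^\<^sub>m r * U) $$ (i, j))"
      unfolding index_mult_sum[OF Nr U(1) ij] sum_distrib_left sum_distrib_right
      by (subst sum.swap) (simp add: algebra_simps)
    also have "\<dots> = (\<Sum>r<Suc k. (l gchoose r) * (?N ^\<^sub>m r) $$ (i, j)) + (\<Sum>r<Suc k. (l gchoose r) * (?N ^\<^sub>m Suc r) $$ (i, j))"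
      unfolding UN[OF Nr] using ij Nr N by (simp add: algebra_simps sum.distrib del: index_mult_mat(1))
    also have "(\<Sum>r<Suc k. (l gchoose r) * (?N ^\<^sub>m Suc r) $$ (i, j)) = (\<Sum>r<k. (l gchoose r) * (?N ^\<^sub>m Suc r) $$ (i, j))"
      using ij by (simp add: k' del: pow_mat.simps(2) index_mult_mat(1))
    also have "(\<Sum>r<Suc k. (l gchoose r) * (?N ^\<^sub>m r) $$ (i, j)) = 
        (?N ^\<^sub>m 0) $$ (i, j) + (\<Sum>r<k. (l gchoose Suc r) * (?N ^\<^sub>m Suc r) $$ (i, j))"
      by (subst sum.lessThan_Suc_shift) simp
    finally have "(unip_pow U l * U) $$ (i, j) = 
       (?N ^\<^sub>m 0) $$ (i, j) + (\<Sum>r<k. ((l + 1) gchoose Suc r) * (?N ^\<^sub>m Suc r) $$ (i, j))"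
      by (simp add: gbinomial_Suc_Suc ring_distribs sum.distrib del: pow_mat.simps(2) index_mult_mat(1))
    also have "\<dots> = (\<Sum>r<Suc k. ((l + 1) gchoose r) * (?N ^\<^sub>m r) $$ (i, j))"
      by (subst sum.lessThan_Suc_shift) simp
    finally show ?thesis unfolding unip_pow_index[OF U(1) k' ij] by simp
  qed
  then show ?thesis using unip_pow_carrier[OF U(1), of l] unip_pow_carrier[OF U(1), of "l + 1"] U
    by (intro eq_matI) (auto simp del: index_mult_mat(1))
qed

lemma unip_pow_of_nat:
  assumes "U \<in> carrier_mat n n" "unipotent_mat U"
  shows "unip_pow U (of_nat r) = U ^\<^sub>m r"
  using assms
  by (induction r) (auto simp: unip_pow_0 unip_pow_plus_1 add.commute[of 1])

text \<open>Entries of $U^\lambda$ are polynomial in $\lambda$. Identities between them therefore need to be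
  checked only for natural exponents, where $U^\lambda$ is an ordinary power.\<close>

definition poly_fun :: "(complex \<Rightarrow> complex) \<Rightarrow> bool" where
  "poly_fun f \<longleftrightarrow> (\<exists>p. f = poly p)"

lemma poly_fun_const: "poly_fun (\<lambda>_. c)"
  unfolding poly_fun_def by (rule exI[of _ "[:c:]"]) auto

lemma poly_fun_add: "poly_fun f \<Longrightarrow> poly_fun g \<Longrightarrow> poly_fun (\<lambda>x. f x + g x)"
  unfolding poly_fun_def by (elim exE, rule_tac x = "p + pa" in exI) auto

lemma poly_fun_mult: "poly_fun f \<Longrightarrow> poly_fun g \<Longrightarrow> poly_fun (\<lambda>x. f x * g x)"
  unfolding poly_fun_def by (elim exE, rule_tac x = "p * pa" in exI) auto

lemma poly_fun_sum: "(\<And>i. i \<in> I \<Longrightarrow> poly_fun (f i)) \<Longrightarrow> poly_fun (\<lambda>x. \<Sum>i\<in>I. f i x)"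
  by (induction I rule: infinite_finite_induct) (auto intro: poly_fun_const poly_fun_add)

lemma poly_fun_shift: "poly_fun f \<Longrightarrow> poly_fun (\<lambda>x. f (x + c))"
  unfolding poly_fun_def
proof (elim exE)
  fix p assume "f = poly p"
  then show "\<exists>r. (\<lambda>x. f (x + c)) = poly r"
    by (intro exI[of _ "pcompose p [:c, 1:]"]) (auto simp: poly_pcompose add.commute)
qed

lemma poly_fun_gbinomial: "poly_fun (\<lambda>x. x gchoose k)"
proof (induction k)
  case (Suc k)
  have "(\<lambda>x::complex. x gchoose Suc k) = (\<lambda>x. (x + (- of_nat k)) * (x gchoose k) * inverse (of_nat (Suc k)))"
  proof
    fix x :: complex
    have "of_nat (Suc k) * (x gchoose Suc k) = (x - of_nat k) * (x gchoose k)"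
      using gbinomial_mult_1[of x k] by (simp add: algebra_simps)
    then show "x gchoose Suc k = (x + (- of_nat k)) * (x gchoose k) * inverse (of_nat (Suc k))"
      by (simp add: field_simps del: of_nat_Suc)
  qed
  moreover have "poly_fun (\<lambda>x. x + c)" for c
    unfolding poly_fun_def by (rule exI[of _ "[:c, 1:]"]) (auto simp: add.commute)
  ultimately show ?case using Suc by (simp only:) (intro poly_fun_mult poly_fun_const)
qed (auto intro: poly_fun_const)

lemma poly_fun_eqI:
  assumes "poly_fun f" "poly_fun g" "\<And>r::nat. f (of_nat r) = g (of_nat r)"
  shows "f x = g x"
proof -
  obtain p s where p: "f = poly p" and s: "g = poly s" using assms unfolding poly_fun_def by auto
  have "range (of_nat :: nat \<Rightarrow> complex) \<subseteq> {x. poly (p - s) x = 0}" using assms(3) p s by auto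
  moreover have "infinite (range (of_nat :: nat \<Rightarrow> complex))"
    by (rule range_inj_infinite) (auto simp: inj_on_def)
  ultimately have "p - s = 0" using poly_roots_finite finite_subset by blast
  then show ?thesis using p s by simp
qed

lemma poly_fun_unip_pow:
  assumes U: "U \<in> carrier_mat n n" "unipotent_mat U" and ij: "i < n" "j < n"
  shows "poly_fun (\<lambda>l. unip_pow U l $$ (i, j))"
proof -
  obtain k where k: "(U - 1\<^sub>m n) ^\<^sub>m k = 0\<^sub>m n n" using unipotentE U by metis
  show ?thesis unfolding unip_pow_index[OF U(1) k ij]
    by (intro poly_fun_sum poly_fun_mult poly_fun_const poly_fun_gbinomial)
qed

lemma unip_pow_add:
  assumes U: "U \<in> carrier_mat n n" "unipotent_mat U"
  shows "unip_pow U (l + l') = unip_pow U l * unip_pow U l'"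
proof (rule eq_matI)
  have nat: "unip_pow U (l + of_nat r) = unip_pow U l * unip_pow U (of_nat r)" for l r
  proof (induction r)
    case 0
    then show ?case using U unip_pow_carrier[OF U(1), of l] by (simp add: unip_pow_0)
  next
    case (Suc r)
    have "unip_pow U (l + of_nat (Suc r)) = unip_pow U (l + of_nat r) * U"
      using unip_pow_plus_1[OF U, of "l + of_nat r"] by (simp add: add_ac)
    also have "\<dots> = unip_pow U l * (unip_pow U (of_nat r) * U)"
      using Suc U unip_pow_carrier[OF U(1)] by (simp add: assoc_mult_mat[of _ n n _ n _ n])
    also have "\<dots> = unip_pow U l * unip_pow U (of_nat (Suc r))"
      using unip_pow_plus_1[OF U, of "of_nat r"] by (simp add: add_ac)
    finally show ?case .
  qed
  fix i j assume "i < dim_row (unip_pow U l * unip_pow U l')" "j < dim_col (unip_pow U l * unip_pow U l')"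
  then have ij: "i < n" "j < n" using unip_pow_carrier[OF U(1)] by (metis carrier_matD index_mult_mat(2,3))+
  show "unip_pow U (l + l') $$ (i, j) = (unip_pow U l * unip_pow U l') $$ (i, j)"
  proof (rule poly_fun_eqI[where x = l'])
    show "poly_fun (\<lambda>l'. unip_pow U (l + l') $$ (i, j))"
      using poly_fun_shift[OF poly_fun_unip_pow[OF U ij], of l] by (simp add: add.commute)
    show "poly_fun (\<lambda>l'. (unip_pow U l * unip_pow U l') $$ (i, j))"
      unfolding index_mult_sum[OF unip_pow_carrier[OF U(1)] unip_pow_carrier[OF U(1)] ij]
      by (intro poly_fun_sum poly_fun_mult poly_fun_const poly_fun_unip_pow[OF U]) (use ij in auto)
  qed (simp only: nat)
qed (use unip_pow_carrier[OF U(1), of l] unip_pow_carrier[OF U(1), of l'] unip_pow_carrier[OF U(1), of "l + l'"] in auto)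

section \<open>Kronecker products\<close>

lemma kronecker_carrier:
  assumes "A \<in> carrier_mat p n" "B \<in> carrier_mat r m"
  shows "kronecker A B \<in> carrier_mat (p * r) (n * m)"
  using assms unfolding kronecker_def by auto

lemma kronecker_index:
  assumes "A \<in> carrier_mat p n" "B \<in> carrier_mat r m" "i < p * r" "j < n * m"
  shows "kronecker A B $$ (i, j) = A $$ (i div r, j div m) * B $$ (i mod r, j mod m)"
  using assms unfolding kronecker_def by auto

lemma div_mod_less:
  assumes "i < n * (m::nat)"
  shows "i div m < n" "i mod m < m"
proof -
  have "m > 0" using assms by (cases m) auto
  then show "i mod m < m" "i div m < n" using assms by (auto simp: less_mult_imp_div_less)
qed

lemma sum_div_mod:
  "(\<Sum>k<n * m. f (k div m) (k mod m)) = (\<Sum>a<n. \<Sum>b<m::nat. f a b)"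
proof -
  have "(\<Sum>k<n * m. f (k div m) (k mod m)) = (\<Sum>(a, b)\<in>{..<n} \<times> {..<m}. f a b)"
  proof (rule sum.reindex_bij_witness[where i = "\<lambda>(a, b). a * m + b" and j = "\<lambda>k. (k div m, k mod m)"])
    fix x assume "x \<in> {..<n} \<times> {..<m}"
    then obtain a b where x: "x = (a, b)" "a < n" "b < m" by auto
    have "a * m + b < Suc a * m" using x by simp
    also have "\<dots> \<le> n * m" using x by (intro mult_right_mono) auto
    finally show "(case x of (a, b) \<Rightarrow> a * m + b) \<in> {..<n * m}" using x by simp
  qed (auto simp: div_mod_less)
  then show ?thesis by (simp add: sum.cartesian_product)
qed

lemma kronecker_mult:
  assumes A: "A \<in> carrier_mat p n" and B: "B \<in> carrier_mat r m"
    and C: "C \<in> carrier_mat n s" and D: "D \<in> carrier_mat m t"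
  shows "kronecker A B * kronecker C D = kronecker (A * C) (B * D)"
proof (rule eq_matI)
  have AC: "A * C \<in> carrier_mat p s" and BD: "B * D \<in> carrier_mat r t" using A B C D by auto
  note c1 = kronecker_carrier[OF A B] and c2 = kronecker_carrier[OF C D] and c3 = kronecker_carrier[OF AC BD]
  fix i j assume "i < dim_row (kronecker (A * C) (B * D))" "j < dim_col (kronecker (A * C) (B * D))"
  then have ij: "i < p * r" "j < s * t" using c3 by auto
  note im = div_mod_less[OF ij(1)] and jm = div_mod_less[OF ij(2)]
  have "(kronecker A B * kronecker C D) $$ (i, j) = 
      (\<Sum>k<n * m. A $$ (i div r, k div m) * B $$ (i mod r, k mod m) * (C $$ (k div m, j div t) * D $$ (k mod m, j mod t)))"
    unfolding index_mult_sum[OF c1 c2 ij]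
    by (rule sum.cong) (simp_all add: kronecker_index[OF A B ij(1)] kronecker_index[OF C D _ ij(2)])
  also have "\<dots> = (\<Sum>a<n. \<Sum>b<m. A $$ (i div r, a) * B $$ (i mod r, b) * (C $$ (a, j div t) * D $$ (b, j mod t)))"
    by (rule sum_div_mod)
  also have "\<dots> = (\<Sum>a<n. A $$ (i div r, a) * C $$ (a, j div t)) * (\<Sum>b<m. B $$ (i mod r, b) * D $$ (b, j mod t))"
    by (simp add: sum_product mult_ac)
  also have "\<dots> = kronecker (A * C) (B * D) $$ (i, j)"
    by (simp add: kronecker_index[OF AC BD ij] index_mult_sum[OF A C im(1) jm(1)] index_mult_sum[OF B D im(2) jm(2)]
        del: index_mult_mat)
  finally show "(kronecker A B * kronecker C D) $$ (i, j) = kronecker (A * C) (B * D) $$ (i, j)" .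
qed (use kronecker_carrier[OF A B] kronecker_carrier[OF C D] assms in \<open>auto simp: kronecker_def\<close>)

lemma kronecker_diag:
  "kronecker (mat_diag n c) (mat_diag m d) = mat_diag (n * m) (\<lambda>i. c (i div m) * d (i mod m))"
proof (rule eq_matI)
  fix i j assume "i < dim_row (mat_diag (n * m) (\<lambda>i. c (i div m) * d (i mod m)))" 
    "j < dim_col (mat_diag (n * m) (\<lambda>i. c (i div m) * d (i mod m)))"
  then have ij: "i < n * m" "j < n * m" by (auto simp: mat_diag_def)
  have "i div m = j div m \<and> i mod m = j mod m \<longleftrightarrow> i = j" by (metis div_mult_mod_eq)
  then show "kronecker (mat_diag n c) (mat_diag m d) $$ (i, j) = mat_diag (n * m) (\<lambda>i. c (i div m) * d (i mod m)) $$ (i, j)"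
    using ij div_mod_less[OF ij(1)] div_mod_less[OF ij(2)] 
    by (subst kronecker_index[OF mat_diag_dim mat_diag_dim ij]) (auto simp: mat_diag_def)
qed (auto simp: kronecker_def mat_diag_def)

lemma kronecker_one: "kronecker (1\<^sub>m n) (1\<^sub>m m) = 1\<^sub>m (n * m)"
  using kronecker_diag[of n "\<lambda>_. 1" m "\<lambda>_. 1"] by simp

lemma kronecker_pow:
  assumes "A \<in> carrier_mat n n" "B \<in> carrier_mat m m"
  shows "kronecker A B ^\<^sub>m k = kronecker (A ^\<^sub>m k) (B ^\<^sub>m k)"
proof (induction k)
  case 0
  then show ?case using assms by (simp add: kronecker_one) (simp add: kronecker_def)
next
  case (Suc k)
  then show ?case using assms by (simp add: kronecker_mult[of _ n n _ m m _ n _ m])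
qed

lemma kronecker_invertible:
  assumes "A \<in> carrier_mat n n" "B \<in> carrier_mat m m" "invertible_mat A" "invertible_mat B"
  shows "invertible_mat (kronecker A B)"
proof -
  obtain A' where A': "A' \<in> carrier_mat n n" "A * A' = 1\<^sub>m n" "A' * A = 1\<^sub>m n" using assms invertible_matE by metis
  obtain B' where B': "B' \<in> carrier_mat m m" "B * B' = 1\<^sub>m m" "B' * B = 1\<^sub>m m" using assms invertible_matE by metis
  show ?thesis
    by (rule invertible_matI[of _ "n * m" "kronecker A' B'"])
      (use assms A' B' in \<open>auto simp: kronecker_carrier kronecker_mult[of _ n n _ m m _ n _ m] kronecker_one\<close>)
qed

lemma kronecker_similar_wit:
  assumes w: "similar_mat_wit S D Q P" "S \<in> carrier_mat n n" and w': "similar_mat_wit S' D' Q' P'" "S' \<in> carrier_mat m m"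
  shows "similar_mat_wit (kronecker S S') (kronecker D D') (kronecker Q Q') (kronecker P P')"
proof -
  note * = similar_mat_witD2[OF w(2,1)] and ** = similar_mat_witD2[OF w'(2,1)]
  note km = kronecker_mult[of _ n n _ m m _ n _ m]
  have c: "Q * D \<in> carrier_mat n n" "Q' * D' \<in> carrier_mat m m" using *(4-) **(4-) by (auto intro: mult_carrier_mat)
  have "kronecker S S' = kronecker Q Q' * kronecker D D' * kronecker P P'"
    using km[OF *(6) **(6) *(5) **(5)] km[OF c *(7) **(7)] *(3) **(3) by simp
  moreover have "kronecker Q Q' * kronecker P P' = 1\<^sub>m (n * m)" "kronecker P P' * kronecker Q Q' = 1\<^sub>m (n * m)"
    using km[OF *(6) **(6) *(7) **(7)] km[OF *(7) **(7) *(6) **(6)] *(1,2) **(1,2) kronecker_one by metis+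
  ultimately show ?thesis
    using kronecker_carrier[OF *(4) **(4)] kronecker_carrier[OF *(5) **(5)] kronecker_carrier[OF *(6) **(6)] kronecker_carrier[OF *(7) **(7)]
    by (intro similar_mat_witI[of _ _ "n * m"])
qed

text \<open>The factor \<open>X\<close> allows an induction on \<open>a + b\<close> that avoids the binomial expansion:
  $(A + B) X$ splits into $A X$ and $B X$, and each of them lowers one of the two exponents.\<close>

lemma commuting_nilpotent_add:
  fixes A B X :: "complex mat"
  assumes A: "A \<in> carrier_mat n n" and B: "B \<in> carrier_mat n n" and comm: "A * B = B * A"
    and X: "X \<in> carrier_mat n n" "A ^\<^sub>m a * X = 0\<^sub>m n n" "B ^\<^sub>m b * X = 0\<^sub>m n n"
  shows "(A + B) ^\<^sub>m (a + b) * X = 0\<^sub>m n n"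
  using X
proof (induction "a + b" arbitrary: a b X)
  case 0
  then show ?case using A B by auto
next
  case (Suc k)
  have AB: "A + B \<in> carrier_mat n n" using A B by auto
  have ABk: "(A + B) ^\<^sub>m r \<in> carrier_mat n n" for r using AB by auto
  note as = assoc_mult_mat[of _ n n _ n _ n]
  show ?case
  proof (cases "a = 0 \<or> b = 0")
    case True
    then have "X = 0\<^sub>m n n" using Suc.prems A B by auto
    then show ?thesis using right_mult_zero_mat[OF ABk] by simp
  next
    case False
    then obtain a' b' where a: "a = Suc a'" and b: "b = Suc b'" by (metis not0_implies_Suc)
    have AX: "A * X \<in> carrier_mat n n" and BX: "B * X \<in> carrier_mat n n" using A B Suc.prems by auto
    have k: "a + b = Suc k" using Suc.hyps by simp
    have "(A + B) ^\<^sub>m (a + b) * X = (A + B) ^\<^sub>m k * ((A + B) * X)"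
      unfolding k using ABk[of k] AB Suc.prems by (simp add: as)
    also have "\<dots> = (A + B) ^\<^sub>m k * (A * X + B * X)"
      using add_mult_distrib_mat[OF A B Suc.prems(1)] by simp
    also have "\<dots> = (A + B) ^\<^sub>m k * (A * X) + (A + B) ^\<^sub>m k * (B * X)"
      using mult_add_distrib_mat[OF ABk AX BX] .
    also have "(A + B) ^\<^sub>m k * (A * X) = 0\<^sub>m n n"
    proof -
      have "A ^\<^sub>m a' * (A * X) = 0\<^sub>m n n" using Suc.prems(1,2) A unfolding a by (simp add: as)
      moreover have "B ^\<^sub>m b * (A * X) = 0\<^sub>m n n"
      proof -
        have "A * B ^\<^sub>m b = B ^\<^sub>m b * A" by (rule pow_mat_intertwine[OF B B A comm])
        then have "B ^\<^sub>m b * (A * X) = A * (B ^\<^sub>m b * X)" using A B Suc.prems(1) by (metis as pow_carrier_mat)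
        then show ?thesis using Suc.prems(3) A by simp
      qed
      ultimately show ?thesis using Suc.hyps(1)[of a' b "A * X"] k a AX by simp
    qed
    also have "(A + B) ^\<^sub>m k * (B * X) = 0\<^sub>m n n"
    proof -
      have "B ^\<^sub>m b' * (B * X) = 0\<^sub>m n n" using Suc.prems(1,3) B unfolding b by (simp add: as)
      moreover have "A ^\<^sub>m a * (B * X) = 0\<^sub>m n n"
      proof -
        have "B * A ^\<^sub>m a = A ^\<^sub>m a * B" by (rule pow_mat_intertwine[OF A A B comm[symmetric]])
        then have "A ^\<^sub>m a * (B * X) = B * (A ^\<^sub>m a * X)" using A B Suc.prems(1) by (metis as pow_carrier_mat)
        then show ?thesis using Suc.prems(2) B by simp
      qed
      ultimately show ?thesis using Suc.hyps(1)[of a b' "B * X"] k b BX by simp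
    qed
    finally show ?thesis by simp
  qed
qed

lemma kronecker_zero_left: "kronecker (0\<^sub>m n n) (B :: complex mat) = 0\<^sub>m (n * dim_row B) (n * dim_col B)"
  by (rule eq_matI) (auto simp: kronecker_def div_mod_less)

lemma kronecker_zero_right: "kronecker (A :: complex mat) (0\<^sub>m n n) = 0\<^sub>m (dim_row A * n) (dim_col A * n)"
  by (rule eq_matI) (auto simp: kronecker_def div_mod_less)

text \<open>$U \otimes V - 1 = (U - 1) \otimes V + 1 \otimes (V - 1)$ is a sum of two commuting nilpotent matrices.\<close>

lemma kronecker_unipotent:
  assumes U: "U \<in> carrier_mat n n" "unipotent_mat U" and V: "V \<in> carrier_mat m m" "unipotent_mat V"
  shows "unipotent_mat (kronecker U V)"
proof -
  obtain a where a: "(U - 1\<^sub>m n) ^\<^sub>m a = 0\<^sub>m n n" using unipotentE U by metis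
  obtain b where b: "(V - 1\<^sub>m m) ^\<^sub>m b = 0\<^sub>m m m" using unipotentE V by metis
  have N: "U - 1\<^sub>m n \<in> carrier_mat n n" and N': "V - 1\<^sub>m m \<in> carrier_mat m m" by (auto intro: minus_carrier_mat)
  let ?A = "kronecker (U - 1\<^sub>m n) V" and ?B = "kronecker (1\<^sub>m n) (V - 1\<^sub>m m)"
  have A: "?A \<in> carrier_mat (n * m) (n * m)" and B: "?B \<in> carrier_mat (n * m) (n * m)"
    using kronecker_carrier[OF N V(1)] kronecker_carrier[OF one_carrier_mat N'] by auto
  have "V * (V - 1\<^sub>m m) = (V - 1\<^sub>m m) * V"
    using V by (simp add: mult_minus_distrib_mat[of _ m m] minus_mult_distrib_mat[of _ m m])
  then have comm: "?A * ?B = ?B * ?A"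
    using N N' by (simp add: kronecker_mult[OF N V(1) one_carrier_mat N'] kronecker_mult[OF one_carrier_mat N' N V(1)])
  have "?A ^\<^sub>m a = 0\<^sub>m (n * m) (n * m)"
    using V by (simp add: kronecker_pow[OF N V(1)] a kronecker_zero_left)
  moreover have "?B ^\<^sub>m b = 0\<^sub>m (n * m) (n * m)"
    by (simp add: kronecker_pow[OF one_carrier_mat N'] b kronecker_zero_right)
  ultimately have "(?A + ?B) ^\<^sub>m (a + b) * 1\<^sub>m (n * m) = 0\<^sub>m (n * m) (n * m)"
    using commuting_nilpotent_add[OF A B comm one_carrier_mat, of a b] by simp
  then have "(?A + ?B) ^\<^sub>m (a + b) = 0\<^sub>m (n * m) (n * m)" using A B by (simp add: pow_carrier_mat)
  moreover have "?A + ?B = kronecker U V - 1\<^sub>m (n * m)"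
  proof (rule eq_matI)
    fix i j assume "i < dim_row (kronecker U V - 1\<^sub>m (n * m))" "j < dim_col (kronecker U V - 1\<^sub>m (n * m))"
    then have ij: "i < n * m" "j < n * m" by auto
    note im = div_mod_less[OF ij(1)] and jm = div_mod_less[OF ij(2)]
    have eq: "i = j \<longleftrightarrow> i div m = j div m \<and> i mod m = j mod m" by (metis div_mult_mod_eq)
    show "(?A + ?B) $$ (i, j) = (kronecker U V - 1\<^sub>m (n * m)) $$ (i, j)"
      using A B ij im jm U V kronecker_carrier[OF U(1) V(1)]
      by (simp add: kronecker_index[OF N V(1) ij] kronecker_index[OF one_carrier_mat N' ij] kronecker_index[OF U(1) V(1) ij] eq algebra_simps)
  qed (use A B in auto)
  ultimately show ?thesis using unipotent_matI[OF kronecker_carrier[OF U(1) V(1)]] by simp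
qed

lemma kronecker_unip_pow:
  assumes U: "U \<in> carrier_mat n n" "unipotent_mat U" and V: "V \<in> carrier_mat m m" "unipotent_mat V"
  shows "unip_pow (kronecker U V) l = kronecker (unip_pow U l) (unip_pow V l)"
proof (rule eq_matI)
  note c = unip_pow_carrier[OF U(1)] unip_pow_carrier[OF V(1)]
  note K = kronecker_carrier[OF U(1) V(1)] kronecker_unipotent[OF U V]
  fix i j assume "i < dim_row (kronecker (unip_pow U l) (unip_pow V l))" "j < dim_col (kronecker (unip_pow U l) (unip_pow V l))"
  then have ij: "i < n * m" "j < n * m" using kronecker_carrier[OF c] by (metis carrier_matD)+
  show "unip_pow (kronecker U V) l $$ (i, j) = kronecker (unip_pow U l) (unip_pow V l) $$ (i, j)"
  proof (rule poly_fun_eqI[where x = l])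
    show "poly_fun (\<lambda>l. unip_pow (kronecker U V) l $$ (i, j))"
      by (rule poly_fun_unip_pow[OF K ij])
    show "poly_fun (\<lambda>l. kronecker (unip_pow U l) (unip_pow V l) $$ (i, j))"
      unfolding kronecker_index[OF c ij] using div_mod_less[OF ij(1)] div_mod_less[OF ij(2)]
      by (intro poly_fun_mult poly_fun_unip_pow[OF U] poly_fun_unip_pow[OF V])
  qed (simp add: unip_pow_of_nat[OF U] unip_pow_of_nat[OF V] unip_pow_of_nat[OF K] kronecker_pow[OF U(1) V(1)])
qed (use kronecker_carrier[OF unip_pow_carrier[OF U(1), of l] unip_pow_carrier[OF V(1), of l]] 
       unip_pow_carrier[OF kronecker_carrier[OF U(1) V(1)], of l] in auto)

lemma kronecker_diagonalizable:
  assumes "S \<in> carrier_mat n n" "diagonalizable_mat S" "T \<in> carrier_mat m m" "diagonalizable_mat T"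
  shows "diagonalizable_mat (kronecker S T)"
proof -
  obtain c Q P where w: "similar_mat_wit S (mat_diag n c) Q P" using diagonalizable_wit assms by metis
  obtain d Q' P' where w': "similar_mat_wit T (mat_diag m d) Q' P'" using diagonalizable_wit assms by metis
  show ?thesis
    using diagonalizable_matI[OF kronecker_similar_wit[OF w assms(1) w' assms(3), unfolded kronecker_diag] kronecker_carrier] assms by simp
qed

text \<open>Characters are multiplicative only on nonzero numbers, so their application to a semisimple part
  requires that its eigenvalues do not vanish.\<close>

lemma diag_invertible_nz:
  assumes w: "similar_mat_wit S (mat_diag n c) Q P" and S: "S \<in> carrier_mat n n" "invertible_mat S" and i: "i < n"
  shows "c i \<noteq> (0::complex)"
proof
  assume c: "c i = 0"
  note * = similar_mat_witD2[OF S(1) w]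
  obtain T where T: "T \<in> carrier_mat n n" "S * T = 1\<^sub>m n" "T * S = 1\<^sub>m n" using invertible_matE S by metis
  have "P * S * Q = mat_diag n c" using similar_mat_witD2(3)[OF _ similar_mat_wit_sym[OF w], of n n] by simp
  then have "mat_diag n c * (P * T * Q) = P * S * Q * (P * T * Q)" by simp
  also have "\<dots> = P * S * (Q * P) * T * Q" using *(6,7) S T by (simp add: assoc_mult_mat[of _ n n _ n _ n])
  also have "\<dots> = P * (S * T) * Q" using *(1,2,6,7) S T(1) by (simp add: assoc_mult_mat[of _ n n _ n _ n])
  also have "\<dots> = 1\<^sub>m n" using T *(1,2,6,7) by simp
  finally have "(mat_diag n c * (P * T * Q)) $$ (i, i) = 1" using i by simp
  moreover have "(mat_diag n c * (P * T * Q)) $$ (i, i) = 0"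
    using c i *(6,7) T by (subst mat_diag_mult_left[of _ n n]) auto
  ultimately show False by simp
qed

lemma char_app_kronecker:
  assumes S: "S \<in> carrier_mat n n" "diagonalizable_mat S" "invertible_mat S" 
    and T: "T \<in> carrier_mat m m" "diagonalizable_mat T" "invertible_mat T"
    and mult: "\<And>a b. a \<noteq> 0 \<Longrightarrow> b \<noteq> 0 \<Longrightarrow> \<gamma> (a * b) = \<gamma> a * \<gamma> b"
  shows "char_app \<gamma> (kronecker S T) = kronecker (char_app \<gamma> S) (char_app \<gamma> T)"
proof -
  obtain c Q P where w: "similar_mat_wit S (mat_diag n c) Q P" using diagonalizable_wit S by metis
  obtain d Q' P' where w': "similar_mat_wit T (mat_diag m d) Q' P'" using diagonalizable_wit T by metis
  note * = similar_mat_witD2[OF S(1) w] and ** = similar_mat_witD2[OF T(1) w']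
  have "char_app \<gamma> (kronecker S T) = 
     kronecker Q Q' * mat_diag (n * m) (\<lambda>i. \<gamma> (c (i div m) * d (i mod m))) * kronecker P P'"
    by (rule char_app_eq[OF kronecker_similar_wit[OF w S(1) w' T(1), unfolded kronecker_diag] kronecker_carrier[OF S(1) T(1)]])
  also have "mat_diag (n * m) (\<lambda>i. \<gamma> (c (i div m) * d (i mod m))) = mat_diag (n * m) (\<lambda>i. \<gamma> (c (i div m)) * \<gamma> (d (i mod m)))"
    unfolding mat_diag_def
    by (rule cong_mat)
       (auto simp: mult diag_invertible_nz[OF w S(1,3)] diag_invertible_nz[OF w' T(1,3)] div_mod_less)
  also have "\<dots> = kronecker (mat_diag n (\<lambda>i. \<gamma> (c i))) (mat_diag m (\<lambda>i. \<gamma> (d i)))"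
    by (simp add: kronecker_diag)
  also have "kronecker Q Q' * \<dots> * kronecker P P' = kronecker (Q * mat_diag n (\<lambda>i. \<gamma> (c i)) * P) (Q' * mat_diag m (\<lambda>i. \<gamma> (d i)) * P')"
    using kronecker_mult[OF *(6) **(6) mat_diag_dim mat_diag_dim] 
      kronecker_mult[OF mult_carrier_mat[OF *(6) mat_diag_dim] mult_carrier_mat[OF **(6) mat_diag_dim] *(7) **(7)] by simp
  finally show ?thesis by (simp only: char_app_eq[OF w S(1)] char_app_eq[OF w' T(1)])
qed

lemma kronecker_dunford:
  assumes A: "A \<in> carrier_mat n n" "is_dunford A S U" and B: "B \<in> carrier_mat m m" "is_dunford B T V"
  shows "is_dunford (kronecker A B) (kronecker S T) (kronecker U V)"
  using dunfordD[OF A(2,1)] dunfordD[OF B(2,1)] 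
  by (intro is_dunfordI[of _ "n * m"] kronecker_carrier A(1) B(1) kronecker_diagonalizable[of _ n _ m] kronecker_unipotent[of _ n _ m])
     (simp_all add: kronecker_mult[of _ n n _ m m _ n _ m])

section \<open>Existence of the Dunford decomposition\<close>

lemma smult_pow_mat:
  fixes A :: "'a :: comm_ring_1 mat"
  assumes "A \<in> carrier_mat n n"
  shows "(c \<cdot>\<^sub>m A) ^\<^sub>m k = c ^ k \<cdot>\<^sub>m A ^\<^sub>m k"
proof (induction k)
  case (Suc k)
  have "(c \<cdot>\<^sub>m A) ^\<^sub>m Suc k = (c ^ k \<cdot>\<^sub>m A ^\<^sub>m k) * (c \<cdot>\<^sub>m A)" using Suc by simp
  also have "\<dots> = (c ^ k * c) \<cdot>\<^sub>m (A ^\<^sub>m k * A)"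
    using assms by (auto simp: mult_smult_assoc_mat[of _ n n] mult_smult_distrib[of _ n n])
  finally show ?case by (simp add: mult.commute)
qed (use assms in auto)

lemma jordan_block_0_nilpotent: "jordan_block n (0::complex) ^\<^sub>m n = 0\<^sub>m n n"
  by (rule eq_matI) (auto simp: jordan_block_pow)

lemma jordan_block_dunford:
  fixes a :: complex
  assumes "a \<noteq> 0"
  shows "is_dunford (jordan_block n a) (a \<cdot>\<^sub>m 1\<^sub>m n) (inverse a \<cdot>\<^sub>m jordan_block n a)"
proof (rule is_dunfordI)
  have "a \<cdot>\<^sub>m 1\<^sub>m n = mat_diag n (\<lambda>_. a)" by (auto simp: mat_diag_def)
  then have "similar_mat_wit (a \<cdot>\<^sub>m 1\<^sub>m n) (mat_diag n (\<lambda>_. a)) (1\<^sub>m n) (1\<^sub>m n)"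
    using similar_mat_wit_refl[OF mat_diag_dim] by simp
  then show "diagonalizable_mat (a \<cdot>\<^sub>m 1\<^sub>m n)" by (rule diagonalizable_matI) simp
  have "inverse a \<cdot>\<^sub>m jordan_block n a - 1\<^sub>m n = inverse a \<cdot>\<^sub>m jordan_block n 0"
    using assms by (intro eq_matI) auto
  then have "(inverse a \<cdot>\<^sub>m jordan_block n a - 1\<^sub>m n) ^\<^sub>m n = 0\<^sub>m n n"
    by (auto simp: smult_pow_mat[of _ n] jordan_block_0_nilpotent intro!: eq_matI)
  then show "unipotent_mat (inverse a \<cdot>\<^sub>m jordan_block n a)"
    by (intro unipotent_matI) auto
  show "jordan_block n a = a \<cdot>\<^sub>m 1\<^sub>m n * (inverse a \<cdot>\<^sub>m jordan_block n a)"
    using assms by (subst mult_smult_assoc_mat[of _ n n _ n]) (auto intro!: eq_matI)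
  show "a \<cdot>\<^sub>m 1\<^sub>m n * (inverse a \<cdot>\<^sub>m jordan_block n a) = inverse a \<cdot>\<^sub>m jordan_block n a * (a \<cdot>\<^sub>m 1\<^sub>m n)"
    by (subst mult_smult_assoc_mat[of _ n n _ n], simp, simp, subst mult_smult_distrib[of _ n n _ n], simp, simp, simp)
qed auto

lemma unipotent_inverse:
  assumes U: "U \<in> carrier_mat n n" "unipotent_mat U"
  shows "unip_pow U l * unip_pow U (- l) = 1\<^sub>m n"
  using unip_pow_add[OF U, of l "- l"] unip_pow_0[OF U] by simp

lemma unip_pow_1: "U \<in> carrier_mat n n \<Longrightarrow> unipotent_mat U \<Longrightarrow> unip_pow U 1 = U"
  using unip_pow_of_nat[of U n 1] by simp

lemma unipotent_invertible:
  assumes U: "U \<in> carrier_mat n n" "unipotent_mat U"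
  shows "invertible_mat U"
  using unipotent_inverse[OF U, of 1] unipotent_inverse[OF U, of "-1"] unip_pow_1[OF U] unip_pow_carrier[OF U(1)] U
  by (intro invertible_matI[of _ n "unip_pow U (-1)"]) auto

lemma invertible_mult:
  assumes "A \<in> carrier_mat n n" "B \<in> carrier_mat n n" "invertible_mat A" "invertible_mat B"
  shows "invertible_mat (A * B :: complex mat)"
proof -
  obtain A' where A': "A' \<in> carrier_mat n n" "A * A' = 1\<^sub>m n" "A' * A = 1\<^sub>m n" using assms invertible_matE by metis
  obtain B' where B': "B' \<in> carrier_mat n n" "B * B' = 1\<^sub>m n" "B' * B = 1\<^sub>m n" using assms invertible_matE by metis
  have "A * B * (B' * A') = A * (B * B') * A'" using assms(1,2) A'(1) B'(1) by (simp add: assoc_mult_mat[of _ n n _ n _ n])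
  then have 1: "A * B * (B' * A') = 1\<^sub>m n" using assms A' B' by simp
  show ?thesis
    by (rule invertible_matI[OF _ _ 1 mat_mult_left_right_inverse[OF _ _ 1]]) (use assms A' B' in auto)
qed

lemma smult_one_invertible: "c \<noteq> 0 \<Longrightarrow> invertible_mat (c \<cdot>\<^sub>m 1\<^sub>m n :: complex mat)"
  by (rule invertible_matI[of _ n "inverse c \<cdot>\<^sub>m 1\<^sub>m n"])
    (auto simp: mult_smult_assoc_mat[of _ n n _ n] intro!: eq_matI)

lemma jordan_block_invertible:
  assumes "a \<noteq> (0::complex)"
  shows "invertible_mat (jordan_block n a)"
proof -
  note d = dunfordD[OF jordan_block_dunford[OF assms, of n] jordan_block_carrier]
  show ?thesis
    using invertible_mult[OF d(1,2) smult_one_invertible[OF assms] unipotent_invertible[OF d(2,4)]] d(5) by simp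
qed

abbreviation diag_sum :: "nat \<Rightarrow> nat \<Rightarrow> complex mat \<Rightarrow> complex mat \<Rightarrow> complex mat" where
  "diag_sum n m A B \<equiv> four_block_mat A (0\<^sub>m n m) (0\<^sub>m m n) B"

lemma diag_sum_mult:
  assumes "A \<in> carrier_mat n n" "B \<in> carrier_mat m m" "C \<in> carrier_mat n n" "D \<in> carrier_mat m m"
  shows "diag_sum n m A B * diag_sum n m C D = diag_sum n m (A * C) (B * D)"
  using assms by (subst mult_four_block_mat[of _ n n _ m _ m _ _ n _ m]) auto

lemma diag_sum_invertible:
  assumes "A \<in> carrier_mat n n" "B \<in> carrier_mat m m" "invertible_mat A" "invertible_mat B"
  shows "invertible_mat (diag_sum n m A B)"
proof -
  obtain A' where A': "A' \<in> carrier_mat n n" "A * A' = 1\<^sub>m n" "A' * A = 1\<^sub>m n" using assms invertible_matE by metis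
  obtain B' where B': "B' \<in> carrier_mat m m" "B * B' = 1\<^sub>m m" "B' * B = 1\<^sub>m m" using assms invertible_matE by metis
  show ?thesis
    by (rule invertible_matI[of _ "n + m" "diag_sum n m A' B'"])
      (use assms A' B' in \<open>auto simp: diag_sum_mult\<close>)
qed

lemma diag_sum_mat_diag:
  "diag_sum n m (mat_diag n c) (mat_diag m d) = mat_diag (n + m) (\<lambda>i. if i < n then c i else d (i - n))"
  by (rule eq_matI) (auto simp: mat_diag_def)

lemma diag_sum_dunford:
  assumes A: "A \<in> carrier_mat n n" "is_dunford A S U" and B: "B \<in> carrier_mat m m" "is_dunford B T V"
  shows "is_dunford (diag_sum n m A B) (diag_sum n m S T) (diag_sum n m U V)"
proof -
  note dA = dunfordD[OF A(2,1)] and dB = dunfordD[OF B(2,1)]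
  obtain c Q P where w: "similar_mat_wit S (mat_diag n c) Q P" using diagonalizable_wit dA by metis
  obtain d Q' P' where w': "similar_mat_wit T (mat_diag m d) Q' P'" using diagonalizable_wit dB by metis
  have "similar_mat (diag_sum n m S T) (diag_sum n m (mat_diag n c) (mat_diag m d))"
    by (rule similar_mat_four_block_0_0) (use w w' dA dB in \<open>auto simp: similar_mat_def\<close>)
  then have "diagonalizable_mat (diag_sum n m S T)"
    unfolding diag_sum_mat_diag diagonalizable_mat_def using dA(1) dB(1) by auto
  moreover have "unipotent_mat (diag_sum n m U V)"
  proof -
    obtain a where a: "(U - 1\<^sub>m n) ^\<^sub>m a = 0\<^sub>m n n" using unipotentE dA by metis
    obtain b where b: "(V - 1\<^sub>m m) ^\<^sub>m b = 0\<^sub>m m m" using unipotentE dB by metis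
    have N: "U - 1\<^sub>m n \<in> carrier_mat n n" and N': "V - 1\<^sub>m m \<in> carrier_mat m m" by (auto intro: minus_carrier_mat)
    have "diag_sum n m U V - 1\<^sub>m (n + m) = diag_sum n m (U - 1\<^sub>m n) (V - 1\<^sub>m m)"
      using dA(2) dB(2) by (intro eq_matI) auto
    then have "(diag_sum n m U V - 1\<^sub>m (n + m)) ^\<^sub>m max a b = 0\<^sub>m (n + m) (n + m)"
      using pow_mat_zero_mono[OF N a, of "max a b"] pow_mat_zero_mono[OF N' b, of "max a b"]
      by (simp add: pow_four_block_mat[OF N N'])
    then show ?thesis using dA(2) dB(2) by (intro unipotent_matI[of _ "n + m"]) auto
  qed
  ultimately show ?thesis
    using A B dA dB by (intro is_dunfordI[of _ "n + m"]) (auto simp: diag_sum_mult)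
qed

lemma sandwich_mult:
  fixes X Y :: "'a :: semiring_1 mat"
  assumes "P \<in> carrier_mat n n" "Q \<in> carrier_mat n n" "X \<in> carrier_mat n n" "Y \<in> carrier_mat n n" "P * Q = 1\<^sub>m n"
  shows "Q * X * P * (Q * Y * P) = Q * (X * Y) * P"
proof -
  have "Q * X * P * (Q * Y * P) = Q * X * (P * Q) * Y * P"
    using assms(1-4) by (simp add: assoc_mult_mat[of _ n n _ n _ n])
  then show ?thesis using assms by (simp add: assoc_mult_mat[of _ n n _ n _ n])
qed

lemma dunford_similar:
  assumes w: "similar_mat_wit A B Q P" "A \<in> carrier_mat n n" and B: "is_dunford B S U"
  shows "is_dunford A (Q * S * P) (Q * U * P)"
proof -
  note * = similar_mat_witD2[OF w(2,1)]
  note d = dunfordD[OF B *(5)]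
  have sw: "similar_mat_wit (Q * X * P) X Q P" if "X \<in> carrier_mat n n" for X
    by (rule similar_mat_witI[of _ _ n]) (use *(1,2,6,7) that in auto)
  note prod = sandwich_mult[OF *(7,6) _ _ *(2)]
  obtain c Q' P' where wS: "similar_mat_wit S (mat_diag n c) Q' P'" using diagonalizable_wit d by metis
  obtain k where k: "(U - 1\<^sub>m n) ^\<^sub>m k = 0\<^sub>m n n" using unipotentE d by metis
  have N: "U - 1\<^sub>m n \<in> carrier_mat n n" by (auto intro: minus_carrier_mat)
  show ?thesis
  proof (rule is_dunfordI[OF w(2)])
    show c: "Q * S * P \<in> carrier_mat n n" "Q * U * P \<in> carrier_mat n n" using *(6,7) d by (auto intro!: mult_carrier_mat)
    show "diagonalizable_mat (Q * S * P)"
      by (rule diagonalizable_matI[OF similar_mat_wit_trans[OF sw[OF d(1)] wS] c(1)])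
    have "Q * U * P - 1\<^sub>m n = Q * (U - 1\<^sub>m n) * P"
      using d(2) *(1,6,7) mult_minus_distrib_mat[OF *(6) d(2) one_carrier_mat]
        minus_mult_distrib_mat[OF mult_carrier_mat[OF *(6) d(2)] *(6) *(7)] by simp
    then have "(Q * U * P - 1\<^sub>m n) ^\<^sub>m k = Q * (U - 1\<^sub>m n) ^\<^sub>m k * P"
      using similar_mat_wit_pow_id[OF sw[OF N], of k] by simp
    then have "(Q * U * P - 1\<^sub>m n) ^\<^sub>m k = 0\<^sub>m n n" using k *(6,7) by simp
    then show "unipotent_mat (Q * U * P)" by (rule unipotent_matI[OF c(2)])
    show "A = Q * S * P * (Q * U * P)" using prod[OF d(1,2)] *(3) d(5) by simp
    show "Q * S * P * (Q * U * P) = Q * U * P * (Q * S * P)" using prod[OF d(1,2)] prod[OF d(2,1)] d(6) by simp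
  qed
qed

lemma invertible_jordan_nz:
  assumes A: "A \<in> carrier_mat n n" "invertible_mat A" and J: "jordan_nf A n_as"
    and x: "(k, a) \<in> set n_as"
  shows "a \<noteq> (0::complex)"
proof
  assume a: "a = 0"
  have k: "k \<noteq> 0" using J x unfolding jordan_nf_def by force
  have "char_poly A = (\<Prod>(n, a)\<leftarrow>n_as. [:- a, 1:] ^ n)" using jordan_nf_char_poly[OF J] .
  then have "poly (char_poly A) 0 = (\<Prod>(n, a)\<leftarrow>n_as. (- a) ^ n)"
    by (simp add: poly_prod_list o_def case_prod_unfold)
  also have "\<dots> = 0"
  proof (subst prod_list_zero_iff)
    have "(\<lambda>(n, a). (- a) ^ n) (k, a) = 0" using k a by simp
    then show "0 \<in> set (map (\<lambda>(n, a). (- a) ^ n) n_as)" using x by (metis image_eqI list.set_map)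
  qed
  finally have "eigenvalue A 0" using eigenvalue_root_char_poly[OF A(1)] by simp
  then obtain v where v: "v \<in> carrier_vec n" "v \<noteq> 0\<^sub>v n" "A *\<^sub>v v = 0 \<cdot>\<^sub>v v"
    unfolding eigenvalue_def eigenvector_def using A by auto
  obtain A' where A': "A' \<in> carrier_mat n n" "A' * A = 1\<^sub>m n" using A invertible_matE by metis
  have "v = A' * A *\<^sub>v v" using A' v by simp
  also have "\<dots> = A' *\<^sub>v (0 \<cdot>\<^sub>v v)" using A A'(1) v(1) by (simp add: v(3))
  also have "\<dots> = 0\<^sub>v n" using A' v by auto
  finally show False using v by simp
qed

text \<open>The existence of Jordan normal forms as an induction principle. It serves twice: for the existence
  of the Dunford decomposition, and to show that tensor automorphisms are determined by their values
  on Jordan blocks.\<close>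

lemma GL_induct [consumes 2, case_names block sum similar]:
  fixes A :: "complex mat"
  assumes A: "A \<in> carrier_mat n n" "invertible_mat A"
    and block: "\<And>n a. a \<noteq> 0 \<Longrightarrow> P (jordan_block n a)"
    and sum: "\<And>n m A B. A \<in> carrier_mat n n \<Longrightarrow> invertible_mat A \<Longrightarrow> B \<in> carrier_mat m m \<Longrightarrow> invertible_mat B \<Longrightarrow>
      P A \<Longrightarrow> P B \<Longrightarrow> P (diag_sum n m A B)"
    and similar: "\<And>n A B Q R. A \<in> carrier_mat n n \<Longrightarrow> invertible_mat A \<Longrightarrow> B \<in> carrier_mat n n \<Longrightarrow> invertible_mat B \<Longrightarrow>
      similar_mat_wit A B Q R \<Longrightarrow> P B \<Longrightarrow> P A"
  shows "P A"
proof -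
  obtain n_as where J: "jordan_nf A n_as"
    using char_poly_factorized[OF A(1)] jordan_nf_exists[OF A(1)] by metis
  have nz: "\<forall>(k, a)\<in>set n_as. a \<noteq> 0" using invertible_jordan_nz[OF A J] by blast
  have "P (jordan_matrix n_as) \<and> invertible_mat (jordan_matrix n_as)"
    using nz
  proof (induction n_as)
    case Nil
    have "jordan_matrix [] = jordan_block 0 (1::complex)" by (auto simp: jordan_matrix_def)
    then show ?case using block[of 1 0] jordan_block_invertible[of 1 0] by simp
  next
    case (Cons na n_as)
    obtain k a where na: "na = (k, a)" by force
    let ?m = "sum_list (map fst n_as)"
    have "jordan_matrix (na # n_as) = diag_sum k ?m (jordan_block k a) (jordan_matrix n_as)"
      unfolding na using jordan_matrix_dim[of n_as, unfolded jordan_matrix_def]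
      by (simp only: jordan_matrix_def list.map diag_block_mat.simps Let_def prod.case jordan_block_index)
    moreover have "jordan_matrix n_as \<in> carrier_mat ?m ?m" by (rule jordan_matrix_carrier)
    moreover have "a \<noteq> 0" using Cons.prems na by auto
    ultimately show ?case
      using Cons sum[of "jordan_block k a" k "jordan_matrix n_as" ?m] block[of a k] jordan_block_invertible[of a k]
        diag_sum_invertible[of "jordan_block k a" k "jordan_matrix n_as" ?m] by auto
  qed
  moreover obtain Q R where w: "similar_mat_wit A (jordan_matrix n_as) Q R"
    using J unfolding jordan_nf_def similar_mat_def by auto
  ultimately show ?thesis
    using similar[OF A similar_mat_witD2(5)[OF A(1) w] _ w] by simp
qed

lemma dunford_exists:
  assumes "A \<in> carrier_mat n n" "invertible_mat A"
  shows "\<exists>S U. is_dunford A S U"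
  using assms
proof (induction rule: GL_induct)
  case (block n a)
  then show ?case using jordan_block_dunford by blast
next
  case (sum n m A B)
  then show ?case using diag_sum_dunford by blast
next
  case (similar n A B Q R)
  then show ?case using dunford_similar by blast
qed

section \<open>The action on representations of the integers\<close>

lemma R_cat_simps [simp]:
  "Obj R_cat = GL_objects" "tens R_cat = obj_tensor" "unit_obj R_cat = (1, 1\<^sub>m 1)" "fdim R_cat = fst" "fmor R_cat = (\<lambda>F. F)"
  "Hom R_cat (n, A) (p, B) = {F \<in> carrier_mat p n. F * A = B * F}"
  by (simp_all add: R_cat_def)

lemma GL_objects_iff: "(n, A) \<in> GL_objects \<longleftrightarrow> A \<in> carrier_mat n n \<and> invertible_mat A"
  by (simp add: GL_objects_def)

lemma tensor_auts_RI:
  assumes "\<eta> \<in> extensional GL_objects"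
    and "\<And>n A. (n, A) \<in> GL_objects \<Longrightarrow> \<eta> (n, A) \<in> carrier_mat n n \<and> invertible_mat (\<eta> (n, A))"
    and "\<And>n A p B F. (n, A) \<in> GL_objects \<Longrightarrow> (p, B) \<in> GL_objects \<Longrightarrow> F \<in> carrier_mat p n \<Longrightarrow> F * A = B * F
       \<Longrightarrow> F * \<eta> (n, A) = \<eta> (p, B) * F"
    and "\<And>n A p B. (n, A) \<in> GL_objects \<Longrightarrow> (p, B) \<in> GL_objects \<Longrightarrow> \<eta> (n * p, kronecker A B) = kronecker (\<eta> (n, A)) (\<eta> (p, B))"
    and "\<eta> (1, 1\<^sub>m 1) = 1\<^sub>m 1"
  shows "\<eta> \<in> tensor_auts R_cat"
  using assms unfolding tensor_auts_def by (auto simp: obj_tensor_def)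

lemma tensor_auts_RD:
  assumes "\<eta> \<in> tensor_auts R_cat"
  shows "\<eta> \<in> extensional GL_objects"
    and "(n, A) \<in> GL_objects \<Longrightarrow> \<eta> (n, A) \<in> carrier_mat n n"
    and "(n, A) \<in> GL_objects \<Longrightarrow> invertible_mat (\<eta> (n, A))"
    and "(n, A) \<in> GL_objects \<Longrightarrow> (p, B) \<in> GL_objects \<Longrightarrow> F \<in> carrier_mat p n \<Longrightarrow> F * A = B * F
       \<Longrightarrow> F * \<eta> (n, A) = \<eta> (p, B) * F"
    and "(n, A) \<in> GL_objects \<Longrightarrow> (p, B) \<in> GL_objects \<Longrightarrow> \<eta> (n * p, kronecker A B) = kronecker (\<eta> (n, A)) (\<eta> (p, B))"
    and "\<eta> (1, 1\<^sub>m 1) = 1\<^sub>m 1"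
proof -
  have *: "\<eta> \<in> extensional GL_objects" 
    "\<forall>X\<in>GL_objects. \<eta> X \<in> carrier_mat (fst X) (fst X) \<and> invertible_mat (\<eta> X)"
    "\<forall>X\<in>GL_objects. \<forall>Y\<in>GL_objects. \<forall>F\<in>Hom R_cat X Y. F * \<eta> X = \<eta> Y * F"
    "\<forall>X\<in>GL_objects. \<forall>Y\<in>GL_objects. \<eta> (obj_tensor X Y) = kronecker (\<eta> X) (\<eta> Y)"
    "\<eta> (1, 1\<^sub>m 1) = 1\<^sub>m 1"
    using assms unfolding tensor_auts_def by auto
  show "\<eta> \<in> extensional GL_objects" "\<eta> (1, 1\<^sub>m 1) = 1\<^sub>m 1" using * by auto
  show "\<eta> (n, A) \<in> carrier_mat n n" "invertible_mat (\<eta> (n, A))" if "(n, A) \<in> GL_objects" 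
    using *(2) that by auto
  show "F * \<eta> (n, A) = \<eta> (p, B) * F"
    if "(n, A) \<in> GL_objects" "(p, B) \<in> GL_objects" "F \<in> carrier_mat p n" "F * A = B * F"
  proof -
    have "F \<in> Hom R_cat (n, A) (p, B)" using that by simp
    then show ?thesis using *(3) that by blast
  qed
  show "\<eta> (n * p, kronecker A B) = kronecker (\<eta> (n, A)) (\<eta> (p, B))"
    if "(n, A) \<in> GL_objects" "(p, B) \<in> GL_objects"
    using *(4) that by (metis obj_tensor_def fst_conv snd_conv)
qed

lemma Zalg_carrierD:
  assumes "(\<gamma>, l) \<in> carrier Zalg"
  shows "\<gamma> \<in> extensional (- {0})" "c \<noteq> 0 \<Longrightarrow> \<gamma> c \<noteq> 0" "a \<noteq> 0 \<Longrightarrow> b \<noteq> 0 \<Longrightarrow> \<gamma> (a * b) = \<gamma> a * \<gamma> b" "\<gamma> 1 = 1"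
proof -
  have *: "\<gamma> \<in> hom Cstar Cstar" "\<gamma> \<in> extensional (- {0})" using assms by (auto simp: Zalg_def Cstar_def)
  show "\<gamma> \<in> extensional (- {0})" by fact
  show nz: "c \<noteq> 0 \<Longrightarrow> \<gamma> c \<noteq> 0" for c using *(1) by (auto simp: hom_def Cstar_def)
  show mult: "a \<noteq> 0 \<Longrightarrow> b \<noteq> 0 \<Longrightarrow> \<gamma> (a * b) = \<gamma> a * \<gamma> b" for a b using *(1) by (auto simp: hom_def Cstar_def)
  show "\<gamma> 1 = 1" using mult[of 1 1] nz[of 1] by simp
qed

lemma Zalg_carrierI:
  assumes "\<gamma> \<in> extensional (- {0})" "\<And>c. c \<noteq> 0 \<Longrightarrow> \<gamma> c \<noteq> 0" "\<And>a b. a \<noteq> 0 \<Longrightarrow> b \<noteq> 0 \<Longrightarrow> \<gamma> (a * b) = \<gamma> a * \<gamma> b"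
  shows "(\<gamma>, l) \<in> carrier Zalg"
  using assms by (auto simp: Zalg_def Cstar_def hom_def)

lemma Zalg_act_eq:
  assumes "A \<in> carrier_mat n n" "invertible_mat A" "is_dunford A S U"
  shows "Zalg_act (\<gamma>, l) (n, A) = char_app \<gamma> S * unip_pow U l"
  using assms ss_part_eq[OF assms(1,3)] unip_part_eq[OF assms] unfolding Zalg_act_def by (simp add: GL_objects_iff)

lemma char_app_mult:
  assumes S: "S \<in> carrier_mat n n" "diagonalizable_mat S"
  shows "char_app \<gamma> S * char_app \<gamma>' S = char_app (\<lambda>c. \<gamma> c * \<gamma>' c) S"
proof -
  obtain c Q P where w: "similar_mat_wit S (mat_diag n c) Q P" using diagonalizable_wit S by metis
  note * = similar_mat_witD2[OF S(1) w]
  show ?thesis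
    using sandwich_mult[OF *(7,6) mat_diag_dim mat_diag_dim *(2)] by (simp add: char_app_eq[OF w S(1)])
qed

lemma char_app_cong:
  assumes S: "S \<in> carrier_mat n n" "diagonalizable_mat S" "invertible_mat S" and eq: "\<And>c. c \<noteq> 0 \<Longrightarrow> \<gamma> c = \<gamma>' c"
  shows "char_app \<gamma> S = char_app \<gamma>' S"
proof -
  obtain c Q P where w: "similar_mat_wit S (mat_diag n c) Q P" using diagonalizable_wit S by metis
  have "mat_diag n (\<lambda>i. \<gamma> (c i)) = mat_diag n (\<lambda>i. \<gamma>' (c i))"
    unfolding mat_diag_def by (rule cong_mat) (use diag_invertible_nz[OF w S(1,3)] eq in auto)
  then show ?thesis by (simp add: char_app_eq[OF w S(1)])
qed

lemma char_app_one:
  assumes S: "S \<in> carrier_mat n n" "diagonalizable_mat S"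
  shows "char_app (\<lambda>_. 1) S = 1\<^sub>m n"
proof -
  obtain c Q P where w: "similar_mat_wit S (mat_diag n c) Q P" using diagonalizable_wit S by metis
  show ?thesis using similar_mat_witD2(1,6,7)[OF S(1) w] by (simp add: char_app_eq[OF w S(1)])
qed

lemma one_smult_mat: "1 \<cdot>\<^sub>m (A :: complex mat) = A"
  by (rule eq_matI) auto

lemma char_app_scalar: "char_app \<gamma> (a \<cdot>\<^sub>m 1\<^sub>m n) = \<gamma> a \<cdot>\<^sub>m 1\<^sub>m n"
proof -
  have e: "mat_diag n (\<lambda>_. b) = b \<cdot>\<^sub>m 1\<^sub>m n" for b :: complex by (auto simp: mat_diag_def)
  have "similar_mat_wit (a \<cdot>\<^sub>m 1\<^sub>m n) (mat_diag n (\<lambda>_. a)) (1\<^sub>m n) (1\<^sub>m n)"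
    using similar_mat_wit_refl[OF mat_diag_dim] e by metis
  from char_app_eq[OF this, of \<gamma>] show ?thesis by (simp add: e)
qed

text \<open>$U^\lambda$ commutes with $S$ as $U$ does, and every matrix that commutes with $S$ commutes with
  $\gamma(S)$: two applications of naturality.\<close>

lemma dunford_act_commute:
  assumes "A \<in> carrier_mat n n" "is_dunford A S U"
  shows "unip_pow U l * char_app \<gamma> S = char_app \<gamma> S * unip_pow U l"
proof -
  note d = dunfordD[OF assms(2,1)]
  have "S * unip_pow U l = unip_pow U l * S"
    by (rule unip_pow_intertwine[OF d(2,4,2,4,1,6)])
  then show ?thesis by (intro char_app_intertwine[OF d(3,1,3,1) unip_pow_carrier[OF d(2)]]) simp
qed

lemma dunford_act_mult:
  assumes A: "A \<in> carrier_mat n n" "is_dunford A S U"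
  shows "(char_app \<gamma> S * unip_pow U l) * (char_app \<gamma>' S * unip_pow U l') = char_app (\<lambda>c. \<gamma> c * \<gamma>' c) S * unip_pow U (l + l')"
proof -
  note d = dunfordD[OF A(2,1)]
  note c = char_app_carrier[OF d(3,1), of \<gamma>] char_app_carrier[OF d(3,1), of \<gamma>'] unip_pow_carrier[OF d(2), of l] unip_pow_carrier[OF d(2), of l']
  note as = assoc_mult_mat[of _ n n _ n _ n]
  have "(char_app \<gamma> S * unip_pow U l) * (char_app \<gamma>' S * unip_pow U l') =
     char_app \<gamma> S * (unip_pow U l * char_app \<gamma>' S) * unip_pow U l'" using c by (simp add: as)
  also have "\<dots> = (char_app \<gamma> S * char_app \<gamma>' S) * (unip_pow U l * unip_pow U l')"
    unfolding dunford_act_commute[OF A] using c by (simp add: as)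
  finally show ?thesis by (simp only: char_app_mult[OF d(1,3)] unip_pow_add[OF d(2,4)])
qed

lemma Zalg_act_tensor_aut:
  assumes Z: "(\<gamma>, l) \<in> carrier Zalg"
  shows "Zalg_act (\<gamma>, l) \<in> tensor_auts R_cat"
proof (rule tensor_auts_RI)
  show "Zalg_act (\<gamma>, l) \<in> extensional GL_objects" unfolding Zalg_act_def by simp
next
  note \<gamma> = Zalg_carrierD[OF Z]
  fix n A assume "(n, A) \<in> GL_objects"
  then have A: "A \<in> carrier_mat n n" "invertible_mat A" by (auto simp: GL_objects_iff)
  then obtain S U where dA: "is_dunford A S U" using dunford_exists by blast
  note d = dunfordD[OF dA A(1)] and e = Zalg_act_eq[OF A dA]
  have S: "invertible_mat S" by (rule dunford_ss_invertible[OF A dA])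
  have c: "char_app g S * unip_pow U r \<in> carrier_mat n n" for g r
    using char_app_carrier[OF d(3,1)] unip_pow_carrier[OF d(2)] by (rule mult_carrier_mat)
  have 1: "char_app \<gamma> S * unip_pow U l * (char_app (\<lambda>c. inverse (\<gamma> c)) S * unip_pow U (- l)) = 1\<^sub>m n"
    unfolding dunford_act_mult[OF A(1) dA]
    using char_app_cong[OF d(1,3) S, of "\<lambda>c. \<gamma> c * inverse (\<gamma> c)" "\<lambda>_. 1"] char_app_one[OF d(1,3)] unip_pow_0[OF d(2,4)] \<gamma>(2)
    by simp
  have 2: "(char_app (\<lambda>c. inverse (\<gamma> c)) S * unip_pow U (- l)) * (char_app \<gamma> S * unip_pow U l) = 1\<^sub>m n"
    by (rule mat_mult_left_right_inverse[OF c c 1])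
  show "Zalg_act (\<gamma>, l) (n, A) \<in> carrier_mat n n \<and> invertible_mat (Zalg_act (\<gamma>, l) (n, A))"
    unfolding e using c invertible_matI[OF c c 1 2] by blast
  fix p B assume "(p, B) \<in> GL_objects"
  then have B: "B \<in> carrier_mat p p" "invertible_mat B" by (auto simp: GL_objects_iff)
  then obtain T V where dB: "is_dunford B T V" using dunford_exists by blast
  note d' = dunfordD[OF dB B(1)] and e' = Zalg_act_eq[OF B dB]
  have T: "invertible_mat T" by (rule dunford_ss_invertible[OF B dB])
  show "Zalg_act (\<gamma>, l) (n * p, kronecker A B) = kronecker (Zalg_act (\<gamma>, l) (n, A)) (Zalg_act (\<gamma>, l) (p, B))"
    unfolding e e' Zalg_act_eq[OF kronecker_carrier[OF A(1) B(1)] kronecker_invertible[OF A(1) B(1) A(2) B(2)] kronecker_dunford[OF A(1) dA B(1) dB]]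
      char_app_kronecker[OF d(1,3) S d'(1,3) T \<gamma>(3), simplified] kronecker_unip_pow[OF d(2,4) d'(2,4)]
    by (rule kronecker_mult[OF char_app_carrier[OF d(3,1)] char_app_carrier[OF d'(3,1)] unip_pow_carrier[OF d(2)] unip_pow_carrier[OF d'(2)]])
  fix F assume F: "F \<in> carrier_mat p n" "F * A = B * F"
  have s: "F * char_app \<gamma> S = char_app \<gamma> T * F"
    by (rule char_app_intertwine[OF d(3,1) d'(3,1) F(1) dunford_intertwine_ss[OF A(1) dA B(1) dB F]])
  have u: "F * unip_pow U l = unip_pow V l * F"
    by (rule unip_pow_intertwine[OF d(2,4) d'(2,4) F(1) dunford_intertwine_unip[OF A(1) dA B dB F]])
  note c = char_app_carrier[OF d(3,1), of \<gamma>] unip_pow_carrier[OF d(2), of l] char_app_carrier[OF d'(3,1), of \<gamma>] unip_pow_carrier[OF d'(2), of l]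
  have "F * (char_app \<gamma> S * unip_pow U l) = (F * char_app \<gamma> S) * unip_pow U l"
    using c F(1) by simp
  also have "\<dots> = char_app \<gamma> T * (F * unip_pow U l)" unfolding s using c F(1) by simp
  also have "\<dots> = char_app \<gamma> T * unip_pow V l * F" unfolding u using c F(1) by simp
  finally show "F * Zalg_act (\<gamma>, l) (n, A) = Zalg_act (\<gamma>, l) (p, B) * F" unfolding e e' .
next
  note \<gamma> = Zalg_carrierD[OF Z]
  have e: "jordan_block 1 1 = 1\<^sub>m 1" "inverse 1 \<cdot>\<^sub>m 1\<^sub>m 1 = (1\<^sub>m 1 :: complex mat)" "1 \<cdot>\<^sub>m 1\<^sub>m 1 = (1\<^sub>m 1 :: complex mat)" by (auto intro!: eq_matI)
  have d: "is_dunford (1\<^sub>m 1) (1 \<cdot>\<^sub>m 1\<^sub>m 1) (1\<^sub>m 1)" using jordan_block_dunford[OF one_neq_zero, of 1] by (simp only: e)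
  have i: "invertible_mat (1\<^sub>m 1 :: complex mat)" by (rule invertible_matI[of _ 1 "1\<^sub>m 1"]) auto
  show "Zalg_act (\<gamma>, l) (1, 1\<^sub>m 1) = 1\<^sub>m 1"
    unfolding Zalg_act_eq[OF one_carrier_mat i d] unip_pow_one char_app_scalar using \<gamma>(4) by (intro eq_matI) auto
qed

lemma Zalg_act_jordan_1:
  assumes "c \<noteq> 0"
  shows "Zalg_act (\<gamma>, l) (1, jordan_block 1 c) = \<gamma> c \<cdot>\<^sub>m 1\<^sub>m 1"
proof -
  have e: "inverse c \<cdot>\<^sub>m jordan_block 1 c = (1\<^sub>m 1 :: complex mat)" using assms by (auto intro!: eq_matI)
  show ?thesis
    unfolding Zalg_act_eq[OF jordan_block_carrier jordan_block_invertible[OF assms] jordan_block_dunford[OF assms]] e unip_pow_one char_app_scalar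
    by simp
qed

lemma Zalg_act_jordan_2:
  assumes "\<gamma> 1 = 1"
  shows "Zalg_act (\<gamma>, l) (2, jordan_block 2 1) = Matrix.mat 2 2 (\<lambda>(i, j). if i = j then 1 else if i < j then l else 0)"
proof -
  let ?J = "jordan_block 2 1 :: complex mat"
  have e: "inverse 1 \<cdot>\<^sub>m ?J = ?J" by (auto intro!: eq_matI)
  have N: "?J - 1\<^sub>m 2 = jordan_block 2 0" by (auto intro!: eq_matI)
  have nil: "(?J - 1\<^sub>m 2) ^\<^sub>m 2 = 0\<^sub>m 2 2" unfolding N by (rule jordan_block_0_nilpotent)
  have N1: "jordan_block 2 (0::complex) ^\<^sub>m Suc 0 = jordan_block 2 0" by (auto intro!: eq_matI)
  have "unip_pow ?J l $$ (i, j) = (if i = j then 1 else if i < j then l else 0)" if "i < 2" "j < 2" for i j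
    unfolding unip_pow_index[OF jordan_block_carrier nil that] N using that
    by (auto simp: numeral_2_eq_2 N1[unfolded numeral_2_eq_2] simp del: pow_mat.simps(2))
  then have "unip_pow ?J l = Matrix.mat 2 2 (\<lambda>(i, j). if i = j then 1 else if i < j then l else 0)"
    using unip_pow_carrier[OF jordan_block_carrier, of 2 1 l] by (intro eq_matI) auto
  moreover have d: "is_dunford ?J (1 \<cdot>\<^sub>m 1\<^sub>m 2) ?J"
    using jordan_block_dunford[of 1 2] by (simp only: e one_neq_zero not_False_eq_True)
  ultimately show ?thesis
    unfolding Zalg_act_eq[OF jordan_block_carrier jordan_block_invertible[OF one_neq_zero] d] char_app_scalar assms
    by (simp add: one_smult_mat left_mult_one_mat[of _ 2 2])
qed

lemma Zalg_act_hom: "Zalg_act \<in> hom Zalg (Aut_tensor R_cat)"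
proof (rule homI)
  fix x assume "x \<in> carrier Zalg"
  then show "Zalg_act x \<in> carrier (Aut_tensor R_cat)"
    using Zalg_act_tensor_aut by (cases x) (auto simp: Aut_tensor_def)
next
  fix x y assume xy: "x \<in> carrier Zalg" "y \<in> carrier Zalg"
  obtain \<gamma> l \<gamma>' l' where x: "x = (\<gamma>, l)" and y: "y = (\<gamma>', l')" by (metis surj_pair)
  have "Zalg_act (x \<otimes>\<^bsub>Zalg\<^esub> y) X = (\<lambda>X\<in>GL_objects. Zalg_act x X * Zalg_act y X) X" for X
  proof (cases "X \<in> GL_objects")
    case True
    obtain n A where X: "X = (n, A)" by force
    have A: "A \<in> carrier_mat n n" "invertible_mat A" using True X by (auto simp: GL_objects_iff)
    obtain S U where d: "is_dunford A S U" using dunford_exists[OF A] by blast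
    note dD = dunfordD[OF d A(1)]
    have "Zalg_act (x \<otimes>\<^bsub>Zalg\<^esub> y) X = char_app (\<lambda>c\<in>carrier Cstar. \<gamma> c * \<gamma>' c) S * unip_pow U (l + l')"
      unfolding x y X using Zalg_act_eq[OF A d] by (simp add: Zalg_def)
    also have "char_app (\<lambda>c\<in>carrier Cstar. \<gamma> c * \<gamma>' c) S = char_app (\<lambda>c. \<gamma> c * \<gamma>' c) S"
      by (rule char_app_cong[OF dD(1,3) dunford_ss_invertible[OF A d]]) (auto simp: Cstar_def)
    also have "char_app (\<lambda>c. \<gamma> c * \<gamma>' c) S * unip_pow U (l + l') = Zalg_act x X * Zalg_act y X"
      unfolding x y X Zalg_act_eq[OF A d] by (rule dunford_act_mult[OF A(1) d, symmetric])
    finally show ?thesis using True by simp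
  next
    case False
    then show ?thesis by (auto simp: Zalg_act_def Zalg_def x y)
  qed
  then show "Zalg_act (x \<otimes>\<^bsub>Zalg\<^esub> y) = Zalg_act x \<otimes>\<^bsub>Aut_tensor R_cat\<^esub> Zalg_act y"
    by (auto simp: Aut_tensor_def)
qed

section \<open>Tensor automorphisms of the representations of the integers\<close>

text \<open>Naturality along a surjective morphism determines the value at the target from the value at the source.\<close>

lemma tensor_aut_eq_quotient:
  assumes \<eta>: "\<eta> \<in> tensor_auts R_cat" "\<theta> \<in> tensor_auts R_cat"
    and AB: "(n, A) \<in> GL_objects" "(p, B) \<in> GL_objects"
    and F: "F \<in> carrier_mat p n" "F * A = B * F" "R \<in> carrier_mat n p" "F * R = 1\<^sub>m p"
    and eq: "\<eta> (n, A) = \<theta> (n, A)"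
  shows "\<eta> (p, B) = \<theta> (p, B)"
proof -
  have *: "\<phi> (p, B) = F * \<phi> (n, A) * R" if \<phi>: "\<phi> \<in> tensor_auts R_cat" for \<phi>
  proof -
    have c: "\<phi> (p, B) \<in> carrier_mat p p" using tensor_auts_RD(2)[OF \<phi>] AB by blast
    have "\<phi> (p, B) = \<phi> (p, B) * (F * R)" using F(4) c by simp
    also have "\<dots> = \<phi> (p, B) * F * R" using c F(1,3) by simp
    also have "\<dots> = F * \<phi> (n, A) * R" using tensor_auts_RD(4)[OF \<phi> AB F(1,2)] by simp
    finally show ?thesis .
  qed
  show ?thesis using *[OF \<eta>(1)] *[OF \<eta>(2)] eq by simp
qed

lemma jordan_1_mult_left:
  assumes "B \<in> carrier_mat n m" "i < n" "j < m"
  shows "(jordan_block n 1 * B) $$ (i, j) = B $$ (i, j) + (if Suc i < n then B $$ (Suc i, j) else (0::complex))"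
proof -
  have "(jordan_block n 1 * B) $$ (i, j) = (\<Sum>a<n. (if a = i then B $$ (a, j) else 0) + (if a = Suc i then B $$ (a, j) else 0))"
    unfolding index_mult_sum[OF jordan_block_carrier assms] using assms by (intro sum.cong) auto
  then show ?thesis using assms by (simp add: sum.distrib)
qed

lemma sum_mult_jordan_1:
  assumes "j < n"
  shows "(\<Sum>a<n. f a * jordan_block n (1::complex) $$ (a, j)) = f j + (if 0 < j then f (j - 1) else 0)"
proof -
  have "(\<Sum>a<n. f a * jordan_block n (1::complex) $$ (a, j)) = 
     (\<Sum>a<n. (if a = j then f a else 0) + (if 0 < j \<and> a = j - 1 then f a else 0))"
    using assms by (intro sum.cong) auto
  then show ?thesis using assms by (cases "j = 0") (auto simp: sum.distrib)
qed

text \<open>The basis vector $e_b$ of the object $J_n(1)$ stands for the binomial polynomial $\binom{x}{b}$, as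
  $\binom{x+1}{b} = \binom{x}{b} + \binom{x}{b-1}$. In these bases the matrix below is the
  multiplication of a polynomial of degree at most $1$ with one of degree less than $n$: the columns
  $k < n$ express $1 \cdot \binom{x}{k}$, and the columns $k = n + b$ express
  $x \binom{x}{b} = (b + 1) \binom{x}{b+1} + b \binom{x}{b}$. It is a morphism because shifting
  the argument is compatible with products of functions.\<close>

definition binomial_mult :: "nat \<Rightarrow> complex mat" where
  "binomial_mult n = Matrix.mat (Suc n) (2 * n) (\<lambda>(i, k).
     if k < n then (if i = k then 1 else 0)
     else (if i = Suc (k - n) then of_nat (Suc (k - n)) else 0) + (if i = k - n then of_nat (k - n) else 0))"

lemma binomial_mult_index:
  assumes "i < Suc n" "b < n"
  shows "binomial_mult n $$ (i, b) = (if i = b then 1 else 0)"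
    and "binomial_mult n $$ (i, n + b) = (if i = Suc b then of_nat (Suc b) else 0) + (if i = b then of_nat b else 0)"
  using assms by (simp_all add: binomial_mult_def)

lemma binomial_mult_intertwine:
  "binomial_mult n * kronecker (jordan_block 2 1) (jordan_block n 1) = jordan_block (Suc n) 1 * binomial_mult n"
proof (rule eq_matI)
  let ?M = "binomial_mult n"
  have M: "?M \<in> carrier_mat (Suc n) (2 * n)" by (simp add: binomial_mult_def)
  have K: "kronecker (jordan_block 2 1) (jordan_block n 1) \<in> carrier_mat (2 * n) (2 * n)"
    by (rule kronecker_carrier) auto
  fix i k assume "i < dim_row (jordan_block (Suc n) 1 * ?M)" "k < dim_col (jordan_block (Suc n) 1 * ?M)"
  then have ik: "i < Suc n" "k < 2 * n" using M by auto
  have n: "n > 0" using ik by auto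
  note km = div_mod_less[OF ik(2)]
  define g where "g a b = ?M $$ (i, a * n + b)" for a b
  have g0: "g 0 b = (if i = b then 1 else 0)"
    and g1: "g 1 b = (if i = Suc b then of_nat (Suc b) else 0) + (if i = b then of_nat b else 0)" if "b < n" for b
    using binomial_mult_index[OF ik(1) that] by (simp_all add: g_def)
  have "(?M * kronecker (jordan_block 2 1) (jordan_block n 1)) $$ (i, k) =
     (\<Sum>t<2 * n. g (t div n) (t mod n) * (jordan_block 2 1 $$ (t div n, k div n) * jordan_block n 1 $$ (t mod n, k mod n)))"
    unfolding index_mult_sum[OF M K ik] g_def
    by (intro sum.cong) (simp_all add: kronecker_index[OF jordan_block_carrier jordan_block_carrier _ ik(2)])
  also have "\<dots> = (\<Sum>a<2. \<Sum>b<n. g a b * (jordan_block 2 1 $$ (a, k div n) * jordan_block n 1 $$ (b, k mod n)))"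
    by (rule sum_div_mod)
  also have "\<dots> = (\<Sum>a<2. (\<Sum>b<n. g a b * jordan_block n 1 $$ (b, k mod n)) * jordan_block 2 1 $$ (a, k div n))"
    by (simp add: sum_distrib_right sum_distrib_left mult_ac)
  also have "\<dots> = (\<Sum>a<2. (g a (k mod n) + (if 0 < k mod n then g a (k mod n - 1) else 0)) * jordan_block 2 1 $$ (a, k div n))"
    by (simp only: sum_mult_jordan_1[OF km(2)])
  also have "\<dots> = (jordan_block (Suc n) 1 * ?M) $$ (i, k)"
  proof (cases "k < n")
    case True
    have k: "k div n = 0" "k mod n = k" using True by auto
    have "(\<Sum>a<2. (g a k + (if 0 < k then g a (k - 1) else 0)) * jordan_block 2 1 $$ (a, 0)) =
        g 0 k + (if 0 < k then g 0 (k - 1) else 0)"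
      by (simp add: numeral_2_eq_2)
    also have "\<dots> = (if i = k then 1 else 0) + (if Suc i = k then 1 else 0)"
      using True ik(1) by (cases k) (auto simp: g_def binomial_mult_index(1))
    also have "\<dots> = (jordan_block (Suc n) 1 * ?M) $$ (i, k)"
      using True ik(1) unfolding jordan_1_mult_left[OF M ik] by (auto simp: binomial_mult_index(1))
    finally show ?thesis unfolding k .
  next
    case False
    then obtain b where b: "k = n + b" "b < n" using ik(2) by (metis add_less_cancel_left le_Suc_ex mult_2 not_less)
    have k: "k div n = 1" "k mod n = b" using b by (simp_all add: div_add_self1)
    have "(\<Sum>a<2. (g a b + (if 0 < b then g a (b - 1) else 0)) * jordan_block 2 1 $$ (a, 1)) =
        g 0 b + g 1 b + (if 0 < b then g 0 (b - 1) + g 1 (b - 1) else 0)"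
      by (simp add: numeral_2_eq_2)
    also have "\<dots> = (if i = Suc b then of_nat (Suc b) else 0) + (if i = b then of_nat (2 * b + 1) else 0)
        + (if Suc i = b then of_nat b else 0)"
    proof (cases b)
      case 0
      then show ?thesis using b(2) g0[of 0] g1[of 0] by simp
    next
      case (Suc b')
      then show ?thesis using b(2) g0[of b'] g1[of b'] g0[of b] g1[of b] by auto
    qed
    also have "\<dots> = ?M $$ (i, n + b) + (if Suc i < Suc n then ?M $$ (Suc i, n + b) else 0)"
      using b(2) ik(1) by (auto simp: binomial_mult_index(2))
    also have "\<dots> = (jordan_block (Suc n) 1 * ?M) $$ (i, k)"
      unfolding jordan_1_mult_left[OF M ik] by (simp only: b(1))
    finally show ?thesis unfolding k .
  qed
  finally show "(?M * kronecker (jordan_block 2 1) (jordan_block n 1)) $$ (i, k) = (jordan_block (Suc n) 1 * ?M) $$ (i, k)" .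
qed (auto simp: binomial_mult_def kronecker_def)

text \<open>Multiplication is surjective: $n \binom{x}{n} = x \binom{x}{n-1} - (n - 1) \binom{x}{n-1}$.\<close>

lemma binomial_mult_right_inverse:
  assumes "n > 0"
  shows "\<exists>R \<in> carrier_mat (2 * n) (Suc n). binomial_mult n * R = 1\<^sub>m (Suc n)"
proof
  let ?R = "Matrix.mat (2 * n) (Suc n) (\<lambda>(k, j). if j < n then (if k = j then 1 else 0)
    else (if k = 2 * n - 1 then inverse (of_nat n) else 0) + (if k = n - 1 then - of_nat (n - 1) * inverse (of_nat n) else 0)) :: complex mat"
  show R: "?R \<in> carrier_mat (2 * n) (Suc n)" by simp
  have M: "binomial_mult n \<in> carrier_mat (Suc n) (2 * n)" by (simp add: binomial_mult_def)
  show "binomial_mult n * ?R = 1\<^sub>m (Suc n)"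
  proof (rule eq_matI)
    fix i j assume "i < dim_row (1\<^sub>m (Suc n))" "j < dim_col (1\<^sub>m (Suc n))"
    then have ij: "i < Suc n" "j < Suc n" by auto
    show "(binomial_mult n * ?R) $$ (i, j) = 1\<^sub>m (Suc n) $$ (i, j)"
    proof (cases "j < n")
      case True
      have "(binomial_mult n * ?R) $$ (i, j) = (\<Sum>k<2 * n. if k = j then binomial_mult n $$ (i, k) else 0)"
        unfolding index_mult_sum[OF M R ij] using True ij by (intro sum.cong) auto
      also have "\<dots> = 1\<^sub>m (Suc n) $$ (i, j)" using True ij by (simp add: binomial_mult_def)
      finally show ?thesis .
    next
      case False
      then have j: "j = n" using ij by simp
      have "(binomial_mult n * ?R) $$ (i, j) = (\<Sum>k<2 * n. (if k = 2 * n - 1 then binomial_mult n $$ (i, k) * inverse (of_nat n) else 0)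
         + (if k = n - 1 then - binomial_mult n $$ (i, k) * of_nat (n - 1) * inverse (of_nat n) else 0))"
        unfolding index_mult_sum[OF M R ij] using j by (intro sum.cong) (auto simp: algebra_simps)
      also have "\<dots> = binomial_mult n $$ (i, 2 * n - 1) * inverse (of_nat n) - binomial_mult n $$ (i, n - 1) * of_nat (n - 1) * inverse (of_nat n)"
        using assms by (subst sum.distrib) (subst sum.delta, simp, subst sum.delta, simp, auto)
      also have "\<dots> = 1\<^sub>m (Suc n) $$ (i, j)"
      proof -
        obtain m where m: "n = Suc m" using assms by (metis gr0_implies_Suc)
        have "complex_of_nat (Suc m) \<noteq> 0" by (simp del: of_nat_Suc)
        then show ?thesis using ij unfolding j m by (auto simp: binomial_mult_def simp del: of_nat_Suc)
      qed
      finally show ?thesis .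
    qed
  qed (simp_all add: binomial_mult_def)
qed

lemma jordan_block_GL: "a \<noteq> 0 \<Longrightarrow> (n, jordan_block n a) \<in> GL_objects"
  by (simp add: GL_objects_iff jordan_block_invertible)

lemma kronecker_GL: "(n, A) \<in> GL_objects \<Longrightarrow> (m, B) \<in> GL_objects \<Longrightarrow> (n * m, kronecker A B) \<in> GL_objects"
  by (auto simp: GL_objects_iff kronecker_carrier kronecker_invertible)

lemma kronecker_scalar_left: "kronecker (c \<cdot>\<^sub>m 1\<^sub>m 1) B = c \<cdot>\<^sub>m B"
  by (rule eq_matI) (auto simp: kronecker_def)

lemma jordan_block_1: "jordan_block 1 c = c \<cdot>\<^sub>m (1\<^sub>m 1 :: complex mat)"
  by (auto intro!: eq_matI)

text \<open>Because the inclusions of the two summands are jointly surjective, a tensor automorphism at a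
  direct sum is recovered from its values at the summands.\<close>

lemma diag_sum_inclusions:
  assumes A: "A \<in> carrier_mat n n" and B: "B \<in> carrier_mat m m"
  defines "I \<equiv> Matrix.mat (n + m) n (\<lambda>(i, j). if i = j then 1 else 0 :: complex)"
    and "J \<equiv> Matrix.mat (n + m) m (\<lambda>(i, j). if i = n + j then 1 else 0 :: complex)"
  shows "I * A = diag_sum n m A B * I" "J * B = diag_sum n m A B * J"
    and "X \<in> carrier_mat (n + m) (n + m) \<Longrightarrow> Y \<in> carrier_mat (n + m) (n + m) \<Longrightarrow> X * I = Y * I \<Longrightarrow> X * J = Y * J \<Longrightarrow> X = Y"
proof -
  have I: "I \<in> carrier_mat (n + m) n" and J: "J \<in> carrier_mat (n + m) m" by (auto simp: I_def J_def)
  have XI: "(X * I) $$ (i, j) = X $$ (i, j)" if "X \<in> carrier_mat (n + m) (n + m)" "i < n + m" "j < n" for X i j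
  proof -
    have "(X * I) $$ (i, j) = (\<Sum>a<n + m. if a = j then X $$ (i, a) else 0)"
      unfolding index_mult_sum[OF that(1) I that(2,3)] using that by (intro sum.cong) (auto simp: I_def)
    then show ?thesis using that by simp
  qed
  have XJ: "(X * J) $$ (i, j) = X $$ (i, n + j)" if "X \<in> carrier_mat (n + m) (n + m)" "i < n + m" "j < m" for X i j
  proof -
    have "(X * J) $$ (i, j) = (\<Sum>a<n + m. if a = n + j then X $$ (i, a) else 0)"
      unfolding index_mult_sum[OF that(1) J that(2,3)] using that by (intro sum.cong) (auto simp: J_def)
    then show ?thesis using that by simp
  qed
  have D: "diag_sum n m A B \<in> carrier_mat (n + m) (n + m)" using A B by auto
  show "I * A = diag_sum n m A B * I"
  proof (rule eq_matI)
    fix i j assume "i < dim_row (diag_sum n m A B * I)" "j < dim_col (diag_sum n m A B * I)"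
    then have ij: "i < n + m" "j < n" using D I by auto
    have "(I * A) $$ (i, j) = (\<Sum>a<n. if a = i then A $$ (a, j) else 0)"
      unfolding index_mult_sum[OF I A ij] using ij by (intro sum.cong) (auto simp: I_def)
    then show "(I * A) $$ (i, j) = (diag_sum n m A B * I) $$ (i, j)"
      unfolding XI[OF D ij] using ij A B by auto
  qed (use A B I in auto)
  show "J * B = diag_sum n m A B * J"
  proof (rule eq_matI)
    fix i j assume "i < dim_row (diag_sum n m A B * J)" "j < dim_col (diag_sum n m A B * J)"
    then have ij: "i < n + m" "j < m" using D J by auto
    have "(J * B) $$ (i, j) = (\<Sum>a<m. if i \<ge> n \<and> a = i - n then B $$ (a, j) else 0)"
      unfolding index_mult_sum[OF J B ij] using ij by (intro sum.cong) (auto simp: J_def)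
    then show "(J * B) $$ (i, j) = (diag_sum n m A B * J) $$ (i, j)"
      unfolding XJ[OF D ij] using ij A B by (cases "i < n") auto
  qed (use A B J in auto)
  assume X: "X \<in> carrier_mat (n + m) (n + m)" and Y: "Y \<in> carrier_mat (n + m) (n + m)" and eI: "X * I = Y * I" and eJ: "X * J = Y * J"
  have "X $$ (i, j) = Y $$ (i, j)" if ij: "i < n + m" "j < n + m" for i j
  proof (cases "j < n")
    case True
    then show ?thesis using XI[OF X ij(1)] XI[OF Y ij(1)] eI by metis
  next
    case False
    then have "j = n + (j - n)" "j - n < m" using ij by auto
    then show ?thesis using XJ[OF X ij(1)] XJ[OF Y ij(1)] eJ by metis
  qed
  then show "X = Y" using X Y by (intro eq_matI) auto
qed

text \<open>The set of objects on which \<open>\<eta>\<close> and \<open>\<theta>\<close> agree is closed under tensor products, quotients and direct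
  sums. Starting from the given objects it absorbs $J_{n+1}(1)$ as a quotient of
  $J_2(1) \otimes J_n(1)$, then $J_n(a)$ as isomorphic to $(1, a) \otimes J_n(1)$, and then all objects.\<close>

lemma tensor_auts_eqI:
  assumes \<eta>: "\<eta> \<in> tensor_auts R_cat" and \<theta>: "\<theta> \<in> tensor_auts R_cat"
    and eq1: "\<And>c. c \<noteq> 0 \<Longrightarrow> \<eta> (1, jordan_block 1 c) = \<theta> (1, jordan_block 1 c)"
    and eq2: "\<eta> (2, jordan_block 2 1) = \<theta> (2, jordan_block 2 1)"
  shows "\<eta> = \<theta>"
proof -
  note quot = tensor_aut_eq_quotient[OF \<eta> \<theta>]
  have unip: "\<eta> (Suc n, jordan_block (Suc n) 1) = \<theta> (Suc n, jordan_block (Suc n) 1)" for n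
  proof (induction n)
    case 0
    then show ?case using eq1[of 1] by simp
  next
    case (Suc n)
    obtain R where R: "R \<in> carrier_mat (2 * Suc n) (Suc (Suc n))" "binomial_mult (Suc n) * R = 1\<^sub>m (Suc (Suc n))"
      using binomial_mult_right_inverse[of "Suc n"] by blast
    note GL = jordan_block_GL[of 1 2] jordan_block_GL[of 1 "Suc n"]
    show ?case
    proof (rule quot[OF kronecker_GL jordan_block_GL _ binomial_mult_intertwine R])
      show "binomial_mult (Suc n) \<in> carrier_mat (Suc (Suc n)) (2 * Suc n)" by (simp add: binomial_mult_def)
      show "\<eta> (2 * Suc n, kronecker (jordan_block 2 1) (jordan_block (Suc n) 1)) = \<theta> (2 * Suc n, kronecker (jordan_block 2 1) (jordan_block (Suc n) 1))"
        using tensor_auts_RD(5)[OF \<eta> GL] tensor_auts_RD(5)[OF \<theta> GL] eq2 Suc by simp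
    qed (use GL in auto)
  qed
  have blocks: "\<eta> (n, jordan_block n a) = \<theta> (n, jordan_block n a)" if a: "a \<noteq> 0" for n a
  proof (cases n)
    case 0
    then show ?thesis using tensor_auts_RD(2)[OF \<eta> jordan_block_GL[OF a]] tensor_auts_RD(2)[OF \<theta> jordan_block_GL[OF a]]
      by (metis carrier_matD eq_matI less_zeroE)
  next
    case (Suc m)
    note GL = jordan_block_GL[OF a, of 1] jordan_block_GL[of 1 n, OF one_neq_zero]
    \<comment> \<open>rescaling the basis by powers of \<open>a\<close> turns $a J_n(1)$ into $J_n(a)$\<close>
    let ?D = "mat_diag n (\<lambda>i. a ^ i)" and ?R = "mat_diag n (\<lambda>i. inverse (a ^ i))"
    show ?thesis
    proof (rule quot[OF kronecker_GL[OF GL] jordan_block_GL[OF a], where F = ?D and R = ?R])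
      show "?D * kronecker (jordan_block 1 a) (jordan_block n 1) = jordan_block n a * ?D"
        unfolding jordan_block_1 kronecker_scalar_left
        by (simp add: mat_diag_mult_left[of _ n n] mat_diag_mult_right[of _ n n]) (rule cong_mat, auto)
      show "?D * ?R = 1\<^sub>m n" using a by simp
      show "\<eta> (1 * n, kronecker (jordan_block 1 a) (jordan_block n 1)) = \<theta> (1 * n, kronecker (jordan_block 1 a) (jordan_block n 1))"
        using tensor_auts_RD(5)[OF \<eta> GL] tensor_auts_RD(5)[OF \<theta> GL] eq1[OF a] unip[of m] Suc by simp
    qed auto
  qed
  have "\<forall>n. A \<in> carrier_mat n n \<longrightarrow> \<eta> (n, A) = \<theta> (n, A)" if "A \<in> carrier_mat k k" "invertible_mat A" for k A
    using that
  proof (induction rule: GL_induct)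
    case (block n a)
    then show ?case using blocks[of a n] by auto
  next
    case (sum n m A B)
    let ?I = "Matrix.mat (n + m) n (\<lambda>(i, j). if i = j then 1 else 0 :: complex)"
    let ?J = "Matrix.mat (n + m) m (\<lambda>(i, j). if i = n + j then 1 else 0 :: complex)"
    let ?D = "diag_sum n m A B"
    have A: "(n, A) \<in> GL_objects" and B: "(m, B) \<in> GL_objects" and D: "(n + m, ?D) \<in> GL_objects"
      using sum.hyps by (auto simp: GL_objects_iff diag_sum_invertible)
    have I: "?I \<in> carrier_mat (n + m) n" and J: "?J \<in> carrier_mat (n + m) m" by auto
    note inc = diag_sum_inclusions[OF sum.hyps(1,3)]
    have "\<eta> (n + m, ?D) * ?I = \<theta> (n + m, ?D) * ?I"
      using tensor_auts_RD(4)[OF \<eta> A D I inc(1)] tensor_auts_RD(4)[OF \<theta> A D I inc(1)] sum by simp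
    moreover have "\<eta> (n + m, ?D) * ?J = \<theta> (n + m, ?D) * ?J"
      using tensor_auts_RD(4)[OF \<eta> B D J inc(2)] tensor_auts_RD(4)[OF \<theta> B D J inc(2)] sum by simp
    ultimately have "\<eta> (n + m, ?D) = \<theta> (n + m, ?D)"
      by (rule inc(3)[OF tensor_auts_RD(2)[OF \<eta> D] tensor_auts_RD(2)[OF \<theta> D]])
    then show ?case using sum.hyps by auto
  next
    case (similar n A B Q R)
    note * = similar_mat_witD2[OF similar.hyps(1,5)]
    have "A * Q = (Q * B * R) * Q" by (rule arg_cong[OF *(3)])
    also have "\<dots> = Q * B * (R * Q)"
      by (rule assoc_mult_mat[OF mult_carrier_mat[OF *(6,5)] *(7,6)])
    also have "\<dots> = Q * B" using *(2,5,6) by simp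
    finally have AQ: "Q * B = A * Q" by (rule sym)
    have "\<eta> (n, A) = \<theta> (n, A)"
      using similar.hyps similar.IH by (intro quot[OF _ _ *(6) AQ *(7,1)]) (auto simp: GL_objects_iff)
    then show ?case using similar.hyps by auto
  qed
  then have "\<eta> X = \<theta> X" for X
    using tensor_auts_RD(1)[OF \<eta>] tensor_auts_RD(1)[OF \<theta>]
    by (cases X; cases "X \<in> GL_objects") (auto simp: GL_objects_iff extensional_def)
  then show ?thesis by blast
qed

text \<open>The candidate $(\gamma, \lambda)$ is read off from the objects that determine $\eta$; that $\gamma$ is a
  character is the compatibility of $\eta$ with $(1, a) \otimes (1, b) = (1, ab)$.\<close>

lemma Zalg_act_surj:
  assumes \<eta>: "\<eta> \<in> tensor_auts R_cat"
  shows "\<exists>z \<in> carrier Zalg. Zalg_act z = \<eta>"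
proof -
  define \<gamma> where "\<gamma> = (\<lambda>c\<in>- {0}. \<eta> (1, jordan_block 1 c) $$ (0, 0))"
  define l where "l = \<eta> (2, jordan_block 2 1) $$ (0, 1)"
  have \<eta>1: "\<eta> (1, jordan_block 1 c) = \<gamma> c \<cdot>\<^sub>m 1\<^sub>m 1" if "c \<noteq> 0" for c
    using tensor_auts_RD(2)[OF \<eta> jordan_block_GL[OF that, of 1]] that by (intro eq_matI) (auto simp: \<gamma>_def)
  have Z: "(\<gamma>, l) \<in> carrier Zalg"
  proof (rule Zalg_carrierI)
    show "\<gamma> \<in> extensional (- {0})" by (simp add: \<gamma>_def)
    show "\<gamma> c \<noteq> 0" if c: "c \<noteq> 0" for c
    proof
      assume "\<gamma> c = 0"
      then have "\<eta> (1, jordan_block 1 c) = 0\<^sub>m 1 1" using \<eta>1[OF c] by (auto intro!: eq_matI)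
      moreover obtain Y where "Y \<in> carrier_mat 1 1" "\<eta> (1, jordan_block 1 c) * Y = 1\<^sub>m 1"
        using invertible_matE[OF tensor_auts_RD(3,2)[OF \<eta> jordan_block_GL[OF c, of 1]]] by metis
      ultimately have "0\<^sub>m 1 1 = (1\<^sub>m 1 :: complex mat)" by simp
      then have "(0\<^sub>m 1 1 :: complex mat) $$ (0, 0) = (1\<^sub>m 1) $$ (0, 0)" by simp
      then show False by simp
    qed
    show "\<gamma> (a * b) = \<gamma> a * \<gamma> b" if ab: "a \<noteq> 0" "b \<noteq> 0" for a b
    proof -
      have "kronecker (jordan_block 1 a) (jordan_block 1 b) = jordan_block 1 (a * b)"
        unfolding jordan_block_1 kronecker_scalar_left by (auto intro!: eq_matI)
      then have "\<eta> (1, jordan_block 1 (a * b)) = kronecker (\<eta> (1, jordan_block 1 a)) (\<eta> (1, jordan_block 1 b))"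
        using tensor_auts_RD(5)[OF \<eta> jordan_block_GL[OF ab(1), of 1] jordan_block_GL[OF ab(2), of 1]] by simp
      then have "\<gamma> (a * b) \<cdot>\<^sub>m 1\<^sub>m 1 = \<gamma> a \<cdot>\<^sub>m (\<gamma> b \<cdot>\<^sub>m 1\<^sub>m 1)"
        using ab by (simp only: \<eta>1 mult_eq_0_iff simp_thms kronecker_scalar_left)
      then have "(\<gamma> (a * b) \<cdot>\<^sub>m 1\<^sub>m 1) $$ (0, 0) = (\<gamma> a \<cdot>\<^sub>m (\<gamma> b \<cdot>\<^sub>m 1\<^sub>m 1)) $$ (0, 0)" by simp
      then show ?thesis by simp
    qed
  qed
  have "Zalg_act (\<gamma>, l) = \<eta>"
  proof (rule tensor_auts_eqI[OF Zalg_act_tensor_aut[OF Z] \<eta>])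
    show "Zalg_act (\<gamma>, l) (1, jordan_block 1 c) = \<eta> (1, jordan_block 1 c)" if "c \<noteq> 0" for c
      using Zalg_act_jordan_1[OF that] \<eta>1[OF that] by simp
    let ?X = "\<eta> (2, jordan_block 2 1)"
    note GL1 = jordan_block_GL[OF one_neq_zero, of 1] and GL2 = jordan_block_GL[OF one_neq_zero, of 2]
    have X: "?X \<in> carrier_mat 2 2" by (rule tensor_auts_RD(2)[OF \<eta> GL2])
    have 1: "\<eta> (1, jordan_block 1 1) = 1\<^sub>m 1"
      using tensor_auts_RD(6)[OF \<eta>] by (simp only: jordan_block_1 one_smult_mat)
    \<comment> \<open>the unit object is a subobject and a quotient of $J_2(1)$, which fixes all entries but one\<close>
    let ?i = "Matrix.mat 2 1 (\<lambda>(i, j). if i = 0 then 1 else 0 :: complex)"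
    let ?p = "Matrix.mat 1 2 (\<lambda>(i, j). if j = 1 then 1 else 0 :: complex)"
    have "?i * jordan_block 1 1 = jordan_block 2 1 * ?i"
      by (intro eq_matI) (auto simp: index_mult_sum[of _ _ 1] index_mult_sum[of _ 2 2] scalar_prod_def numeral_2_eq_2)
    from tensor_auts_RD(4)[OF \<eta> GL1 GL2 _ this] have i: "?i = ?X * ?i" unfolding 1 by simp
    have "?p * jordan_block 2 1 = jordan_block 1 1 * ?p"
      by (intro eq_matI) (auto simp: scalar_prod_def numeral_2_eq_2)
    from tensor_auts_RD(4)[OF \<eta> GL2 GL1 _ this] have p: "?p * ?X = ?p" unfolding 1 by simp
    have Xi: "(?X * ?i) $$ (i, 0) = ?X $$ (i, 0)" if "i < 2" for i
      using that by (subst index_mult_sum[OF X, of _ 1]) (auto simp: numeral_2_eq_2)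
    have pX: "(?p * ?X) $$ (0, j) = ?X $$ (1, j)" if "j < 2" for j
      using that by (subst index_mult_sum[OF _ X, of _ 1]) (auto simp: numeral_2_eq_2)
    have "?X $$ (0, 0) = 1" "?X $$ (1, 0) = 0" "?X $$ (1, 1) = 1"
      using Xi[of 0] Xi[of 1] pX[of 1] unfolding i[symmetric] p by simp_all
    then have "?X = Matrix.mat 2 2 (\<lambda>(i, j). if i = j then 1 else if i < j then l else 0)"
      using X by (intro eq_matI) (auto simp: l_def less_2_cases_iff)
    then show "Zalg_act (\<gamma>, l) (2, jordan_block 2 1) = ?X"
      using Zalg_act_jordan_2[where \<gamma> = \<gamma> and l = l] Zalg_carrierD(4)[OF Z] by simp
  qed
  then show ?thesis using Z by blast
qed

lemma Zalg_act_inj: "inj_on Zalg_act (carrier Zalg)"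
proof (rule inj_onI)
  fix x y assume xy: "x \<in> carrier Zalg" "y \<in> carrier Zalg" and eq: "Zalg_act x = Zalg_act y"
  obtain \<gamma> l \<gamma>' l' where x: "x = (\<gamma>, l)" and y: "y = (\<gamma>', l')" by (metis surj_pair)
  note g = Zalg_carrierD[OF xy(1)[unfolded x]] and g' = Zalg_carrierD[OF xy(2)[unfolded y]]
  have "\<gamma> c = \<gamma>' c" if "c \<noteq> 0" for c
  proof -
    have "(\<gamma> c \<cdot>\<^sub>m 1\<^sub>m 1) $$ (0, 0) = (\<gamma>' c \<cdot>\<^sub>m 1\<^sub>m 1) $$ (0, 0)"
      using eq Zalg_act_jordan_1[OF that] unfolding x y by metis
    then show ?thesis by simp
  qed
  then have "\<gamma> = \<gamma>'" using g(1) g'(1) by (intro extensionalityI[of _ "- {0}"]) auto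
  moreover have "l = l'"
  proof -
    have "Matrix.mat 2 2 (\<lambda>(i, j). if i = j then 1 else if i < j then l else 0) =
        Matrix.mat 2 2 (\<lambda>(i, j). if i = j then 1 else if i < j then l' else 0)"
      using eq Zalg_act_jordan_2[where \<gamma> = \<gamma> and l = l] Zalg_act_jordan_2[where \<gamma> = \<gamma>' and l = l'] g(4) g'(4)
      unfolding x y by simp
    then have "Matrix.mat 2 2 (\<lambda>(i, j). if i = j then 1 else if i < j then l else 0) $$ (0, 1) =
        Matrix.mat 2 2 (\<lambda>(i, j). if i = j then 1 else if i < j then l' else 0) $$ (0, 1)" by (rule arg_cong)
    then show ?thesis by simp
  qed
  ultimately show "x = y" using x y by simp
qed

lemma Zalg_act_iso: "Zalg_act \<in> iso Zalg (Aut_tensor R_cat)"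
proof -
  have "Zalg_act ` carrier Zalg = carrier (Aut_tensor R_cat)"
    using Zalg_act_surj Zalg_act_tensor_aut by (fastforce simp: Aut_tensor_def)
  then show ?thesis using Zalg_act_hom Zalg_act_inj by (simp add: iso_def bij_betw_def)
qed

section \<open>Laurent coefficients of morphisms of q-difference modules\<close>

text \<open>Morphisms are matrices of germs rather than of functions, so Laurent coefficients are taken of an
  arbitrary representative; they do not depend on its choice.\<close>

definition germ_coeff :: "int \<Rightarrow> mero_germ \<Rightarrow> complex" where
  "germ_coeff k g = fls_nth (laurent_expansion (rep_mero_germ g) 0) k"

lemma meromorphic_on_0_laurent: "f meromorphic_on {0} \<longleftrightarrow> (\<exists>L. f has_laurent_expansion L)"
  by (simp add: meromorphic_on_def)

lemma germ_coeff_germ: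
  assumes "f has_laurent_expansion L"
  shows "germ_coeff k (germ f) = fls_nth L k"
proof -
  define r where "r = rep_mero_germ (germ f)"
  have f: "f meromorphic_on {0}" using assms meromorphic_on_0_laurent by blast
  have "germ_rel r r"
    unfolding r_def by (rule Quotient3_rep_reflp[OF Quotient3_mero_germ])
  hence r: "r meromorphic_on {0}" by (simp add: germ_rel_def)
  have "germ r = germ f"
    unfolding r_def by (simp add: germ_def Quotient3_abs_rep[OF Quotient3_mero_germ])
  hence ev: "\<forall>\<^sub>F z in at 0. r z = f z" using germ_eq_iff[OF r f] by simp
  have "r has_laurent_expansion L" using has_laurent_expansion_cong[OF ev refl] assms by blast
  then have "laurent_expansion r 0 = L" by (rule laurent_expansion_0_eqI)
  then show ?thesis unfolding germ_coeff_def r_def by simp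
qed

lemma germ_add:
  assumes "f meromorphic_on {0}" "g meromorphic_on {0}"
  shows "germ f + germ g = germ (\<lambda>z. f z + g z)"
  unfolding germ_def using assms by (subst plus_mero_germ.abs_eq) (auto simp: germ_rel_def)

lemma germ_mult:
  assumes "f meromorphic_on {0}" "g meromorphic_on {0}"
  shows "germ f * germ g = germ (\<lambda>z. f z * g z)"
  unfolding germ_def using assms by (subst times_mero_germ.abs_eq) (auto simp: germ_rel_def)

lemma germ_laurent_cases:
  obtains f L where "f has_laurent_expansion L" "g = germ f"
  using germ_cases[of g] meromorphic_on_0_laurent by metis

lemma germ_coeff_add: "germ_coeff k (g + h) = germ_coeff k g + germ_coeff k h"
proof -
  obtain f L where f: "f has_laurent_expansion L" "g = germ f" by (rule germ_laurent_cases)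
  obtain f' L' where f': "f' has_laurent_expansion L'" "h = germ f'" by (rule germ_laurent_cases)
  have "g + h = germ (\<lambda>z. f z + f' z)"
    unfolding f f' by (rule germ_add) (use f f' meromorphic_on_0_laurent in blast)+
  then show ?thesis
    using germ_coeff_germ[OF has_laurent_expansion_add[OF f(1) f'(1)]] germ_coeff_germ[OF f(1)] germ_coeff_germ[OF f'(1)] f f' by simp
qed

lemma germ_coeff_0: "germ_coeff k 0 = 0"
  using germ_coeff_add[of k 0 0] by simp

lemma germ_coeff_sum: "germ_coeff k (\<Sum>i\<in>I. g i) = (\<Sum>i\<in>I. germ_coeff k (g i))"
  by (induction I rule: infinite_finite_induct) (simp_all add: germ_coeff_0 germ_coeff_add)

lemma germ_coeff_cmult: "germ_coeff k (germ_const c * g) = c * germ_coeff k g"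
proof -
  obtain f L where f: "f has_laurent_expansion L" "g = germ f" by (rule germ_laurent_cases)
  have "germ_const c * g = germ (\<lambda>z. c * f z)"
    unfolding f germ_const_def by (rule germ_mult) (use f meromorphic_on_0_laurent in auto)
  then show ?thesis
    using germ_coeff_germ[OF has_laurent_expansion_cmult_left[OF f(1)]] germ_coeff_germ[OF f(1)] f by simp
qed

lemma germ_coeff_sigma:
  assumes "q \<noteq> 0"
  shows "germ_coeff k (sigma q g) = q powi k * germ_coeff k g"
proof -
  obtain f L where f: "f has_laurent_expansion L" "g = germ f" by (rule germ_laurent_cases)
  have "(\<lambda>z. q * z) has_laurent_expansion fps_to_fls (fps_const q * fps_X)"
    by (rule has_laurent_expansion_fps) (intro fps_expansion_intros)
  from has_laurent_expansion_compose[OF f(1) this]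
  have "(f \<circ> (\<lambda>z. q * z)) has_laurent_expansion fls_compose_fps L (fps_const q * fps_X)"
    using assms by simp
  then have e: "(\<lambda>z. f (q * z)) has_laurent_expansion fls_compose_fps L (fps_const q * fps_X)"
    by (simp add: o_def)
  have "sigma q g = germ (\<lambda>z. f (q * z))"
    unfolding f(2) using f(1) meromorphic_on_0_laurent by (intro sigma_germ[OF assms]) blast
  then show ?thesis
    using germ_coeff_germ[OF e] germ_coeff_germ[OF f(1)] f by (simp add: fls_nth_fls_compose_fps_linear[OF assms])
qed

lemma germ_coeff_bounded_below: "\<exists>N. \<forall>k < N. germ_coeff k g = 0"
proof -
  obtain f L where f: "f has_laurent_expansion L" "g = germ f" by (rule germ_laurent_cases)
  then show ?thesis using germ_coeff_germ[OF f(1)] by (intro exI[of _ "fls_subdegree L"]) simp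
qed

text \<open>A germ with finitely many nonzero Laurent coefficients is a Laurent polynomial, so that its
  evaluation at a nonzero point is meaningful.\<close>

lemma germ_eval_finite:
  assumes z0: "z0 \<noteq> 0" and below: "\<And>k. k < - int N \<Longrightarrow> germ_coeff k g = 0" and above: "\<And>k. k \<ge> int M \<Longrightarrow> germ_coeff k g = 0"
  shows "germ_eval z0 g = (\<Sum>j<N + M. germ_coeff (int j - int N) g * z0 powi (int j - int N))"
proof -
  obtain f L where f: "f has_laurent_expansion L" "g = germ f" by (rule germ_laurent_cases)
  define c where "c j = germ_coeff (int j - int N) g" for j :: nat
  define p where "p = (\<Sum>j<N + M. monom (c j) j)"
  have p: "poly p z / z ^ N = (\<Sum>j<N + M. c j * z powi (int j - int N))" if "z \<noteq> 0" for z
    using that by (simp add: p_def poly_sum poly_monom sum_divide_distrib power_int_diff)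
  have "(\<lambda>z. \<Sum>j<N + M. c j * z powi (int j - int N)) has_laurent_expansion
      (\<Sum>j<N + M. fls_const (c j) * fls_X_intpow (int j - int N))"
    by (intro laurent_expansion_intros)
  also have "(\<Sum>j<N + M. fls_const (c j) * fls_X_intpow (int j - int N)) = L"
  proof (rule fls_eqI)
    fix k
    have "fls_nth (\<Sum>j<N + M. fls_const (c j) * fls_X_intpow (int j - int N)) k =
        (\<Sum>j<N + M. if int j = k + int N then germ_coeff k g else 0)"
      unfolding fls_nth_sum by (intro sum.cong) (auto simp: c_def)
    also have "\<dots> = germ_coeff k g"
    proof (cases "- int N \<le> k \<and> k < int M")
      case True
      then have "(\<Sum>j<N + M. if int j = k + int N then germ_coeff k g else 0) = (\<Sum>j<N + M. if j = nat (k + int N) then germ_coeff k g else 0)"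
        by (intro sum.cong) auto
      moreover have "nat (k + int N) < N + M" using True by linarith
      ultimately show ?thesis by simp
    next
      case False
      then have "germ_coeff k g = 0" using below above by force
      then show ?thesis by simp
    qed
    finally show "fls_nth (\<Sum>j<N + M. fls_const (c j) * fls_X_intpow (int j - int N)) k = fls_nth L k"
      using germ_coeff_germ[OF f(1)] f(2) by simp
  qed
  finally have e: "(\<lambda>z. \<Sum>j<N + M. c j * z powi (int j - int N)) has_laurent_expansion L" .
  have ev: "\<forall>\<^sub>F z in at 0. poly p z / z ^ N = (\<Sum>j<N + M. c j * z powi (int j - int N))"
    using p by (auto simp: eventually_at_filter)
  have h: "(\<lambda>z. poly p z / z ^ N) has_laurent_expansion L"
    by (rule iffD2[OF has_laurent_expansion_cong[OF ev refl] e])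
  have "\<forall>\<^sub>F z in at 0. f z = poly p z / z ^ N"
    using f(1) h unfolding has_laurent_expansion_def by (auto elim: eventually_elim2)
  then have "g = germ (\<lambda>z. poly p z / z ^ N)"
    unfolding f(2) using germ_eq_iff meromorphic_on_0_laurent f(1) h by blast
  then show ?thesis
    using germ_eval_laurent_poly[OF z0, of p N] p[OF z0] by (simp add: c_def)
qed

lemma P0_cat_simps [simp]:
  "Obj (P0_cat q z0) = GL_objects" "tens (P0_cat q z0) = obj_tensor" "unit_obj (P0_cat q z0) = (1, 1\<^sub>m 1)"
  "fdim (P0_cat q z0) = fst" "fmor (P0_cat q z0) = map_mat (germ_eval z0)"
  "Hom (P0_cat q z0) (n, A) (p, B) = {F \<in> carrier_mat p n.
       map_mat (sigma q) F * map_mat germ_const A = map_mat germ_const B * F}"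
  by (simp_all add: P0_cat_def)

text \<open>Comparison of the coefficients of $z^k$ in $F(qz) A = B F(z)$.\<close>

lemma P0_coeff_intertwine:
  assumes q: "q \<noteq> 0" and A: "A \<in> carrier_mat n n" and B: "B \<in> carrier_mat p p"
    and F: "F \<in> Hom (P0_cat q z0) (n, A) (p, B)"
  shows "map_mat (germ_coeff k) F * (q powi k \<cdot>\<^sub>m A) = B * map_mat (germ_coeff k) F"
proof (rule eq_matI)
  let ?G = "map_mat (germ_coeff k) F"
  have cF: "F \<in> carrier_mat p n" and eq: "map_mat (sigma q) F * map_mat germ_const A = map_mat germ_const B * F"
    using F by auto
  have G: "?G \<in> carrier_mat p n" and sF: "map_mat (sigma q) F \<in> carrier_mat p n" using cF by auto
  have cA: "map_mat germ_const A \<in> carrier_mat n n" and cB: "map_mat germ_const B \<in> carrier_mat p p" and qA: "q powi k \<cdot>\<^sub>m A \<in> carrier_mat n n"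
    using A B by auto
  fix i j assume "i < dim_row (B * ?G)" "j < dim_col (B * ?G)"
  then have ij: "i < p" "j < n" using B cF by auto
  have "(?G * (q powi k \<cdot>\<^sub>m A)) $$ (i, j) = (\<Sum>a<n. germ_coeff k (map_mat (sigma q) F $$ (i, a) * map_mat germ_const A $$ (a, j)))"
    unfolding index_mult_sum[OF G qA ij] using ij cF A
    by (intro sum.cong) (auto simp: germ_coeff_sigma[OF q] germ_coeff_cmult mult.commute[of _ "germ_const _"])
  also have "\<dots> = germ_coeff k ((map_mat (sigma q) F * map_mat germ_const A) $$ (i, j))"
    unfolding index_mult_sum[OF sF cA ij] germ_coeff_sum ..
  also have "\<dots> = (\<Sum>a<p. germ_coeff k (map_mat germ_const B $$ (i, a) * F $$ (a, j)))"
    unfolding eq index_mult_sum[OF cB cF ij] germ_coeff_sum ..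
  also have "\<dots> = (B * ?G) $$ (i, j)"
    unfolding index_mult_sum[OF B G ij] using ij cF B by (intro sum.cong) (auto simp: germ_coeff_cmult)
  finally show "(?G * (q powi k \<cdot>\<^sub>m A)) $$ (i, j) = (B * ?G) $$ (i, j)" .
qed (use A B F in auto)

text \<open>Any submultiplicative norm would do; this one has elementary proofs for rectangular matrices.\<close>

definition mat_sum_norm :: "complex mat \<Rightarrow> real" where
  "mat_sum_norm X = (\<Sum>i<dim_row X. \<Sum>j<dim_col X. norm (X $$ (i, j)))"

lemma mat_sum_norm_nonneg: "mat_sum_norm X \<ge> 0"
  unfolding mat_sum_norm_def by (intro sum_nonneg) auto

lemma mat_sum_norm_eq_0:
  assumes "X \<in> carrier_mat p n" "mat_sum_norm X = 0"
  shows "X = 0\<^sub>m p n"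
proof (rule eq_matI)
  fix i j assume "i < dim_row (0\<^sub>m p n :: complex mat)" "j < dim_col (0\<^sub>m p n :: complex mat)"
  then have ij: "i < dim_row X" "j < dim_col X" using assms by auto
  have "(\<Sum>j<dim_col X. norm (X $$ (i, j))) = 0"
    using assms(2) ij(1) unfolding mat_sum_norm_def by (subst (asm) sum_nonneg_eq_0_iff) (auto intro: sum_nonneg)
  then have "norm (X $$ (i, j)) = 0" using ij(2) by (subst (asm) sum_nonneg_eq_0_iff) auto
  then show "X $$ (i, j) = 0\<^sub>m p n $$ (i, j)" using ij assms by simp
qed (use assms in auto)

lemma mat_sum_norm_smult: "mat_sum_norm (c \<cdot>\<^sub>m X) = norm c * mat_sum_norm X"
  by (simp add: mat_sum_norm_def norm_mult sum_distrib_left)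

lemma mat_sum_norm_mult:
  assumes X: "X \<in> carrier_mat p n" and Y: "Y \<in> carrier_mat n m"
  shows "mat_sum_norm (X * Y) \<le> mat_sum_norm X * mat_sum_norm Y"
proof -
  have "mat_sum_norm (X * Y) = (\<Sum>i<p. \<Sum>j<m. norm (\<Sum>a<n. X $$ (i, a) * Y $$ (a, j)))"
    using X Y unfolding mat_sum_norm_def by (intro sum.cong) (auto simp: index_mult_sum[OF X Y] simp del: index_mult_mat(1))
  also have "\<dots> \<le> (\<Sum>i<p. \<Sum>j<m. \<Sum>a<n. norm (X $$ (i, a)) * norm (Y $$ (a, j)))"
    by (intro sum_mono order.trans[OF norm_sum]) (simp add: norm_mult)
  also have "\<dots> \<le> (\<Sum>i<p. \<Sum>j<m. \<Sum>a<n. norm (X $$ (i, a)) * (\<Sum>b<n. norm (Y $$ (b, j))))"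
    by (intro sum_mono mult_left_mono member_le_sum) auto
  also have "\<dots> = (\<Sum>i<p. \<Sum>a<n. norm (X $$ (i, a))) * (\<Sum>j<m. \<Sum>b<n. norm (Y $$ (b, j)))"
    unfolding sum_product[where f = "\<lambda>i. \<Sum>a<n. norm (X $$ (i, a))"] by (simp only: sum_distrib_right)
  also have "(\<Sum>j<m. \<Sum>b<n. norm (Y $$ (b, j))) = (\<Sum>b<n. \<Sum>j<m. norm (Y $$ (b, j)))" by (rule sum.swap)
  finally show ?thesis using X Y by (simp add: mat_sum_norm_def)
qed

text \<open>From $q^k F_k = B F_k A^{-1}$ follows $|q|^k \|F_k\| \le \|B\| \|A^{-1}\| \|F_k\|$, which
  forces $F_k = 0$ once $|q|^k$ exceeds $\|B\| \|A^{-1}\|$. This is where $|q| > 1$ enters.\<close>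

lemma P0_coeff_bounded_above:
  assumes q: "norm q > 1" and A: "(n, A) \<in> GL_objects" and B: "(p, B) \<in> GL_objects"
    and F: "F \<in> Hom (P0_cat q z0) (n, A) (p, B)"
  shows "\<exists>M. \<forall>k \<ge> int M. map_mat (germ_coeff k) F = 0\<^sub>m p n"
proof -
  have q0: "q \<noteq> 0" using q by auto
  have cA: "A \<in> carrier_mat n n" "invertible_mat A" and cB: "B \<in> carrier_mat p p" using A B by (auto simp: GL_objects_iff)
  obtain A' where A': "A' \<in> carrier_mat n n" "A * A' = 1\<^sub>m n" using invertible_matE cA by metis
  obtain M where M: "mat_sum_norm B * mat_sum_norm A' < norm q ^ M" using real_arch_pow[OF q] by blast
  show ?thesis
  proof (intro exI[of _ M] allI impI)
    fix k assume k: "k \<ge> int M"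
    let ?G = "map_mat (germ_coeff k) F"
    have G: "?G \<in> carrier_mat p n" using F by auto
    have "q powi k \<cdot>\<^sub>m ?G = q powi k \<cdot>\<^sub>m (?G * (A * A'))" using A' G by simp
    also have "\<dots> = ?G * (q powi k \<cdot>\<^sub>m A) * A'"
      using assoc_mult_mat[OF G cA(1) A'(1)] mult_smult_distrib[OF G cA(1)]
        mult_smult_assoc_mat[OF mult_carrier_mat[OF G cA(1)] A'(1)] by metis
    also have "\<dots> = B * ?G * A'" unfolding P0_coeff_intertwine[OF q0 cA(1) cB F] ..
    finally have "norm (q powi k) * mat_sum_norm ?G = mat_sum_norm (B * ?G * A')"
      using mat_sum_norm_smult by metis
    also have "\<dots> \<le> mat_sum_norm (B * ?G) * mat_sum_norm A'"
      by (rule mat_sum_norm_mult[OF mult_carrier_mat[OF cB G] A'(1)])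
    also have "\<dots> \<le> mat_sum_norm B * mat_sum_norm ?G * mat_sum_norm A'"
      by (intro mult_right_mono mat_sum_norm_mult[OF cB G] mat_sum_norm_nonneg)
    finally have le: "norm (q powi k) * mat_sum_norm ?G \<le> (mat_sum_norm B * mat_sum_norm A') * mat_sum_norm ?G"
      by (simp add: mult_ac)
    have "norm q ^ M \<le> norm q ^ nat k" using k q by (intro power_increasing) auto
    also have "\<dots> = norm (q powi k)" using k by (simp add: power_int_def norm_power)
    finally have lt: "mat_sum_norm B * mat_sum_norm A' < norm (q powi k)" using M by simp
    have "mat_sum_norm ?G = 0"
    proof (rule ccontr)
      assume "mat_sum_norm ?G \<noteq> 0"
      then have "mat_sum_norm ?G > 0" using mat_sum_norm_nonneg[of ?G] by simp
      then show False using mult_strict_right_mono[OF lt, of "mat_sum_norm ?G"] le by simp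
    qed
    then show "?G = 0\<^sub>m p n" by (rule mat_sum_norm_eq_0[OF G])
  qed
qed

lemma P0_coeff_bounded_below:
  assumes F: "F \<in> carrier_mat p n"
  shows "\<exists>N. \<forall>i<p. \<forall>j<n. \<forall>k < - int N. germ_coeff k (F $$ (i, j)) = 0"
proof -
  have "\<exists>N. \<forall>g. \<forall>k < N g. germ_coeff k g = 0"
    using germ_coeff_bounded_below by (intro choice) blast
  then obtain N' where N': "\<And>g k. k < N' g \<Longrightarrow> germ_coeff k g = 0" by blast
  define N where "N i j = N' (F $$ (i, j))" for i j
  have N: "\<And>i j k. k < N i j \<Longrightarrow> germ_coeff k (F $$ (i, j)) = 0"
    unfolding N_def by (rule N')
  define K where "K = (\<Sum>i<p. \<Sum>j<n. nat \<bar>N i j\<bar>)"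
  have le: "nat \<bar>N i j\<bar> \<le> K" if "i < p" "j < n" for i j
  proof -
    have "nat \<bar>N i j\<bar> \<le> (\<Sum>j<n. nat \<bar>N i j\<bar>)" using that by (intro member_le_sum) auto
    also have "\<dots> \<le> K" unfolding K_def using that by (intro member_le_sum[of i _ "\<lambda>i. \<Sum>j<n. nat \<bar>N i j\<bar>"]) auto
    finally show ?thesis .
  qed
  show ?thesis
  proof (intro exI[of _ K] allI impI)
    fix i j k assume "i < p" "j < n" "k < - int K"
    then show "germ_coeff k (F $$ (i, j)) = 0" using le[of i j] by (intro N) linarith
  qed
qed

section \<open>Tensor automorphisms of q-difference modules\<close>

lemma Zalg_powi:
  assumes Z: "(\<gamma>, l) \<in> carrier Zalg" and q: "q \<noteq> 0" "\<gamma> q = 1"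
  shows "\<gamma> (q powi k) = 1"
proof -
  note g = Zalg_carrierD[OF Z]
  have pow: "\<gamma> (q ^ m) = 1" for m
    by (induction m) (use g q in auto)
  show ?thesis
  proof (cases "k \<ge> 0")
    case True
    then show ?thesis using pow by (simp add: power_int_def)
  next
    case False
    have "\<gamma> (inverse q ^ nat (- k)) * \<gamma> (q ^ nat (- k)) = \<gamma> 1"
      using g(3)[of "inverse q ^ nat (- k)" "q ^ nat (- k)"] q by (simp flip: power_mult_distrib)
    then show ?thesis using False pow g(4) by (simp add: power_int_def)
  qed
qed

text \<open>Each coefficient $F_k$ is a morphism of representations from $q^k A = (1, q^k) \otimes A$ to $B$. The
  action on the source is $\gamma(q^k) = 1$ times the action on $A$, so every $F_k$, and with
  them the finite sum $F(z_0)$, is compatible with the action.\<close>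

lemma Zalg_act_natural_P0:
  assumes q: "norm q > 1" and z0: "z0 \<noteq> 0" and Z: "(\<gamma>, l) \<in> carrier Zalg" and \<gamma>q: "\<gamma> q = 1"
    and A: "(n, A) \<in> GL_objects" and B: "(p, B) \<in> GL_objects"
    and F: "F \<in> Hom (P0_cat q z0) (n, A) (p, B)"
  shows "map_mat (germ_eval z0) F * Zalg_act (\<gamma>, l) (n, A) = Zalg_act (\<gamma>, l) (p, B) * map_mat (germ_eval z0) F"
proof -
  let ?\<eta> = "Zalg_act (\<gamma>, l)"
  let ?E = "map_mat (germ_eval z0) F"
  define G where "G k = map_mat (germ_coeff k) F" for k
  have q0: "q \<noteq> 0" using q by auto
  have \<eta>: "?\<eta> \<in> tensor_auts R_cat" by (rule Zalg_act_tensor_aut[OF Z])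
  note \<eta>D = tensor_auts_RD[OF \<eta>]
  have cF: "F \<in> carrier_mat p n" using F by simp
  have cA: "A \<in> carrier_mat n n" and cB: "B \<in> carrier_mat p p" using A B by (auto simp: GL_objects_iff)
  have G: "G k \<in> carrier_mat p n" for k using cF by (simp add: G_def)
  have nat: "G k * ?\<eta> (n, A) = ?\<eta> (p, B) * G k" for k
  proof -
    have qk: "q powi k \<noteq> 0" using q0 by simp
    note GLq = jordan_block_GL[OF qk, of 1]
    have K: "kronecker (jordan_block 1 (q powi k)) A = q powi k \<cdot>\<^sub>m A" unfolding jordan_block_1 kronecker_scalar_left ..
    have GLqA: "(n, q powi k \<cdot>\<^sub>m A) \<in> GL_objects" using kronecker_GL[OF GLq A] K by simp
    have "?\<eta> (n, q powi k \<cdot>\<^sub>m A) = kronecker (?\<eta> (1, jordan_block 1 (q powi k))) (?\<eta> (n, A))"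
      using \<eta>D(5)[OF GLq A] K by simp
    also have "\<dots> = ?\<eta> (n, A)"
      unfolding Zalg_act_jordan_1[OF qk] kronecker_scalar_left Zalg_powi[OF Z q0 \<gamma>q] by (rule one_smult_mat)
    finally have e: "?\<eta> (n, q powi k \<cdot>\<^sub>m A) = ?\<eta> (n, A)" .
    show ?thesis
      using \<eta>D(4)[OF GLqA B G P0_coeff_intertwine[OF q0 cA cB F, of k, folded G_def]] unfolding e .
  qed
  obtain M where M: "\<And>k. k \<ge> int M \<Longrightarrow> G k = 0\<^sub>m p n"
    using P0_coeff_bounded_above[OF q A B F] unfolding G_def by blast
  obtain N where N: "\<And>i j k. i < p \<Longrightarrow> j < n \<Longrightarrow> k < - int N \<Longrightarrow> germ_coeff k (F $$ (i, j)) = 0"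
    using P0_coeff_bounded_below[OF cF] by blast
  have E: "?E \<in> carrier_mat p n" using cF by simp
  let ?z = "\<lambda>t. z0 powi (int t - int N)"
  have Eij: "?E $$ (i, j) = (\<Sum>t<N + M. G (int t - int N) $$ (i, j) * ?z t)" if ij: "i < p" "j < n" for i j
  proof -
    have "germ_coeff k (F $$ (i, j)) = 0" if "k \<ge> int M" for k
    proof -
      have "germ_coeff k (F $$ (i, j)) = G k $$ (i, j)" using ij cF by (simp add: G_def)
      then show ?thesis using M[OF that] ij by simp
    qed
    then have "germ_eval z0 (F $$ (i, j)) = (\<Sum>t<N + M. germ_coeff (int t - int N) (F $$ (i, j)) * ?z t)"
      using germ_eval_finite[OF z0, of N "F $$ (i, j)" M] N[OF ij] by blast
    then show ?thesis using ij cF by (simp add: G_def)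
  qed
  have c: "?\<eta> (n, A) \<in> carrier_mat n n" "?\<eta> (p, B) \<in> carrier_mat p p" using \<eta>D(2) A B by blast+
  show ?thesis
  proof (rule eq_matI)
    fix i j assume "i < dim_row (?\<eta> (p, B) * ?E)" "j < dim_col (?\<eta> (p, B) * ?E)"
    then have ij: "i < p" "j < n" using c E by auto
    have "(?E * ?\<eta> (n, A)) $$ (i, j) = (\<Sum>a<n. (\<Sum>t<N + M. G (int t - int N) $$ (i, a) * ?z t) * ?\<eta> (n, A) $$ (a, j))"
      unfolding index_mult_sum[OF E c(1) ij] using ij(1) by (intro sum.cong) (simp_all only: Eij lessThan_iff)
    also have "\<dots> = (\<Sum>t<N + M. (G (int t - int N) * ?\<eta> (n, A)) $$ (i, j) * ?z t)"
      unfolding index_mult_sum[OF G c(1) ij] sum_distrib_right by (subst sum.swap) (simp add: mult_ac)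
    also have "\<dots> = (\<Sum>t<N + M. (?\<eta> (p, B) * G (int t - int N)) $$ (i, j) * ?z t)" unfolding nat ..
    also have "\<dots> = (\<Sum>a<p. ?\<eta> (p, B) $$ (i, a) * (\<Sum>t<N + M. G (int t - int N) $$ (a, j) * ?z t))"
      unfolding index_mult_sum[OF c(2) G ij] sum_distrib_right sum_distrib_left by (subst sum.swap) (simp add: mult_ac)
    also have "\<dots> = (?\<eta> (p, B) * ?E) $$ (i, j)"
      unfolding index_mult_sum[OF c(2) E ij] using ij(2) by (intro sum.cong) (simp_all only: Eij lessThan_iff)
    finally show "(?E * ?\<eta> (n, A)) $$ (i, j) = (?\<eta> (p, B) * ?E) $$ (i, j)" .
  qed (use c E in auto)
qed

text \<open>The two categories have the same objects and tensor products, and constant matrices are morphisms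
  of both. Only naturality with respect to the nonconstant morphisms is a new condition.\<close>

lemma tensor_auts_P0_iff:
  assumes q: "q \<noteq> 0" and z0: "z0 \<noteq> 0"
  shows "\<eta> \<in> tensor_auts (P0_cat q z0) \<longleftrightarrow> \<eta> \<in> tensor_auts R_cat \<and>
    (\<forall>X\<in>GL_objects. \<forall>Y\<in>GL_objects. \<forall>F\<in>Hom (P0_cat q z0) X Y. map_mat (germ_eval z0) F * \<eta> X = \<eta> Y * map_mat (germ_eval z0) F)"
proof -
  have "F * \<eta> X = \<eta> Y * F"
    if nat: "\<forall>X\<in>GL_objects. \<forall>Y\<in>GL_objects. \<forall>F\<in>Hom (P0_cat q z0) X Y. map_mat (germ_eval z0) F * \<eta> X = \<eta> Y * map_mat (germ_eval z0) F"
      and XY: "X \<in> GL_objects" "Y \<in> GL_objects" "F \<in> Hom R_cat X Y" for X Y F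
  proof -
    have "map_mat germ_const F \<in> Hom (P0_cat q z0) X Y" using R_embeds_in_P0[OF q] XY by simp
    moreover have "map_mat (germ_eval z0) (map_mat germ_const F) = F" using P0_fibre_on_R[OF z0, of q F] by simp
    ultimately show ?thesis using nat XY(1,2) by metis
  qed
  then show ?thesis unfolding tensor_auts_def by auto
qed

text \<open>The function $z$ is a morphism from $(1, 1)$ to $(1, q)$ with the nonzero value $z_0$.\<close>

lemma P0_aut_gamma_q:
  assumes q: "q \<noteq> 0" and z0: "z0 \<noteq> 0" and \<eta>: "Zalg_act (\<gamma>, l) \<in> tensor_auts (P0_cat q z0)" and Z: "(\<gamma>, l) \<in> carrier Zalg"
  shows "\<gamma> q = 1"
proof -
  let ?F = "Matrix.mat 1 1 (\<lambda>_. germ (\<lambda>z. z)) :: mero_germ mat"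
  have id: "(\<lambda>z. z) meromorphic_on {0}" by (intro meromorphic_intros)
  have "sigma q (germ (\<lambda>z. z)) = germ (\<lambda>z. q * z)" by (rule sigma_germ[OF q id])
  also have "\<dots> = germ_const q * germ (\<lambda>z. z)" unfolding germ_const_def by (subst germ_mult) (auto intro: id)
  finally have s: "sigma q (germ (\<lambda>z. z)) = germ_const q * germ (\<lambda>z. z)" .
  have "germ_const 1 = 1" unfolding germ_const_def germ_def one_mero_germ_def ..
  then have "map_mat (sigma q) ?F * map_mat germ_const (jordan_block 1 1) = map_mat germ_const (jordan_block 1 q) * ?F"
    by (intro eq_matI) (auto simp: scalar_prod_def s)
  then have F: "?F \<in> Hom (P0_cat q z0) (1, jordan_block 1 1) (1, jordan_block 1 q)" by simp
  have "germ_eval z0 (germ (\<lambda>z. z)) = z0" using germ_eval_laurent_poly[OF z0, of "[:0, 1:]" 0] by simp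
  then have E: "map_mat (germ_eval z0) ?F = z0 \<cdot>\<^sub>m 1\<^sub>m 1" by (intro eq_matI) auto
  have "map_mat (germ_eval z0) ?F * Zalg_act (\<gamma>, l) (1, jordan_block 1 1) = Zalg_act (\<gamma>, l) (1, jordan_block 1 q) * map_mat (germ_eval z0) ?F"
  proof -
    have "\<forall>X\<in>GL_objects. \<forall>Y\<in>GL_objects. \<forall>F\<in>Hom (P0_cat q z0) X Y.
        map_mat (germ_eval z0) F * Zalg_act (\<gamma>, l) X = Zalg_act (\<gamma>, l) Y * map_mat (germ_eval z0) F"
      using \<eta> tensor_auts_P0_iff[OF q z0] by simp
    from bspec[OF bspec[OF bspec[OF this jordan_block_GL[OF one_neq_zero]] jordan_block_GL[OF q]] F] show ?thesis .
  qed
  then have "z0 \<cdot>\<^sub>m 1\<^sub>m 1 * (\<gamma> 1 \<cdot>\<^sub>m 1\<^sub>m 1) = \<gamma> q \<cdot>\<^sub>m 1\<^sub>m 1 * (z0 \<cdot>\<^sub>m 1\<^sub>m 1)"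
    unfolding E Zalg_act_jordan_1[OF one_neq_zero] Zalg_act_jordan_1[OF q] .
  then have "(z0 \<cdot>\<^sub>m 1\<^sub>m 1 * (\<gamma> 1 \<cdot>\<^sub>m 1\<^sub>m 1)) $$ (0, 0) = (\<gamma> q \<cdot>\<^sub>m 1\<^sub>m 1 * (z0 \<cdot>\<^sub>m 1\<^sub>m 1)) $$ (0, 0)" by (rule arg_cong)
  then show ?thesis using z0 Zalg_carrierD(4)[OF Z] by (simp add: scalar_prod_def)
qed

theorem mainTheorem8:
  fixes q z0 :: complex
  assumes "norm q > 1" and "z0 \<noteq> 0"
  shows "Zalg_act \<in> iso Zalg (Aut_tensor R_cat) \<and>
    restrict_to_R \<in> mon (Aut_tensor (P0_cat q z0)) (Aut_tensor R_cat) \<and>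
    restrict_to_R ` carrier (Aut_tensor (P0_cat q z0)) =
      Zalg_act ` {(\<gamma>, l) \<in> carrier Zalg. \<gamma> q = 1}"
proof -
  have q0: "q \<noteq> 0" using assms(1) by auto
  note iff = tensor_auts_P0_iff[OF q0 assms(2)]
  have res: "restrict_to_R \<eta> = \<eta>" if "\<eta> \<in> tensor_auts R_cat" for \<eta>
    using tensor_auts_RD(1)[OF that] by (simp add: restrict_to_R_def extensional_restrict)
  have carr: "carrier (Aut_tensor (P0_cat q z0)) \<subseteq> tensor_auts R_cat" "carrier (Aut_tensor (P0_cat q z0)) = tensor_auts (P0_cat q z0)"
    using iff by (auto simp: Aut_tensor_def)
  have "restrict_to_R \<in> hom (Aut_tensor (P0_cat q z0)) (Aut_tensor R_cat)"
  proof (rule homI)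
    show "restrict_to_R \<eta> \<in> carrier (Aut_tensor R_cat)" if "\<eta> \<in> carrier (Aut_tensor (P0_cat q z0))" for \<eta>
      using that carr res by (auto simp: Aut_tensor_def)
    show "restrict_to_R (\<eta> \<otimes>\<^bsub>Aut_tensor (P0_cat q z0)\<^esub> \<theta>) = restrict_to_R \<eta> \<otimes>\<^bsub>Aut_tensor R_cat\<^esub> restrict_to_R \<theta>" for \<eta> \<theta>
      by (auto simp: Aut_tensor_def restrict_to_R_def)
  qed
  moreover have "inj_on restrict_to_R (carrier (Aut_tensor (P0_cat q z0)))"
    using carr(1) res by (intro inj_onI) (metis subsetD)
  moreover have "restrict_to_R ` carrier (Aut_tensor (P0_cat q z0)) = id ` carrier (Aut_tensor (P0_cat q z0))"
    by (rule image_cong) (use carr(1) res in auto)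
  then have "restrict_to_R ` carrier (Aut_tensor (P0_cat q z0)) = tensor_auts (P0_cat q z0)"
    by (simp only: image_id id_apply carr(2))
  moreover have "tensor_auts (P0_cat q z0) = Zalg_act ` {(\<gamma>, l) \<in> carrier Zalg. \<gamma> q = 1}"
  proof (intro equalityI subsetI)
    fix \<eta> assume \<eta>: "\<eta> \<in> tensor_auts (P0_cat q z0)"
    then obtain z where z: "z \<in> carrier Zalg" "Zalg_act z = \<eta>" using iff Zalg_act_surj by blast
    obtain \<gamma> l where "z = (\<gamma>, l)" by force
    then show "\<eta> \<in> Zalg_act ` {(\<gamma>, l) \<in> carrier Zalg. \<gamma> q = 1}"
      using z P0_aut_gamma_q[OF q0 assms(2), of \<gamma> l] \<eta> by auto
  next
    fix \<eta> assume "\<eta> \<in> Zalg_act ` {(\<gamma>, l) \<in> carrier Zalg. \<gamma> q = 1}"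
    then obtain \<gamma> l where z: "(\<gamma>, l) \<in> carrier Zalg" "\<gamma> q = 1" "\<eta> = Zalg_act (\<gamma>, l)" by auto
    show "\<eta> \<in> tensor_auts (P0_cat q z0)"
      unfolding iff z(3) using Zalg_act_tensor_aut[OF z(1)] Zalg_act_natural_P0[OF assms z(1,2)] by auto
  qed
  ultimately show ?thesis using Zalg_act_iso by (simp add: mon_def)
qed

end
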